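(* There is a constant $c = \exp(-O(k))$ and a randomized algorithm running in time $\mathrm{poly}(m,n,\exp(k))$ that, given a triangle-free CSP instance $\Im$ on $n$ Boolean variables with $m$ arbitrary constraints, each of arity between $2$ and $k$, in which every variable has degree at most $D$, finds with high probability an assignment $x \in \{\pm1\}^n$ such that \[ \mathrm{val}_{\Im}(x) \geq \mu + \frac{c}{\sqrt{D}}, \] where $\mu$ is the expected fraction of constraints of $\Im$ satisfied by a uniformly random assignment.
   Context: A CSP instance has Boolean variables $x_1,\dots,x_n \in \{\pm1\}$ and $m$ constraints $(P_\ell,S_\ell)$, $\ell\in[m]$, where the scope $S_\ell$ is an ordered $r$-tuple of distinct indices in $[n]$ ($r$ is the arity) and the predicate $P_\ell:\{\pm1\}^r\to\{0,1\}$ depends on all $r$ of its coordinates; the constraint is satisfied by $x$ iff $P_\ell(x_{S_\ell})=1$. The degree of variable $x_i$ is the number of constraints whose scope contains $i$. $\mathrm{val}_\Im(x)$ is the fraction of constraints satisfied by $x$. An instance is triangle-free if the scopes of any two distinct constraints intersect in at most one variable, and there are no three distinct constraints whose scopes pairwise intersect. *)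

theory Defs
  imports "HOL-Probability.Probability" "HOL-Library.Landau_Symbols"
begin

section \<open>CSP instances\<close>

text \<open>The variables are indexed by \<open>{..<n}\<close> and the constraints by their position in a list.
  The values of a predicate are only relevant on lists of signs whose length is the arity.\<close>

datatype constr = Constr (predic: "int list \<Rightarrow> bool") (scope: "nat list")

definition arity :: "constr \<Rightarrow> nat" where
  "arity C = length (scope C)"

definition sign_lists :: "nat \<Rightarrow> int list set" where
  "sign_lists r = {y. length y = r \<and> set y \<subseteq> {-1, 1}}"

definition depends_on_all :: "constr \<Rightarrow> bool" where
  "depends_on_all C \<longleftrightarrow> (\<forall>j < arity C. \<exists>y \<in> sign_lists (arity C).
     predic C y \<noteq> predic C (y[j := - (y ! j)]))"

definition csp_instance :: "nat \<Rightarrow> constr list \<Rightarrow> bool" where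
  "csp_instance n I \<longleftrightarrow>
     (\<forall>C \<in> set I. distinct (scope C) \<and> set (scope C) \<subseteq> {..<n} \<and> depends_on_all C)"

definition var_degree :: "constr list \<Rightarrow> nat \<Rightarrow> nat" where
  "var_degree I i = card {l. l < length I \<and> i \<in> set (scope (I ! l))}"

text \<open>Three constraints through one common variable intersect pairwise, but they are not a
  triangle (otherwise triangle-freeness would force every degree to be at most 2).  As two scopes
  share at most one variable, an empty triple intersection says that the three pairwise
  intersections are three different variables.  Lemma \<open>triangle_freeI\<close> shows that forbidding
  every pairwise intersecting triple is a special case.\<close>

definition triangle_free :: "constr list \<Rightarrow> bool" where
  "triangle_free I \<longleftrightarrow>
     (\<forall>a < length I. \<forall>b < length I. a \<noteq> b \<longrightarrow>
        card (set (scope (I ! a)) \<inter> set (scope (I ! b))) \<le> 1) \<and>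
     \<not> (\<exists>a < length I. \<exists>b < length I. \<exists>c < length I. a \<noteq> b \<and> b \<noteq> c \<and> a \<noteq> c \<and>
        set (scope (I ! a)) \<inter> set (scope (I ! b)) \<noteq> {} \<and>
        set (scope (I ! b)) \<inter> set (scope (I ! c)) \<noteq> {} \<and>
        set (scope (I ! a)) \<inter> set (scope (I ! c)) \<noteq> {} \<and>
        set (scope (I ! a)) \<inter> set (scope (I ! b)) \<inter> set (scope (I ! c)) = {})"

lemma triangle_freeI:
  assumes "\<And>a b. a < length I \<Longrightarrow> b < length I \<Longrightarrow> a \<noteq> b \<Longrightarrow>
             card (set (scope (I ! a)) \<inter> set (scope (I ! b))) \<le> 1"
    and "\<not> (\<exists>a < length I. \<exists>b < length I. \<exists>c < length I. a \<noteq> b \<and> b \<noteq> c \<and> a \<noteq> c \<and>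
           set (scope (I ! a)) \<inter> set (scope (I ! b)) \<noteq> {} \<and>
           set (scope (I ! b)) \<inter> set (scope (I ! c)) \<noteq> {} \<and>
           set (scope (I ! a)) \<inter> set (scope (I ! c)) \<noteq> {})"
  shows "triangle_free I"
  using assms unfolding triangle_free_def by blast

definition assignments :: "nat \<Rightarrow> (nat \<Rightarrow> int) set" where
  "assignments n = ({..<n} \<rightarrow>\<^sub>E {-1, 1})"

definition satisfies :: "(nat \<Rightarrow> int) \<Rightarrow> constr \<Rightarrow> bool" where
  "satisfies x C \<longleftrightarrow> predic C (map x (scope C))"

definition csp_val :: "constr list \<Rightarrow> (nat \<Rightarrow> int) \<Rightarrow> real" where
  "csp_val I x = real (card {l. l < length I \<and> satisfies x (I ! l)}) / real (length I)"

definition random_val :: "nat \<Rightarrow> constr list \<Rightarrow> real" where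
  "random_val n I = measure_pmf.expectation (pmf_of_set (assignments n)) (csp_val I)"


section \<open>Randomized algorithms\<close>

text \<open>Algorithms are programs of a randomized random-access machine: a structured language over
  finitely many named arrays of natural numbers with indirect addressing, and an instruction that
  stores a fair coin flip in a cell.  The running time is the number of execution steps.
  An expression occurring in a program has a fixed size and there is no multiplication, so one step
  lengthens the numbers in memory by at most a constant number of bits; hence running times
  are polynomially related to those of probabilistic Turing machines.\<close>

type_synonym mem = "string \<Rightarrow> nat \<Rightarrow> nat"

datatype aexp = Num nat | Cell string aexp | Plus aexp aexp | Minus aexp aexp

datatype bexp = Less aexp aexp | Neg bexp | And bexp bexp

datatype com =
    SKIP
  | Store string aexp aexp
  | Flip string aexp
  | Seq com com
  | Cond bexp com com
  | While bexp com

primrec aval :: "aexp \<Rightarrow> mem \<Rightarrow> nat" where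
  "aval (Num k) s = k"
| "aval (Cell v e) s = s v (aval e s)"
| "aval (Plus e1 e2) s = aval e1 s + aval e2 s"
| "aval (Minus e1 e2) s = aval e1 s - aval e2 s"

primrec bval :: "bexp \<Rightarrow> mem \<Rightarrow> bool" where
  "bval (Less e1 e2) s \<longleftrightarrow> aval e1 s < aval e2 s"
| "bval (Neg b) s \<longleftrightarrow> \<not> bval b s"
| "bval (And b1 b2) s \<longleftrightarrow> bval b1 s \<and> bval b2 s"

definition write_cell :: "string \<Rightarrow> nat \<Rightarrow> nat \<Rightarrow> mem \<Rightarrow> mem" where
  "write_cell v i z s = s(v := (s v)(i := z))"

primrec step :: "com \<Rightarrow> mem \<Rightarrow> (com \<times> mem) pmf" where
  "step SKIP s = return_pmf (SKIP, s)"
| "step (Store v e1 e2) s = return_pmf (SKIP, write_cell v (aval e1 s) (aval e2 s) s)"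
| "step (Flip v e) s =
     map_pmf (\<lambda>b. (SKIP, write_cell v (aval e s) (of_bool b) s)) (bernoulli_pmf (1/2))"
| "step (Seq c1 c2) s =
     (if c1 = SKIP then return_pmf (c2, s)
      else map_pmf (\<lambda>(c, s'). (Seq c c2, s')) (step c1 s))"
| "step (Cond b c1 c2) s = return_pmf (if bval b s then c1 else c2, s)"
| "step (While b c) s = return_pmf (Cond b (Seq c (While b c)) SKIP, s)"

primrec run :: "nat \<Rightarrow> com \<Rightarrow> mem \<Rightarrow> (com \<times> mem) pmf" where
  "run 0 c s = return_pmf (c, s)"
| "run (Suc t) c s = bind_pmf (step c s) (\<lambda>(c', s'). run t c' s')"

text \<open>Worst case over the coin flips.\<close>

definition halts_within :: "nat \<Rightarrow> com \<Rightarrow> mem \<Rightarrow> bool" where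
  "halts_within t c s \<longleftrightarrow> (\<forall>(c', s') \<in> set_pmf (run t c s). c' = SKIP)"


section \<open>Input and output\<close>

text \<open>A constraint of arity \<open>r\<close> is encoded by \<open>r\<close>, its scope and the \<open>2 ^ r\<close> entries of the truth
  table of its predicate.  Bit \<open>j\<close> of a table index is set iff the \<open>j\<close>-th argument is \<open>1\<close>.\<close>

definition index_signs :: "nat \<Rightarrow> nat \<Rightarrow> int list" where
  "index_signs r t = map (\<lambda>j. if bit t j then 1 else -1) [0..<r]"

definition encode_constr :: "constr \<Rightarrow> nat list" where
  "encode_constr C = arity C # scope C @
     map (\<lambda>t. of_bool (predic C (index_signs (arity C) t))) [0..<2 ^ arity C]"

definition encode_csp :: "nat \<Rightarrow> constr list \<Rightarrow> nat list" where
  "encode_csp n I = n # length I # concat (map encode_constr I)"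

definition input_mem :: "nat list \<Rightarrow> mem" where
  "input_mem xs = (\<lambda>v i. if v = ''input'' \<and> i < length xs then xs ! i else 0)"

definition output_assignment :: "nat \<Rightarrow> mem \<Rightarrow> nat \<Rightarrow> int" where
  "output_assignment n s = (\<lambda>i \<in> {..<n}. if s ''output'' i = 1 then 1 else -1)"

lemma output_assignment_in: "output_assignment n s \<in> assignments n"
  by (simp add: output_assignment_def assignments_def)

end

theory Submission
  imports Defs
begin

text \<open>Split the variables at random into greedy and fixed ones, and draw two independent uniform
  assignments, a main and a shadow one.  Call a constraint active at \<open>j\<close> if \<open>j\<close> is its only
  greedy variable, let \<open>W j\<close> be the sum of the discrete derivatives in direction \<open>j\<close> of the
  constraints active at \<open>j\<close>, evaluated at the main assignment, and \<open>W' j\<close> the same for the shadow.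
  A greedy \<open>j\<close> receives the sign of \<open>W j - W' j\<close> (ties are broken by the main coin), a fixed one
  its main coin.  Comparing with a shadow instead of with \<open>0\<close> makes every greedy value unbiased:
  exchanging main and shadow around \<open>j\<close> flips it.  By triangle-freeness these exchanges act
  independently on the variables of one constraint, so constraints that are not active keep their
  mean, whereas the active ones gain \<open>E |W j - W' j| / 4\<close> for every \<open>j\<close>.  The summands of
  \<open>W j - W' j\<close> live on disjoint sets of coins, and exchanging main and shadow on one of them changes
  the sign of one summand only; so a fourth moment bound gives
  \<open>E |W j - W' j| \<ge> Var / (6 * sqrt D)\<close>, where each constraint contributes at least \<open>8 ^ -k\<close> to the
  total variance.  By Markov's inequality one trial succeeds with probability at least
  \<open>8 ^ -k / (48 * sqrt D)\<close>.  The program takes the best of \<open>a * n * L ^ 6\<close> trials, \<open>L\<close> being the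
  length of the input, which exceeds \<open>2 ^ k\<close> and the number of constraints.\<close>

section \<open>Signed involutions and anticoncentration\<close>

text \<open>Every probability here is a count over a finite coin space, and involutions of that
  space replace independence: a list of bits is uniform once each bit can be flipped alone, and a
  product sums to 0 once one factor can be negated alone. Hence the exchange of main and shadow must
  be confined to the constraints that decide \<open>j\<close>; exchanging them everywhere would
  negate all advantages at once. The comparison with a shadow has a price: a constraint whose
  derivative is constant cancels out. Arity at least 2 excludes this. The factor
  \<open>8 ^ -k\<close> is the probability that the three coins of each of \<open>k\<close>
  variables take prescribed values. The program knows neither \<open>k\<close> nor \<open>D\<close>.
  Once these are replaced by the largest arity and by the minimum of \<open>D\<close> and the number
  of constraints, \<open>L ^ 2\<close>, \<open>L ^ 3\<close> and \<open>L\<close> exceed 48,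
  \<open>8 ^ k\<close> and \<open>sqrt D\<close>, so \<open>L ^ 6\<close> trials suffice for a
  constant probability of success; the factor \<open>a * n\<close> lowers the failure probability to
  \<open>1 / n ^ a\<close>. The machine cannot multiply, so this number of trials is realised by
  nested loops.\<close>

lemma card_fibre_of_flips:
  fixes X :: "'w \<Rightarrow> bool list"
  assumes "finite \<Omega>"
    and len: "\<And>\<omega>. \<omega> \<in> \<Omega> \<Longrightarrow> length (X \<omega>) = r"
    and T: "\<And>i \<omega>. i < r \<Longrightarrow> \<omega> \<in> \<Omega> \<Longrightarrow> T i \<omega> \<in> \<Omega>"
    and TT: "\<And>i \<omega>. i < r \<Longrightarrow> \<omega> \<in> \<Omega> \<Longrightarrow> T i (T i \<omega>) = \<omega>"
    and X: "\<And>i \<omega>. i < r \<Longrightarrow> \<omega> \<in> \<Omega> \<Longrightarrow> X (T i \<omega>) = (X \<omega>)[i := \<not> X \<omega> ! i]"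
    and b: "length b = r"
  shows "card {\<omega> \<in> \<Omega>. X \<omega> = b} = card {\<omega> \<in> \<Omega>. X \<omega> = replicate r False}"
proof -
  have flip: "card {\<omega> \<in> \<Omega>. X \<omega> = b} = card {\<omega> \<in> \<Omega>. X \<omega> = b[i := \<not> b ! i]}"
    if "i < r" "length b = r" for i b
  proof (rule bij_betw_same_card[of "T i"], rule bij_betw_byWitness[where f' = "T i"])
    show "T i ` {\<omega> \<in> \<Omega>. X \<omega> = b} \<subseteq> {\<omega> \<in> \<Omega>. X \<omega> = b[i := \<not> b ! i]}"
      using that T X by auto
    show "T i ` {\<omega> \<in> \<Omega>. X \<omega> = b[i := \<not> b ! i]} \<subseteq> {\<omega> \<in> \<Omega>. X \<omega> = b}"
      using that T X by (auto simp: list_update_same_conv)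
  qed (use that TT in auto)
  have set: "card {\<omega> \<in> \<Omega>. X \<omega> = b} = card {\<omega> \<in> \<Omega>. X \<omega> = b[i := False]}"
    if "i < r" "length b = r" for i b
  proof (cases "b ! i")
    case True
    then show ?thesis using flip[OF that] by simp
  next
    case False
    then have "b[i := False] = b" using that by (metis list_update_id)
    then show ?thesis by simp
  qed
  \<comment> \<open>The entries of \<open>b\<close> are cleared from left to right, and no such step
    changes the size of the fibre.\<close>
  have "card {\<omega> \<in> \<Omega>. X \<omega> = b} = card {\<omega> \<in> \<Omega>. X \<omega> = replicate i False @ drop i b}" if "i \<le> r" for i
    using that
  proof (induction i)
    case (Suc i)
    have "replicate (Suc i) False @ drop (Suc i) b = (replicate i False @ drop i b)[i := False]"
      using Suc.prems b
      by (simp add: list_update_append replicate_app_Cons_same flip: Cons_nth_drop_Suc)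
    with Suc set[of i "replicate i False @ drop i b"] b show ?case by simp
  qed simp
  from this[of r] b show ?thesis by simp
qed

lemma finite_bool_lists: "finite {b :: bool list. length b = r}"
  using finite_lists_length_eq[of "UNIV :: bool set" r] by simp

lemma card_bool_lists: "card {b :: bool list. length b = r} = 2 ^ r"
  using card_lists_length_eq[of "UNIV :: bool set" r] by simp

text \<open>All fibres of \<open>X\<close> have the same size, so \<open>X\<close> is uniform. This
  stands in for joint independence of the entries of \<open>X\<close>.\<close>

lemma sum_uniform_of_flips:
  fixes X :: "'w \<Rightarrow> bool list" and h :: "bool list \<Rightarrow> real"
  assumes fin: "finite \<Omega>"
    and len: "\<And>\<omega>. \<omega> \<in> \<Omega> \<Longrightarrow> length (X \<omega>) = r"
    and T: "\<And>i \<omega>. i < r \<Longrightarrow> \<omega> \<in> \<Omega> \<Longrightarrow> T i \<omega> \<in> \<Omega>"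
    and TT: "\<And>i \<omega>. i < r \<Longrightarrow> \<omega> \<in> \<Omega> \<Longrightarrow> T i (T i \<omega>) = \<omega>"
    and X: "\<And>i \<omega>. i < r \<Longrightarrow> \<omega> \<in> \<Omega> \<Longrightarrow> X (T i \<omega>) = (X \<omega>)[i := \<not> X \<omega> ! i]"
  shows "(\<Sum>\<omega>\<in>\<Omega>. h (X \<omega>)) = real (card \<Omega>) * ((\<Sum>b | length b = r. h b) / 2 ^ r)"
proof -
  define N where "N = card {\<omega> \<in> \<Omega>. X \<omega> = replicate r False}"
  have N: "card {\<omega> \<in> \<Omega>. X \<omega> = b} = N" if "length b = r" for b
    unfolding N_def by (rule card_fibre_of_flips[where T = T]) (use assms that in blast)+
  have group: "(\<Sum>\<omega>\<in>\<Omega>. f (X \<omega>)) = real N * (\<Sum>b | length b = r. f b)" for f :: "bool list \<Rightarrow> real"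
  proof -
    have "(\<Sum>\<omega>\<in>\<Omega>. f (X \<omega>)) = (\<Sum>b | length b = r. \<Sum>\<omega> | \<omega> \<in> \<Omega> \<and> X \<omega> = b. f (X \<omega>))"
      by (rule sum.group[symmetric]) (use fin len finite_bool_lists in auto)
    also have "\<dots> = (\<Sum>b | length b = r. real N * f b)"
      by (rule sum.cong) (use N in auto)
    finally show ?thesis by (simp add: sum_distrib_left)
  qed
  \<comment> \<open>The constant function 1 determines the common fibre size.\<close>
  have "real (card \<Omega>) = real N * 2 ^ r"
    using group[of "\<lambda>_. 1"] by (simp add: card_bool_lists)
  then show ?thesis using group[of h] by simp
qed

lemma sum_involution:
  fixes f :: "'w \<Rightarrow> real"
  assumes "\<And>\<omega>. \<omega> \<in> \<Omega> \<Longrightarrow> T \<omega> \<in> \<Omega>" "\<And>\<omega>. \<omega> \<in> \<Omega> \<Longrightarrow> T (T \<omega>) = \<omega>"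
  shows "(\<Sum>\<omega>\<in>\<Omega>. f (T \<omega>)) = (\<Sum>\<omega>\<in>\<Omega>. f \<omega>)"
  by (rule sum.reindex_bij_witness[of _ T T]) (use assms in auto)

lemma sum_antisymmetric:
  fixes f :: "'w \<Rightarrow> real"
  assumes "\<And>\<omega>. \<omega> \<in> \<Omega> \<Longrightarrow> T \<omega> \<in> \<Omega>" "\<And>\<omega>. \<omega> \<in> \<Omega> \<Longrightarrow> T (T \<omega>) = \<omega>"
    and "\<And>\<omega>. \<omega> \<in> \<Omega> \<Longrightarrow> f (T \<omega>) = - f \<omega>"
  shows "(\<Sum>\<omega>\<in>\<Omega>. f \<omega>) = 0"
proof -
  have "(\<Sum>\<omega>\<in>\<Omega>. f \<omega>) = (\<Sum>\<omega>\<in>\<Omega>. f (T \<omega>))"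
    using sum_involution[of \<Omega> T f] assms by simp
  also have "\<dots> = - (\<Sum>\<omega>\<in>\<Omega>. f \<omega>)"
    using assms(3) by (simp add: sum_negf)
  finally show ?thesis by simp
qed

section \<open>Anticoncentration from the second and fourth moments\<close>

text \<open>With u = |z| / S the claim reads u^2 - 4/27 u^4 \<le> u. The constant 4/27 is the least
  possible one: equality holds at u = 3/2, the double root of the cubic in the proof.\<close>

lemma abs_ge_moments:
  fixes z S :: real
  assumes "S > 0"
  shows "\<bar>z\<bar> \<ge> z\<^sup>2 / S - 4 / 27 * (z ^ 4 / S ^ 3)"
proof -
  define u where "u = \<bar>z\<bar> / S"
  have u: "u \<ge> 0" "\<bar>z\<bar> = u * S" using assms by (auto simp: u_def)
  have "0 \<le> (2 * u - 3)\<^sup>2 * (u + 3)" using u by simp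
  also have "\<dots> = 4 * u ^ 3 - 27 * u + 27" by (simp add: power2_eq_square power3_eq_cube algebra_simps)
  finally have "0 \<le> (4 * u ^ 3 - 27 * u + 27) * u" using u by simp
  then have "u\<^sup>2 - 4 / 27 * u ^ 4 \<le> u" by (simp add: algebra_simps power2_eq_square eval_nat_numeral)
  then have "(u\<^sup>2 - 4 / 27 * u ^ 4) * S \<le> u * S" using assms by simp
  moreover have "z\<^sup>2 = (u * S)\<^sup>2" "z ^ 4 = (u * S) ^ 4"
    using u(2) by (metis power2_abs, metis power_even_abs even_numeral)
  ultimately show ?thesis using assms u(2)
    by (simp add: field_simps power2_eq_square eval_nat_numeral)
qed

text \<open>\<open>T l\<close> negates \<open>Z l\<close> and fixes the other summands, so the signs
  behave like independent fair ones: a product in which some \<open>Z l\<close> has an odd power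
  sums to 0. The fourth moment is therefore of order \<open>card B\<close> times the second, and
  \<open>abs_ge_moments\<close> at a scale of order \<open>sqrt D\<close> bounds the first
  moment.\<close>

lemma sum_abs_ge_variance:
  fixes Z :: "'l \<Rightarrow> 'w \<Rightarrow> real" and D :: real
  assumes fin: "finite B" and bnd: "\<And>l \<omega>. l \<in> B \<Longrightarrow> \<omega> \<in> \<Omega> \<Longrightarrow> \<bar>Z l \<omega>\<bar> \<le> 2"
    and T: "\<And>l \<omega>. l \<in> B \<Longrightarrow> \<omega> \<in> \<Omega> \<Longrightarrow> T l \<omega> \<in> \<Omega>"
    and TT: "\<And>l \<omega>. l \<in> B \<Longrightarrow> \<omega> \<in> \<Omega> \<Longrightarrow> T l (T l \<omega>) = \<omega>"
    and neg: "\<And>l \<omega>. l \<in> B \<Longrightarrow> \<omega> \<in> \<Omega> \<Longrightarrow> Z l (T l \<omega>) = - Z l \<omega>"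
    and inv: "\<And>l l' \<omega>. l \<in> B \<Longrightarrow> l' \<in> B \<Longrightarrow> l \<noteq> l' \<Longrightarrow> \<omega> \<in> \<Omega> \<Longrightarrow> Z l' (T l \<omega>) = Z l' \<omega>"
    and D: "real (card B) \<le> D" "D > 0"
  shows "(\<Sum>\<omega>\<in>\<Omega>. \<bar>\<Sum>l\<in>B. Z l \<omega>\<bar>) \<ge> (\<Sum>l\<in>B. \<Sum>\<omega>\<in>\<Omega>. (Z l \<omega>)\<^sup>2) / (6 * sqrt D)"
proof -
  define s where "s B' = (\<Sum>l\<in>B'. \<Sum>\<omega>\<in>\<Omega>. (Z l \<omega>)\<^sup>2)" for B'
  have "(\<Sum>\<omega>\<in>\<Omega>. (\<Sum>l\<in>B'. Z l \<omega>)\<^sup>2) = s B' \<and>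
        (\<Sum>\<omega>\<in>\<Omega>. (\<Sum>l\<in>B'. Z l \<omega>) ^ 4) \<le> 24 * card B' * s B'" if "B' \<subseteq> B" for B'
    using finite_subset[OF that fin] that
  proof (induction B' rule: finite_induct)
    case empty
    then show ?case by (simp add: s_def)
  next
    case (insert l B')
    define S where "S \<omega> = (\<Sum>l\<in>B'. Z l \<omega>)" for \<omega>
    have l: "l \<in> B" using insert by simp
    have SS: "S (T l \<omega>) = S \<omega>" if "\<omega> \<in> \<Omega>" for \<omega>
      unfolding S_def by (rule sum.cong) (use insert that inv[OF l] in auto)
    note anti = sum_antisymmetric[of \<Omega> "T l", OF T[OF l] TT[OF l]]
    \<comment> \<open>These are the terms odd in \<open>Z l\<close> that occur when the square and
      the fourth power of the sum are expanded.\<close>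
    have o1: "(\<Sum>\<omega>\<in>\<Omega>. S \<omega> * Z l \<omega>) = 0" by (rule anti) (auto simp: SS neg l)
    have o2: "(\<Sum>\<omega>\<in>\<Omega>. S \<omega> ^ 3 * Z l \<omega>) = 0" by (rule anti) (auto simp: SS neg l)
    have o3: "(\<Sum>\<omega>\<in>\<Omega>. S \<omega> * Z l \<omega> ^ 3) = 0" by (rule anti) (auto simp: SS neg l)
    have IH: "(\<Sum>\<omega>\<in>\<Omega>. (S \<omega>)\<^sup>2) = s B'" "(\<Sum>\<omega>\<in>\<Omega>. S \<omega> ^ 4) \<le> 24 * card B' * s B'"
      using insert by (auto simp: S_def)
    have ins: "(\<Sum>l\<in>insert l B'. Z l \<omega>) = S \<omega> + Z l \<omega>" for \<omega>
      using insert by (simp add: S_def)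
    have s: "s (insert l B') = s B' + (\<Sum>\<omega>\<in>\<Omega>. (Z l \<omega>)\<^sup>2)" using insert by (simp add: s_def)
    have s0: "s B' \<ge> 0" by (simp add: s_def sum_nonneg)
    have "(\<Sum>\<omega>\<in>\<Omega>. (S \<omega> + Z l \<omega>)\<^sup>2) =
       (\<Sum>\<omega>\<in>\<Omega>. (S \<omega>)\<^sup>2) + 2 * (\<Sum>\<omega>\<in>\<Omega>. S \<omega> * Z l \<omega>) + (\<Sum>\<omega>\<in>\<Omega>. (Z l \<omega>)\<^sup>2)"
      by (simp add: power2_eq_square algebra_simps sum.distrib sum_distrib_left)
    then have c1: "(\<Sum>\<omega>\<in>\<Omega>. (S \<omega> + Z l \<omega>)\<^sup>2) = s (insert l B')" using o1 IH s by simp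
    have Z2: "(Z l \<omega>)\<^sup>2 \<le> 4" if "\<omega> \<in> \<Omega>" for \<omega>
    proof -
      have "(Z l \<omega>)\<^sup>2 \<le> 2\<^sup>2" by (rule abs_le_square_iff[THEN iffD1]) (use bnd[OF l that] in simp)
      then show ?thesis by simp
    qed
    \<comment> \<open>From |Z| \<le> 2 comes Z^2 \<le> 4; with the binomial coefficient 6 this is
      the origin of the constant 24.\<close>
    have q: "(\<Sum>\<omega>\<in>\<Omega>. (S \<omega>)\<^sup>2 * (Z l \<omega>)\<^sup>2) \<le> (\<Sum>\<omega>\<in>\<Omega>. 4 * (S \<omega>)\<^sup>2)"
      by (rule sum_mono) (use Z2 in \<open>auto simp: mult.commute[of 4] intro!: mult_left_mono\<close>)
    have q': "(\<Sum>\<omega>\<in>\<Omega>. Z l \<omega> ^ 4) \<le> (\<Sum>\<omega>\<in>\<Omega>. 4 * (Z l \<omega>)\<^sup>2)"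
    proof (rule sum_mono)
      fix \<omega> assume "\<omega> \<in> \<Omega>"
      have "Z l \<omega> ^ 4 = (Z l \<omega>)\<^sup>2 * (Z l \<omega>)\<^sup>2" by (simp add: power2_eq_square eval_nat_numeral)
      also have "\<dots> \<le> 4 * (Z l \<omega>)\<^sup>2" using Z2[OF \<open>\<omega> \<in> \<Omega>\<close>] by (intro mult_right_mono) auto
      finally show "Z l \<omega> ^ 4 \<le> 4 * (Z l \<omega>)\<^sup>2" .
    qed
    have "(S \<omega> + Z l \<omega>) ^ 4 = S \<omega> ^ 4 + 4 * (S \<omega> ^ 3 * Z l \<omega>) +
       6 * ((S \<omega>)\<^sup>2 * (Z l \<omega>)\<^sup>2) + 4 * (S \<omega> * Z l \<omega> ^ 3) + Z l \<omega> ^ 4" for \<omega>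
      by (simp add: algebra_simps eval_nat_numeral)
    then have "(\<Sum>\<omega>\<in>\<Omega>. (S \<omega> + Z l \<omega>) ^ 4) =
       (\<Sum>\<omega>\<in>\<Omega>. S \<omega> ^ 4) + 6 * (\<Sum>\<omega>\<in>\<Omega>. (S \<omega>)\<^sup>2 * (Z l \<omega>)\<^sup>2) + (\<Sum>\<omega>\<in>\<Omega>. Z l \<omega> ^ 4)"
      using o2 o3 by (simp add: sum.distrib flip: sum_distrib_left)
    also have "\<dots> \<le> 24 * card B' * s B' + 24 * s B' + 4 * (\<Sum>\<omega>\<in>\<Omega>. (Z l \<omega>)\<^sup>2)"
      using IH q q' by (simp flip: sum_distrib_left)
    also have "\<dots> \<le> 24 * card (insert l B') * s (insert l B')"
    proof -
      have "4 * (\<Sum>\<omega>\<in>\<Omega>. (Z l \<omega>)\<^sup>2) \<le> 24 * (1 + real (card B')) * (\<Sum>\<omega>\<in>\<Omega>. (Z l \<omega>)\<^sup>2)"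
        by (intro mult_right_mono) (auto simp: sum_nonneg)
      then show ?thesis using s insert by (simp add: algebra_simps)
    qed
    finally show ?case using c1 by (simp only: ins)
  qed
  from this[of B] have m2: "(\<Sum>\<omega>\<in>\<Omega>. (\<Sum>l\<in>B. Z l \<omega>)\<^sup>2) = s B"
    and m4: "(\<Sum>\<omega>\<in>\<Omega>. (\<Sum>l\<in>B. Z l \<omega>) ^ 4) \<le> 24 * card B * s B" by auto
  have s0: "s B \<ge> 0" by (simp add: s_def sum_nonneg)
  have m4': "(\<Sum>\<omega>\<in>\<Omega>. (\<Sum>l\<in>B. Z l \<omega>) ^ 4) \<le> 24 * D * s B"
    using m4 mult_right_mono[OF D(1) s0] by linarith
  \<comment> \<open>This scale leaves the factor 1/3 - 4 * 24 / 27^2 = 147/729, which exceeds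
    1/6.\<close>
  define S where "S = 3 * sqrt D"
  have S: "S > 0" using D by (simp add: S_def)
  have S3: "S ^ 3 = 27 * D * sqrt D" using D by (simp add: S_def power3_eq_cube)
  have "s B / (6 * sqrt D) \<le> s B / S - 4 / 27 * (24 * D * s B / S ^ 3)"
    unfolding S3 unfolding S_def using D s0 by (simp add: field_simps)
  also have "\<dots> \<le> s B / S - 4 / 27 * ((\<Sum>\<omega>\<in>\<Omega>. (\<Sum>l\<in>B. Z l \<omega>) ^ 4) / S ^ 3)"
    using divide_right_mono[OF m4', of "S ^ 3"] S by simp
  also have "\<dots> = (\<Sum>\<omega>\<in>\<Omega>. (\<Sum>l\<in>B. Z l \<omega>)\<^sup>2 / S - 4 / 27 * ((\<Sum>l\<in>B. Z l \<omega>) ^ 4 / S ^ 3))"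
    by (simp add: m2[symmetric] sum_subtractf sum_divide_distrib sum_distrib_left)
  also have "\<dots> \<le> (\<Sum>\<omega>\<in>\<Omega>. \<bar>\<Sum>l\<in>B. Z l \<omega>\<bar>)"
    by (rule sum_mono) (use abs_ge_moments[OF S] in auto)
  finally show ?thesis by (simp add: s_def)
qed

section \<open>The value of one trial\<close>

definition constr_val :: "constr \<Rightarrow> (nat \<Rightarrow> bool) \<Rightarrow> real" where
  "constr_val C b = of_bool (predic C (map (\<lambda>v. if b v then 1 else - 1) (scope C)))"

text \<open>The mean is taken over the scope only; \<open>sum_constr_val_assignments\<close>
  identifies it with the mean over all assignments.\<close>

definition constr_mean :: "constr \<Rightarrow> real" where
  "constr_mean C =
     (\<Sum>b | length b = arity C. of_bool (predic C (map (\<lambda>x. if x then 1 else - 1) b))) / 2 ^ arity C"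

lemma constr_val_bounds: "0 \<le> constr_val C b" "constr_val C b \<le> 1"
  by (auto simp: constr_val_def)

lemma constr_val_cong: "(\<And>v. v \<in> set (scope C) \<Longrightarrow> b v = b' v) \<Longrightarrow> constr_val C b = constr_val C b'"
  unfolding constr_val_def by (intro arg_cong[where f = of_bool] arg_cong[where f = "predic C"] map_cong) auto

definition discrete_deriv :: "constr \<Rightarrow> nat \<Rightarrow> (nat \<Rightarrow> bool) \<Rightarrow> real" where
  "discrete_deriv C j b = constr_val C (b(j := True)) - constr_val C (b(j := False))"

lemma discrete_deriv_cong:
  "(\<And>v. v \<in> set (scope C) \<Longrightarrow> v \<noteq> j \<Longrightarrow> b v = b' v) \<Longrightarrow> discrete_deriv C j b = discrete_deriv C j b'"
  unfolding discrete_deriv_def by (intro arg_cong2[where f = "(-)"] constr_val_cong) auto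

lemma discrete_deriv_cases: "discrete_deriv C j b \<in> {-1, 0, 1}"
  by (auto simp: discrete_deriv_def constr_val_def)

lemma map_scope_flip:
  assumes "distinct vs" "i < length vs" "\<And>v. v \<in> set vs \<Longrightarrow> f' v = (if v = vs ! i then \<not> f v else f v)"
  shows "map f' vs = (map f vs)[i := \<not> map f vs ! i]"
  by (rule nth_equalityI) (use assms in \<open>auto simp: nth_list_update nth_eq_iff_index_eq\<close>)

text \<open>Only the values on the scope have to be flippable one at a time; the sample space is
  arbitrary. It is applied to greedy values, to main coins and to assignments.\<close>

lemma sum_constr_val_uniform:
  assumes "finite \<Omega>" "distinct (scope C)"
    and "\<And>v \<omega>. v \<in> set (scope C) \<Longrightarrow> \<omega> \<in> \<Omega> \<Longrightarrow> T v \<omega> \<in> \<Omega> \<and> T v (T v \<omega>) = \<omega>"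
    and "\<And>v u \<omega>. v \<in> set (scope C) \<Longrightarrow> \<omega> \<in> \<Omega> \<Longrightarrow> u \<in> set (scope C) \<Longrightarrow>
           X (T v \<omega>) u = (if u = v then \<not> X \<omega> u else X \<omega> u)"
  shows "(\<Sum>\<omega>\<in>\<Omega>. constr_val C (X \<omega>)) = real (card \<Omega>) * constr_mean C"
proof -
  have "(\<Sum>\<omega>\<in>\<Omega>. constr_val C (X \<omega>)) =
     (\<Sum>\<omega>\<in>\<Omega>. of_bool (predic C (map (\<lambda>x. if x then 1 else - 1) (map (X \<omega>) (scope C)))))"
    by (simp add: constr_val_def comp_def)
  also have "\<dots> = real (card \<Omega>) * constr_mean C"
    unfolding constr_mean_def
    by (rule sum_uniform_of_flips[where T = "\<lambda>i. T (scope C ! i)"])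
       (use assms in \<open>auto simp: arity_def nth_eq_iff_index_eq list_eq_iff_nth_eq nth_list_update\<close>)
  finally show ?thesis .
qed

text \<open>A constant derivative would be nonzero, as \<open>C\<close> depends on \<open>j\<close>.
  A nonzero difference of two bits determines both bits, so \<open>C\<close> would be a function of
  \<open>j\<close> alone, contrary to its dependence on a second variable.\<close>

lemma discrete_deriv_nonconstant:
  assumes "depends_on_all C" "distinct (scope C)" "arity C \<ge> 2" "j \<in> set (scope C)"
  shows "\<exists>b b'. discrete_deriv C j b \<noteq> discrete_deriv C j b'"
proof (rule ccontr)
  assume "\<nexists>b b'. discrete_deriv C j b \<noteq> discrete_deriv C j b'"
  then have const: "discrete_deriv C j b = discrete_deriv C j b'" for b b' by blast
  have sens: "\<exists>b. constr_val C (b(v := True)) \<noteq> constr_val C (b(v := False))"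
    if v: "v \<in> set (scope C)" for v
  proof -
    obtain i where i: "i < arity C" "v = scope C ! i"
      using v by (auto simp: in_set_conv_nth arity_def)
    obtain y where y: "y \<in> sign_lists (arity C)" "predic C y \<noteq> predic C (y[i := - (y ! i)])"
      using assms(1) i by (auto simp: depends_on_all_def)
    \<comment> \<open>\<open>y\<close> is indexed by positions. As the scope is distinct, each of
      its variables has one position, and \<open>b\<close> is \<open>y\<close> read as an assignment
      of variables.\<close>
    define b where "b u = (y ! (THE i'. i' < arity C \<and> scope C ! i' = u) = 1)" for u
    have b: "b (scope C ! i') = (y ! i' = 1)" if "i' < arity C" for i'
    proof -
      have "(THE k. k < arity C \<and> scope C ! k = scope C ! i') = i'"
        using that assms(2) by (intro the_equality) (auto simp: arity_def nth_eq_iff_index_eq)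
      then show ?thesis by (simp add: b_def)
    qed
    have y1: "y ! i' = 1 \<or> y ! i' = - 1" if "i' < arity C" for i'
      using y(1) that nth_mem[of i' y] unfolding sign_lists_def by force
    have len: "length y = arity C" using y(1) by (simp add: sign_lists_def)
    have e: "(if b (scope C ! i') then 1 else - 1) = y ! i'" if "i' < arity C" for i'
      using b[OF that] y1[OF that] by auto
    have "map (\<lambda>u. if b u then 1 else - 1) (scope C) = y"
      by (rule nth_equalityI) (use len e in \<open>simp_all add: arity_def\<close>)
    moreover have "map (\<lambda>u. if (b(v := \<not> b v)) u then 1 else - 1) (scope C) = y[i := - (y ! i)]"
    proof (rule nth_equalityI)
      fix i' assume "i' < length (map (\<lambda>u. if (b(v := \<not> b v)) u then 1 else - 1 :: int) (scope C))"
      then have i': "i' < arity C" by (simp add: arity_def)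
      show "map (\<lambda>u. if (b(v := \<not> b v)) u then 1 else - 1) (scope C) ! i' = y[i := - (y ! i)] ! i'"
      proof (cases "i' = i")
        case True
        then show ?thesis using i len b[OF i'] y1[OF i'] by (auto simp: arity_def)
      next
        case False
        then have "scope C ! i' \<noteq> v"
          using i i' assms(2) by (simp add: arity_def nth_eq_iff_index_eq)
        then show ?thesis using False i' e[OF i'] by (simp add: arity_def)
      qed
    qed (use len in \<open>simp add: arity_def\<close>)
    ultimately have "constr_val C b \<noteq> constr_val C (b(v := \<not> b v))"
      using y(2) by (simp add: constr_val_def)
    moreover have "b(v := b v) = b" by simp
    ultimately have "constr_val C (b(v := True)) \<noteq> constr_val C (b(v := False))"
      by (cases "b v") metis+
    then show ?thesis by blast
  qed
  obtain b0 where b0: "constr_val C (b0(j := True)) \<noteq> constr_val C (b0(j := False))"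
    using sens[OF assms(4)] by blast
  have d: "discrete_deriv C j b = discrete_deriv C j b0" "discrete_deriv C j b0 \<noteq> 0" for b
    using b0 const by (auto simp: discrete_deriv_def)
  have only_j: "constr_val C b = constr_val C b'" if "b j = b' j" for b b'
  proof -
    have 1: "b(j := b j) = b" "b'(j := b j) = b'" using that by (simp_all only: fun_upd_idem)
    have eq: "p = p' \<and> q = q'" if "(of_bool :: bool \<Rightarrow> real) p - of_bool q = of_bool p' - of_bool q'" "(of_bool :: bool \<Rightarrow> real) p - of_bool q \<noteq> 0"
      for p q p' q' using that by (cases p; cases q; cases p'; cases q') auto
    define P where "P c x \<longleftrightarrow> predic C (map (\<lambda>v. if (c(j := x)) v then 1 else - 1) (scope C))" for c x
    have P: "constr_val C (c(j := x)) = of_bool (P c x)" for c x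
      by (simp only: P_def constr_val_def)
    have "constr_val C (b(j := True)) = constr_val C (b'(j := True)) \<and>
      constr_val C (b(j := False)) = constr_val C (b'(j := False))"
      using d(1)[of b] d(1)[of b'] d(2) eq[of "P b True" "P b False" "P b' True" "P b' False"]
      unfolding discrete_deriv_def P by simp
    then have "constr_val C (b(j := x)) = constr_val C (b'(j := x))" for x by (cases x) auto
    from this[of "b j"] show ?thesis unfolding 1 .
  qed
  obtain v where v: "v \<in> set (scope C)" "v \<noteq> j"
  proof -
    have "card (set (scope C)) \<ge> 2" using assms by (simp add: arity_def distinct_card)
    then have "\<not> set (scope C) \<subseteq> {j}" using card_mono[of "{j}" "set (scope C)"] by fastforce
    then show ?thesis using that by blast
  qed
  obtain b where "constr_val C (b(v := True)) \<noteq> constr_val C (b(v := False))" using sens[OF v(1)] by blast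
  moreover have "constr_val C (b(v := True)) = constr_val C (b(v := False))" by (rule only_j) (use v in simp)
  ultimately show False by simp
qed

section \<open>The coin space and its elementary involutions\<close>

type_synonym coins = "nat \<Rightarrow> bool \<times> bool \<times> bool"

abbreviation greedy :: "coins \<Rightarrow> nat \<Rightarrow> bool" where "greedy \<omega> v \<equiv> fst (\<omega> v)"
abbreviation main :: "coins \<Rightarrow> nat \<Rightarrow> bool" where "main \<omega> v \<equiv> fst (snd (\<omega> v))"
abbreviation shadow :: "coins \<Rightarrow> nat \<Rightarrow> bool" where "shadow \<omega> v \<equiv> snd (snd (\<omega> v))"

text \<open>The fixed value outside \<open>{..<n}\<close> makes the space finite and is the default
  of the product distribution \<open>coins_pmf\<close>.\<close>

definition coin_space :: "nat \<Rightarrow> coins set" where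
  "coin_space n = {\<omega>. \<forall>i\<ge>n. \<omega> i = (False, False, False)}"

lemma coin_space_eq: "coin_space n = PiE_dflt {..<n} (False, False, False) (\<lambda>_. UNIV)"
  by (auto simp: coin_space_def PiE_dflt_def not_less)

lemma finite_coin_space [simp]: "finite (coin_space n)"
  unfolding coin_space_eq by (rule finite_PiE_dflt) auto

lemma coin_space_nonempty [simp]: "coin_space n \<noteq> {}"
  by (auto simp: coin_space_def)

definition flip_main :: "nat \<Rightarrow> coins \<Rightarrow> coins" where
  "flip_main v \<omega> = fun_upd \<omega> v (greedy \<omega> v, \<not> main \<omega> v, shadow \<omega> v)"

definition swap_shadow :: "nat set \<Rightarrow> coins \<Rightarrow> coins" where
  "swap_shadow A \<omega> = (\<lambda>i. if i \<in> A then (greedy \<omega> i, shadow \<omega> i, main \<omega> i) else \<omega> i)"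

lemma flip_main_simps [simp]:
  "greedy (flip_main v \<omega>) u = greedy \<omega> u"
  "shadow (flip_main v \<omega>) u = shadow \<omega> u"
  "main (flip_main v \<omega>) u = (if u = v then \<not> main \<omega> u else main \<omega> u)"
  "flip_main v (flip_main v \<omega>) = \<omega>"
  by (auto simp: flip_main_def)

lemma swap_shadow_simps [simp]:
  "greedy (swap_shadow A \<omega>) u = greedy \<omega> u"
  "shadow (swap_shadow A \<omega>) u = (if u \<in> A then main \<omega> u else shadow \<omega> u)"
  "main (swap_shadow A \<omega>) u = (if u \<in> A then shadow \<omega> u else main \<omega> u)"
  "swap_shadow A (swap_shadow A \<omega>) = \<omega>"
  by (auto simp: swap_shadow_def)

lemma flip_main_coin_space: "v < n \<Longrightarrow> \<omega> \<in> coin_space n \<Longrightarrow> flip_main v \<omega> \<in> coin_space n"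
  by (auto simp: flip_main_def coin_space_def)

lemma swap_shadow_coin_space: "\<omega> \<in> coin_space n \<Longrightarrow> swap_shadow A \<omega> \<in> coin_space n"
  by (auto simp: swap_shadow_def coin_space_def)

section \<open>The greedy rule on a triangle-free instance\<close>

locale tf_csp =
  fixes n :: nat and I :: "constr list" and D :: nat
  assumes inst: "csp_instance n I" and tf: "triangle_free I"
    and ar: "\<And>C. C \<in> set I \<Longrightarrow> 2 \<le> arity C"
    and deg: "\<And>i. i < n \<Longrightarrow> var_degree I i \<le> D"
    and nonempty: "I \<noteq> []"
begin

abbreviation sc :: "nat \<Rightarrow> nat set" where "sc l \<equiv> set (scope (I ! l))"
abbreviation m :: nat where "m \<equiv> length I"

lemma distinct_scope: "l < m \<Longrightarrow> distinct (scope (I ! l))"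
  and sc_less: "l < m \<Longrightarrow> v \<in> sc l \<Longrightarrow> v < n"
  and depends: "l < m \<Longrightarrow> depends_on_all (I ! l)"
  using inst nth_mem[of l I] by (auto simp: csp_instance_def)

lemma meet_once:
  assumes "a < m" "b < m" "a \<noteq> b" "u \<in> sc a" "u \<in> sc b" "v \<in> sc a" "v \<in> sc b"
  shows "u = v"
proof -
  have "card (sc a \<inter> sc b) \<le> 1" using tf assms by (auto simp: triangle_free_def)
  then show ?thesis using assms card_le_Suc0_iff_eq[of "sc a \<inter> sc b"] by auto
qed

text \<open>A variable common to all three scopes would equal both \<open>u\<close> and
  \<open>v\<close> by \<open>meet_once\<close>, so \<open>u \<noteq> v\<close> already makes the
  three constraints a genuine triangle.\<close>

lemma no_triangle:
  assumes "a < m" "b < m" "c < m" "a \<noteq> b" "b \<noteq> c" "a \<noteq> c"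
    and "u \<in> sc a" "u \<in> sc b" "v \<in> sc b" "v \<in> sc c" "w \<in> sc a" "w \<in> sc c" "u \<noteq> v"
  shows False
proof -
  have "sc a \<inter> sc b \<noteq> {}" "sc b \<inter> sc c \<noteq> {}" "sc a \<inter> sc c \<noteq> {}" using assms by auto
  with tf assms have "sc a \<inter> sc b \<inter> sc c \<noteq> {}" unfolding triangle_free_def by blast
  then obtain x where "x \<in> sc a" "x \<in> sc b" "x \<in> sc c" by auto
  with assms meet_once[of a b u x] meet_once[of b c v x] show False by auto
qed

definition active :: "coins \<Rightarrow> nat \<Rightarrow> nat \<Rightarrow> bool" where
  "active \<omega> l j \<longleftrightarrow> {v \<in> sc l. greedy \<omega> v} = {j}"

lemma activeD: "active \<omega> l j \<Longrightarrow> v \<in> sc l \<Longrightarrow> greedy \<omega> v \<longleftrightarrow> v = j"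
  and active_mem: "active \<omega> l j \<Longrightarrow> j \<in> sc l"
  unfolding active_def by blast+

lemma active_cong: "(\<And>v. v \<in> sc l \<Longrightarrow> greedy \<omega> v = greedy \<omega>' v) \<Longrightarrow> active \<omega> l j = active \<omega>' l j"
proof -
  assume "\<And>v. v \<in> sc l \<Longrightarrow> greedy \<omega> v = greedy \<omega>' v"
  then have "{v \<in> sc l. greedy \<omega> v} = {v \<in> sc l. greedy \<omega>' v}" by auto
  then show ?thesis by (simp only: active_def)
qed

text \<open>\<open>swing j l\<close> is the summand of \<open>W j - W' j\<close> that stems from
  constraint \<open>l\<close>, and \<open>advantage\<close> is the whole difference.\<close>

definition swing :: "nat \<Rightarrow> nat \<Rightarrow> coins \<Rightarrow> real" where
  "swing j l \<omega> = (if active \<omega> l j then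
     discrete_deriv (I ! l) j (main \<omega>) - discrete_deriv (I ! l) j (shadow \<omega>) else 0)"

definition advantage :: "coins \<Rightarrow> nat \<Rightarrow> real" where
  "advantage \<omega> j = (\<Sum>l<m. swing j l \<omega>)"

definition greedy_choice :: "coins \<Rightarrow> nat \<Rightarrow> bool" where
  "greedy_choice \<omega> j = (if advantage \<omega> j > 0 then True else if advantage \<omega> j < 0 then False else main \<omega> j)"

text \<open>Given the greedy marks, these are the variables whose coins determine the advantage at
  \<open>j\<close>; see \<open>advantage_cong\<close>.\<close>

definition nbrs :: "coins \<Rightarrow> nat \<Rightarrow> nat set" where
  "nbrs \<omega> j = {v. \<exists>l<m. active \<omega> l j \<and> v \<in> sc l \<and> v \<noteq> j}"

lemma nbrs_cong: "(\<And>v. greedy \<omega> v = greedy \<omega>' v) \<Longrightarrow> nbrs \<omega> j = nbrs \<omega>' j"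
  unfolding nbrs_def using active_cong by blast

lemma nbrs_not_greedy: "v \<in> nbrs \<omega> j \<Longrightarrow> \<not> greedy \<omega> v"
  unfolding nbrs_def using activeD by blast

lemma advantage_cong:
  assumes "\<And>v. greedy \<omega> v = greedy \<omega>' v"
    and "\<And>v. v \<in> nbrs \<omega> j \<Longrightarrow> main \<omega> v = main \<omega>' v \<and> shadow \<omega> v = shadow \<omega>' v"
  shows "advantage \<omega> j = advantage \<omega>' j"
  unfolding advantage_def
proof (rule sum.cong[OF refl])
  fix l assume l: "l \<in> {..<m}"
  have a: "active \<omega> l j = active \<omega>' l j" by (rule active_cong) (use assms in auto)
  show "swing j l \<omega> = swing j l \<omega>'"
  proof (cases "active \<omega> l j")
    case True
    then have "v \<in> sc l \<Longrightarrow> v \<noteq> j \<Longrightarrow> v \<in> nbrs \<omega> j" for v using l by (auto simp: nbrs_def)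
    then show ?thesis unfolding swing_def a[symmetric]
      using discrete_deriv_cong[of "I ! l" j "main \<omega>" "main \<omega>'"]
        discrete_deriv_cong[of "I ! l" j "shadow \<omega>" "shadow \<omega>'"] assms(2) by simp
  qed (use a in \<open>simp add: swing_def\<close>)
qed

lemma advantage_not_greedy: "\<not> greedy \<omega> j \<Longrightarrow> advantage \<omega> j = 0"
  unfolding advantage_def swing_def using activeD active_mem by (intro sum.neutral) auto

text \<open>No constraint is active at a fixed variable, so its advantage is 0 and the tie rule
  yields its main coin. Thus one formula covers greedy and fixed variables.\<close>

lemma greedy_choice_not_greedy: "\<not> greedy \<omega> j \<Longrightarrow> greedy_choice \<omega> j = main \<omega> j"
  by (simp add: greedy_choice_def advantage_not_greedy)

text \<open>The exchange is confined to \<open>nbrs\<close> so that it can leave the decisions of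
  other variables alone. Flipping the main coin of \<open>j\<close> itself covers ties, which that
  coin decides.\<close>

definition mirror :: "nat \<Rightarrow> coins \<Rightarrow> coins" where
  "mirror j \<omega> = flip_main j (swap_shadow (nbrs \<omega> j) \<omega>)"

lemma greedy_mirror [simp]: "greedy (mirror j \<omega>) v = greedy \<omega> v"
  by (simp add: mirror_def)

lemma not_nbr_self: "j \<notin> nbrs \<omega> j"
  by (auto simp: nbrs_def)

text \<open>\<open>nbrs\<close> depends only on the marks, which the mirror keeps, and it omits
  \<open>j\<close>; so the two parts of the mirror act on different variables.\<close>

lemma mirror_mirror: "mirror j (mirror j \<omega>) = \<omega>"
proof -
  have "nbrs (mirror j \<omega>) j = nbrs \<omega> j" by (rule nbrs_cong) simp
  then show ?thesis
    unfolding mirror_def using not_nbr_self[of j \<omega>]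
    by (auto simp: flip_main_def swap_shadow_def fun_eq_iff)
qed

lemma mirror_coin_space: "j < n \<Longrightarrow> \<omega> \<in> coin_space n \<Longrightarrow> mirror j \<omega> \<in> coin_space n"
  by (simp add: mirror_def flip_main_coin_space swap_shadow_coin_space)

lemma main_mirror: "active \<omega> l j \<Longrightarrow> l < m \<Longrightarrow> v \<in> sc l \<Longrightarrow> v \<noteq> j \<Longrightarrow> main (mirror j \<omega>) v = shadow \<omega> v"
  and shadow_mirror: "active \<omega> l j \<Longrightarrow> l < m \<Longrightarrow> v \<in> sc l \<Longrightarrow> v \<noteq> j \<Longrightarrow> shadow (mirror j \<omega>) v = main \<omega> v"
  by (auto simp: mirror_def nbrs_def)

lemma active_mirror [simp]: "active (mirror j \<omega>) l i = active \<omega> l i"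
  by (rule active_cong) simp

lemma deriv_mirror:
  assumes "active \<omega> l j" "l < m"
  shows "discrete_deriv (I ! l) j (main (mirror j \<omega>)) = discrete_deriv (I ! l) j (shadow \<omega>)"
    and "discrete_deriv (I ! l) j (shadow (mirror j \<omega>)) = discrete_deriv (I ! l) j (main \<omega>)"
  using assms by (auto intro!: discrete_deriv_cong simp: main_mirror shadow_mirror)

lemma advantage_mirror: "advantage (mirror j \<omega>) j = - advantage \<omega> j"
  unfolding advantage_def swing_def
  by (auto simp: sum_negf[symmetric] deriv_mirror intro!: sum.cong)

lemma greedy_choice_mirror: "greedy_choice (mirror j \<omega>) j = (\<not> greedy_choice \<omega> j)"
  using not_nbr_self[of j \<omega>] by (auto simp: greedy_choice_def advantage_mirror) (simp_all add: mirror_def)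

text \<open>If a scope holds several greedy variables, then by triangle-freeness the constraints that
  decide them are disjoint from each other and from that scope.\<close>

lemma greedy_choice_mirror_other:
  assumes l: "l < m" "v \<in> sc l" "u \<in> sc l" "u \<noteq> v" "greedy \<omega> v" and na: "\<And>j. \<not> active \<omega> l j"
  shows "greedy_choice (mirror v \<omega>) u = greedy_choice \<omega> u"
proof -
  \<comment> \<open>If \<open>u\<close> were a neighbour of \<open>v\<close>, the deciding
    constraint \<open>a\<close> would share \<open>u\<close> and \<open>v\<close> with
    \<open>l\<close>. If they had a common neighbour, \<open>a\<close>, \<open>b\<close> and
    \<open>l\<close> would form a triangle. Inactivity of \<open>l\<close> ensures that
    \<open>a\<close> and \<open>b\<close> differ from \<open>l\<close>.\<close>
  have disj: "u' \<notin> nbrs \<omega> v" if or: "u' = u \<or> u' \<in> nbrs \<omega> u" for u'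
  proof
    assume "u' \<in> nbrs \<omega> v"
    then obtain a where a: "a < m" "active \<omega> a v" "u' \<in> sc a" "u' \<noteq> v" by (auto simp: nbrs_def)
    have al: "a \<noteq> l" using a na by auto
    have va: "v \<in> sc a" using a active_mem by auto
    show False
    proof (cases "u' = u")
      case True
      then show False using meet_once[of a l u v] a l al va by auto
    next
      case False
      then obtain b where b: "b < m" "active \<omega> b u" "u' \<in> sc b" "u' \<noteq> u"
        using or unfolding nbrs_def by blast
      have bl: "b \<noteq> l" using b na by auto
      have ub: "u \<in> sc b" using b active_mem by auto
      have "a \<noteq> b" using activeD[OF a(2) va] activeD[OF b(2), of v] va l by auto
      then show False
        using no_triangle[of a b l u' u v] a b l al bl va ub by auto
    qed
  qed
  have "advantage (mirror v \<omega>) u = advantage \<omega> u"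
  proof (rule advantage_cong)
    fix w assume "w \<in> nbrs (mirror v \<omega>) u"
    then have w: "w \<in> nbrs \<omega> u" using nbrs_cong[of "mirror v \<omega>" \<omega> u] by simp
    then have "w \<noteq> v" using nbrs_not_greedy l by blast
    then show "main (mirror v \<omega>) w = main \<omega> w \<and> shadow (mirror v \<omega>) w = shadow \<omega> w"
      using disj w by (auto simp: mirror_def)
  qed simp
  moreover have "main (mirror v \<omega>) u = main \<omega> u" using disj[of u] l by (simp add: mirror_def)
  ultimately show ?thesis by (simp add: greedy_choice_def)
qed

text \<open>A fixed \<open>v\<close> influences another variable \<open>u\<close> only through an
  active constraint containing both, and such a constraint would share two variables with the
  inactive \<open>l\<close>.\<close>

lemma greedy_choice_flip_main:
  assumes l: "l < m" "v \<in> sc l" "u \<in> sc l" "\<not> greedy \<omega> v" and na: "\<And>j. \<not> active \<omega> l j"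
  shows "greedy_choice (flip_main v \<omega>) u = (if u = v then \<not> greedy_choice \<omega> u else greedy_choice \<omega> u)"
proof (cases "u = v")
  case True
  then show ?thesis using l by (simp add: greedy_choice_not_greedy)
next
  case False
  have "v \<notin> nbrs \<omega> u"
  proof
    assume "v \<in> nbrs \<omega> u"
    then obtain a where a: "a < m" "active \<omega> a u" "v \<in> sc a" by (auto simp: nbrs_def)
    then show False using meet_once[of a l u v] l False na active_mem by auto
  qed
  moreover have "nbrs (flip_main v \<omega>) u = nbrs \<omega> u" by (rule nbrs_cong) simp
  ultimately have "advantage (flip_main v \<omega>) u = advantage \<omega> u"
    by (intro advantage_cong) auto
  then show ?thesis using False by (simp add: greedy_choice_def)
qed

section \<open>Means of inactive and of active constraints\<close>

text \<open>Each value on the scope can be flipped alone: at a greedy variable by the mirror, at a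
  fixed one by its main coin. Both keep the marks and hence the inactivity of
  \<open>l\<close>.\<close>

lemma sum_inactive:
  assumes l: "l < m"
  defines "\<Omega> \<equiv> {\<omega> \<in> coin_space n. \<forall>j. \<not> active \<omega> l j}"
  shows "(\<Sum>\<omega>\<in>\<Omega>. constr_val (I ! l) (greedy_choice \<omega>)) = real (card \<Omega>) * constr_mean (I ! l)"
proof (rule sum_constr_val_uniform[where X = greedy_choice and T = "\<lambda>v \<omega>. if greedy \<omega> v then mirror v \<omega> else flip_main v \<omega>"])
  have fa: "active (flip_main v \<omega>) l j = active \<omega> l j" for v \<omega> j by (rule active_cong) simp
  show "finite \<Omega>" by (simp add: \<Omega>_def)
  show "distinct (scope (I ! l))" using l by (rule distinct_scope)
  fix v \<omega> assume v: "v \<in> sc l" "\<omega> \<in> \<Omega>"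
  let ?T = "\<lambda>\<omega>. if greedy \<omega> v then mirror v \<omega> else flip_main v \<omega>"
  show "?T \<omega> \<in> \<Omega> \<and> ?T (?T \<omega>) = \<omega>"
    using v sc_less[OF l v(1)]
    by (cases "greedy \<omega> v")
      (simp_all add: \<Omega>_def mirror_coin_space flip_main_coin_space mirror_mirror fa)
  fix u assume u: "u \<in> sc l"
  have na: "\<And>j. \<not> active \<omega> l j" using v by (simp add: \<Omega>_def)
  show "greedy_choice (?T \<omega>) u = (if u = v then \<not> greedy_choice \<omega> u else greedy_choice \<omega> u)"
    using greedy_choice_mirror[of v \<omega>] greedy_choice_mirror_other[OF l v(1) u]
      greedy_choice_flip_main[OF l v(1) u] na by (cases "greedy \<omega> v"; cases "u = v") simp_all
qed

text \<open>Activity depends on the marks only, so the main coins remain uniform under this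
  condition. The average over both values of \<open>j\<close> replaces the greedy value, which may
  be correlated with the other main coins of the scope.\<close>

lemma sum_active:
  assumes l: "l < m" "j \<in> sc l"
  defines "\<Omega> \<equiv> {\<omega> \<in> coin_space n. active \<omega> l j}"
  shows "(\<Sum>\<omega>\<in>\<Omega>. (constr_val (I ! l) ((main \<omega>)(j := True)) + constr_val (I ! l) ((main \<omega>)(j := False))) / 2)
    = real (card \<Omega>) * constr_mean (I ! l)"
proof -
  have fa: "active (flip_main v \<omega>) l j = active \<omega> l j" for v \<omega> by (rule active_cong) simp
  have fl: "flip_main v \<omega> \<in> \<Omega>" if "\<omega> \<in> \<Omega>" "v \<in> sc l" for v \<omega>
    using that l sc_less by (auto simp: \<Omega>_def fa flip_main_coin_space)
  \<comment> \<open>Flipping the main coin of \<open>j\<close> exchanges the two settings of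
    \<open>j\<close>.\<close>
  have "(\<Sum>\<omega>\<in>\<Omega>. constr_val (I ! l) ((main \<omega>)(j := True)) + constr_val (I ! l) ((main \<omega>)(j := False)))
    = (\<Sum>\<omega>\<in>\<Omega>. constr_val (I ! l) (main \<omega>) + constr_val (I ! l) (main (flip_main j \<omega>)))"
  proof (rule sum.cong[OF refl])
    fix \<omega>
    have 1: "main (flip_main j \<omega>) = (main \<omega>)(j := \<not> main \<omega> j)" by (auto simp: fun_eq_iff)
    have 2: "(main \<omega>)(j := main \<omega> j) = main \<omega>" by (auto simp: fun_eq_iff)
    show "constr_val (I ! l) ((main \<omega>)(j := True)) + constr_val (I ! l) ((main \<omega>)(j := False)) =
      constr_val (I ! l) (main \<omega>) + constr_val (I ! l) (main (flip_main j \<omega>))"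
      using 2 unfolding 1 by (cases "main \<omega> j") simp_all
  qed
  also have "\<dots> = 2 * (\<Sum>\<omega>\<in>\<Omega>. constr_val (I ! l) (main \<omega>))"
    using sum_involution[of \<Omega> "flip_main j" "\<lambda>\<omega>. constr_val (I ! l) (main \<omega>)"] fl l
    by (simp add: sum.distrib)
  also have "(\<Sum>\<omega>\<in>\<Omega>. constr_val (I ! l) (main \<omega>)) = real (card \<Omega>) * constr_mean (I ! l)"
    by (rule sum_constr_val_uniform[where T = flip_main])
       (use fl distinct_scope[OF l(1)] in \<open>auto simp: \<Omega>_def\<close>)
  finally show ?thesis by (simp add: sum_divide_distrib[symmetric] fun_upd_def)
qed

end

lemma sum_constr_val_assignments:
  assumes "distinct (scope C)" "set (scope C) \<subseteq> {..<n}"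
  shows "(\<Sum>x\<in>assignments n. of_bool (satisfies x C)) = real (card (assignments n)) * constr_mean C"
proof -
  have fin: "finite (assignments n)" unfolding assignments_def by (rule finite_PiE) auto
  have sgn: "x v = 1 \<or> x v = - 1" if "x \<in> assignments n" "v < n" for x v
    using PiE_mem[of x "{..<n}" "\<lambda>_. {-1, 1}" v] that by (auto simp: assignments_def)
  have "(\<Sum>x\<in>assignments n. of_bool (satisfies x C)) = (\<Sum>x\<in>assignments n. constr_val C (\<lambda>v. x v = 1))"
  proof (rule sum.cong[OF refl])
    fix x assume "x \<in> assignments n"
    then have "map x (scope C) = map (\<lambda>v. if x v = 1 then 1 else - 1) (scope C)"
      using sgn assms(2) by (intro map_cong) fastforce+
    then show "of_bool (satisfies x C) = constr_val C (\<lambda>v. x v = 1)"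
      by (simp only: satisfies_def constr_val_def)
  qed
  also have "\<dots> = real (card (assignments n)) * constr_mean C"
  proof (rule sum_constr_val_uniform[where X = "\<lambda>x v. x v = 1" and T = "\<lambda>v x. x(v := - x v)"])
    fix v x assume v: "v \<in> set (scope C)" "x \<in> assignments n"
    then have "v < n" using assms(2) by auto
    with sgn[OF v(2) this] v show "x(v := - x v) \<in> assignments n \<and> (x(v := - x v))(v := - (x(v := - x v)) v) = x"
      by (auto simp: assignments_def PiE_def extensional_def Pi_iff)
    fix u assume "u \<in> set (scope C)"
    show "((x(v := - x v)) u = 1) = (if u = v then \<not> x u = 1 else x u = 1)"
      using sgn[OF v(2) \<open>v < n\<close>] by auto
  qed (use fin assms in auto)
  finally show ?thesis .
qed

lemma csp_val_eq_sum: "csp_val I x = (\<Sum>l<length I. of_bool (satisfies x (I ! l))) / real (length I)"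
proof -
  have "{l. l < length I \<and> satisfies x (I ! l)} = {l \<in> {..<length I}. satisfies x (I ! l)}" by auto
  then show ?thesis by (simp add: csp_val_def Int_def)
qed

lemma random_val_eq_mean:
  assumes "csp_instance n I"
  shows "random_val n I = (\<Sum>l<length I. constr_mean (I ! l)) / real (length I)"
proof -
  let ?A = "assignments n"
  have fin: "finite ?A" unfolding assignments_def by (rule finite_PiE) auto
  have ne: "?A \<noteq> {}" using output_assignment_in by blast
  have "random_val n I = (\<Sum>x\<in>?A. csp_val I x) / real (card ?A)"
    unfolding random_val_def by (simp add: integral_pmf_of_set fin ne)
  also have "(\<Sum>x\<in>?A. csp_val I x) =
      (\<Sum>l<length I. \<Sum>x\<in>?A. of_bool (satisfies x (I ! l))) / real (length I)"
    unfolding csp_val_eq_sum sum_divide_distrib[symmetric] by (subst sum.swap) simp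
  also have "(\<Sum>l<length I. \<Sum>x\<in>?A. of_bool (satisfies x (I ! l))) =
      (\<Sum>l<length I. real (card ?A) * constr_mean (I ! l))"
    by (rule sum.cong) (use assms nth_mem in \<open>auto simp: csp_instance_def intro!: sum_constr_val_assignments\<close>)
  finally show ?thesis using fin ne by (simp flip: sum_distrib_left)
qed

lemma random_val_nonneg: "0 \<le> random_val n I"
  unfolding random_val_def by (rule integral_nonneg_AE) (auto simp: csp_val_def)

section \<open>Lower bounds for the variance and for the mean absolute advantage\<close>

definition flip_greedy :: "nat \<Rightarrow> coins \<Rightarrow> coins" where
  "flip_greedy v \<omega> = fun_upd \<omega> v (\<not> greedy \<omega> v, main \<omega> v, shadow \<omega> v)"

definition flip_shadow :: "nat \<Rightarrow> coins \<Rightarrow> coins" where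
  "flip_shadow v \<omega> = fun_upd \<omega> v (greedy \<omega> v, main \<omega> v, \<not> shadow \<omega> v)"

text \<open>The coins of the variables in \<open>vs\<close> form a list of
  \<open>3 * length vs\<close> bits, each of which can be flipped alone, so every pattern is equally
  frequent.\<close>

lemma card_coins_pattern:
  assumes "distinct vs" "set vs \<subseteq> {..<n}"
  shows "real (card {\<omega> \<in> coin_space n. \<forall>v\<in>set vs. \<omega> v = (f v, b v, b' v)}) =
    real (card (coin_space n)) / 8 ^ length vs"
proof -
  let ?r = "length vs"
  define X where "X \<omega> = map (greedy \<omega>) vs @ map (main \<omega>) vs @ map (shadow \<omega>) vs" for \<omega>
  define p where "p = map f vs @ map b vs @ map b' vs"
  \<comment> \<open>The positions follow the order in \<open>X\<close>: the marks, then the main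
    coins, then the shadow coins.\<close>
  define T where "T i = (if i < ?r then flip_greedy (vs ! i) else if i < 2 * ?r then flip_main (vs ! (i - ?r))
    else flip_shadow (vs ! (i - 2 * ?r)))" for i
  note flip_defs = flip_greedy_def flip_main_def flip_shadow_def
  have "(\<Sum>\<omega>\<in>coin_space n. of_bool (X \<omega> = p)) =
    real (card (coin_space n)) * ((\<Sum>c | length c = 3 * ?r. of_bool (c = p)) / 2 ^ (3 * ?r))"
  proof (rule sum_uniform_of_flips[where T = T])
    fix i \<omega> assume i: "i < 3 * ?r" and w: "\<omega> \<in> coin_space n"
    have lt: "vs ! j < n" if "j < ?r" for j using assms(2) that nth_mem by blast
    show "T i \<omega> \<in> coin_space n"
    proof -
      have "vs ! i < n" if "i < ?r" using lt that .
      moreover have "vs ! (i - ?r) < n" if "\<not> i < ?r" "i < 2 * ?r" using that by (intro lt) linarith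
      moreover have "vs ! (i - 2 * ?r) < n" if "\<not> i < 2 * ?r" using that i by (intro lt) linarith
      ultimately show ?thesis using w by (auto simp: T_def coin_space_def flip_defs)
    qed
    show "T i (T i \<omega>) = \<omega>" by (simp add: T_def flip_defs)
    show "X (T i \<omega>) = (X \<omega>)[i := \<not> X \<omega> ! i]"
    proof -
      consider "i < ?r" | "?r \<le> i" "i < 2 * ?r" | "2 * ?r \<le> i" "i < 3 * ?r" using i by linarith
      then show ?thesis
      proof cases
        case 1
        then have "map (greedy (T i \<omega>)) vs = (map (greedy \<omega>) vs)[i := \<not> map (greedy \<omega>) vs ! i]"
          by (intro map_scope_flip[OF assms(1)]) (auto simp: T_def flip_defs)
        moreover have "main (T i \<omega>) = main \<omega>" "shadow (T i \<omega>) = shadow \<omega>"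
          using 1 by (auto simp: T_def flip_defs fun_eq_iff)
        ultimately show ?thesis using 1 by (simp add: X_def list_update_append nth_append)
      next
        case 2
        then have "map (main (T i \<omega>)) vs = (map (main \<omega>) vs)[i - ?r := \<not> map (main \<omega>) vs ! (i - ?r)]"
          by (intro map_scope_flip[OF assms(1)]) (auto simp: T_def flip_defs)
        moreover have "greedy (T i \<omega>) = greedy \<omega>" "shadow (T i \<omega>) = shadow \<omega>"
          using 2 by (auto simp: T_def flip_defs fun_eq_iff)
        moreover have "i - ?r < ?r" using 2 by linarith
        ultimately show ?thesis using 2 by (simp add: X_def list_update_append nth_append)
      next
        case 3
        then have "map (shadow (T i \<omega>)) vs = (map (shadow \<omega>) vs)[i - 2 * ?r := \<not> map (shadow \<omega>) vs ! (i - 2 * ?r)]"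
          by (intro map_scope_flip[OF assms(1)]) (auto simp: T_def flip_defs)
        moreover have "greedy (T i \<omega>) = greedy \<omega>" "main (T i \<omega>) = main \<omega>"
          using 3 by (auto simp: T_def flip_defs fun_eq_iff)
        moreover have "i - ?r - ?r = i - 2 * ?r" "\<not> i - ?r < ?r" "i - 2 * ?r < ?r" using 3 by linarith+
        ultimately show ?thesis using 3 by (simp add: X_def list_update_append nth_append)
      qed
    qed
  qed (simp_all add: X_def)
  moreover have "(\<Sum>c | length c = 3 * ?r. of_bool (c = p)) = (1 :: real)"
    using finite_bool_lists[of "3 * ?r"] by (simp add: of_bool_def sum.delta p_def)
  moreover have "(\<Sum>\<omega>\<in>coin_space n. of_bool (X \<omega> = p)) =
      real (card {\<omega> \<in> coin_space n. \<forall>v\<in>set vs. \<omega> v = (f v, b v, b' v)})"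
  proof -
    have "X \<omega> = p \<longleftrightarrow> (\<forall>v\<in>set vs. \<omega> v = (f v, b v, b' v))" for \<omega>
      by (auto simp: X_def p_def prod_eq_iff)
    then show ?thesis by (simp add: Int_def)
  qed
  moreover have "(2 :: real) ^ (3 * ?r) = 8 ^ ?r" by (simp add: power_mult)
  ultimately show ?thesis by simp
qed

context tf_csp
begin

lemma var_degree_eq: "var_degree I j = card {l \<in> {..<m}. j \<in> sc l}"
  unfolding var_degree_def by (rule arg_cong[where f = card]) auto

lemma D_pos: "D > 0"
proof -
  have 0: "0 < m" using nonempty by simp
  have "scope (I ! 0) \<noteq> []" using ar[of "I ! 0"] nth_mem[OF 0] by (auto simp: arity_def)
  then obtain j where j: "j \<in> sc 0" by (meson list.set_intros(1) neq_Nil_conv hd_in_set)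
  then have "0 < var_degree I j" unfolding var_degree_eq using 0 by (auto simp: card_gt_0_iff)
  then show ?thesis using deg[OF sc_less[OF 0 j]] by linarith
qed

text \<open>Take two contexts with different derivatives and prescribe all coins on the scope: only
  \<open>j\<close> is greedy, main and shadow equal the two contexts. On this event the swing is a
  nonzero integer.\<close>

lemma sum_swing_sq_ge:
  assumes l: "l < m"
  shows "\<exists>j\<in>sc l. (\<Sum>\<omega>\<in>coin_space n. (swing j l \<omega>)\<^sup>2) \<ge> real (card (coin_space n)) / 8 ^ arity (I ! l)"
proof -
  have "2 \<le> arity (I ! l)" using ar l by simp
  then have "scope (I ! l) \<noteq> []" by (auto simp: arity_def)
  then obtain j where j: "j \<in> sc l" using hd_in_set by blast
  obtain b b' where b: "discrete_deriv (I ! l) j b \<noteq> discrete_deriv (I ! l) j b'"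
    using discrete_deriv_nonconstant[OF depends[OF l] distinct_scope[OF l] _ j] ar l by auto
  let ?P = "{\<omega> \<in> coin_space n. \<forall>v\<in>sc l. \<omega> v = (v = j, b v, b' v)}"
  have "1 \<le> (swing j l \<omega>)\<^sup>2" if "\<omega> \<in> ?P" for \<omega>
  proof -
    have "active \<omega> l j" using that j by (auto simp: active_def)
    moreover have "discrete_deriv (I ! l) j (main \<omega>) = discrete_deriv (I ! l) j b"
      "discrete_deriv (I ! l) j (shadow \<omega>) = discrete_deriv (I ! l) j b'"
      using that by (auto intro!: discrete_deriv_cong)
    ultimately show ?thesis
      using b discrete_deriv_cases[of "I ! l" j b] discrete_deriv_cases[of "I ! l" j b']
      by (auto simp: swing_def)
  qed
  then have "(\<Sum>\<omega>\<in>?P. 1) \<le> (\<Sum>\<omega>\<in>?P. (swing j l \<omega>)\<^sup>2)" by (rule sum_mono)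
  also have "\<dots> \<le> (\<Sum>\<omega>\<in>coin_space n. (swing j l \<omega>)\<^sup>2)" by (rule sum_mono2) auto
  finally have "real (card ?P) \<le> (\<Sum>\<omega>\<in>coin_space n. (swing j l \<omega>)\<^sup>2)" by simp
  moreover have "sc l \<subseteq> {..<n}" using sc_less[OF l] by auto
  ultimately show ?thesis
    using card_coins_pattern[OF distinct_scope[OF l], of n "\<lambda>v. v = j" b b'] j
    by (auto simp: arity_def)
qed

text \<open>Exchanging main and shadow on \<open>sc l - {j}\<close> negates the swing of
  \<open>l\<close>. Two scopes through \<open>j\<close> share no other variable, so the remaining
  swings are unchanged, as \<open>sum_abs_ge_variance\<close> demands.\<close>

lemma sum_abs_advantage_ge:
  assumes j: "j < n"
  shows "(\<Sum>\<omega>\<in>coin_space n. \<bar>advantage \<omega> j\<bar>) \<ge>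
    (\<Sum>l | l < m \<and> j \<in> sc l. \<Sum>\<omega>\<in>coin_space n. (swing j l \<omega>)\<^sup>2) / (6 * sqrt (real D))"
proof -
  let ?B = "{l. l < m \<and> j \<in> sc l}" and ?T = "\<lambda>l. swap_shadow (sc l - {j})"
  have act: "active (swap_shadow A \<omega>) l j = active \<omega> l j" for A \<omega> l by (rule active_cong) simp
  have bound: "(\<Sum>l\<in>?B. \<Sum>\<omega>\<in>coin_space n. (swing j l \<omega>)\<^sup>2) / (6 * sqrt (real D)) \<le>
     (\<Sum>\<omega>\<in>coin_space n. \<bar>\<Sum>l\<in>?B. swing j l \<omega>\<bar>)"
  proof (rule sum_abs_ge_variance[where T = ?T])
    show "real (card ?B) \<le> real D" using deg[OF j] by (simp add: var_degree_eq)
    show "real D > 0" using D_pos by simp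
    fix l \<omega> assume "l \<in> ?B"
    show "\<bar>swing j l \<omega>\<bar> \<le> 2"
      using discrete_deriv_cases[of "I ! l" j "main \<omega>"] discrete_deriv_cases[of "I ! l" j "shadow \<omega>"]
      by (auto simp: swing_def)
    have "discrete_deriv (I ! l) j (main (?T l \<omega>)) = discrete_deriv (I ! l) j (shadow \<omega>)"
      "discrete_deriv (I ! l) j (shadow (?T l \<omega>)) = discrete_deriv (I ! l) j (main \<omega>)"
      by (auto intro!: discrete_deriv_cong)
    then show "swing j l (?T l \<omega>) = - swing j l \<omega>" by (simp add: swing_def act)
  next
    fix l l' \<omega> assume l: "l \<in> ?B" "l' \<in> ?B" "l \<noteq> l'"
    then have "v \<notin> sc l - {j}" if "v \<in> sc l'" for v using that meet_once[of l l' v j] by auto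
    then have "discrete_deriv (I ! l') j (main (?T l \<omega>)) = discrete_deriv (I ! l') j (main \<omega>)"
      "discrete_deriv (I ! l') j (shadow (?T l \<omega>)) = discrete_deriv (I ! l') j (shadow \<omega>)"
      by (auto intro!: discrete_deriv_cong)
    then show "swing j l' (?T l \<omega>) = swing j l' \<omega>" by (simp add: swing_def act)
  qed (auto simp: swap_shadow_coin_space)
  have "(\<Sum>l\<in>?B. swing j l \<omega>) = advantage \<omega> j" for \<omega>
    unfolding advantage_def by (rule sum.mono_neutral_left) (auto simp: swing_def dest: active_mem)
  with bound show ?thesis by simp
qed

section \<open>The expected value of one trial\<close>

text \<open>Half of this is the excess of an active constraint over its average for the two values
  of \<open>j\<close>.\<close>

definition gain :: "nat \<Rightarrow> nat \<Rightarrow> coins \<Rightarrow> real" where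
  "gain j l \<omega> = (if active \<omega> l j then
     (if greedy_choice \<omega> j then 1 else - 1) * discrete_deriv (I ! l) j (main \<omega>) else 0)"

text \<open>Summed over \<open>l\<close>, the gain is \<open>W j\<close> times the sign of the
  choice at \<open>j\<close>. The mirror reverses the choice and replaces \<open>W j\<close> by
  \<open>W' j\<close>, so a coin pattern and its mirror image together gain
  \<open>|W j - W' j|\<close>.\<close>

lemma sum_gain:
  assumes j: "j < n"
  shows "(\<Sum>\<omega>\<in>coin_space n. \<Sum>l<m. gain j l \<omega>) = (\<Sum>\<omega>\<in>coin_space n. \<bar>advantage \<omega> j\<bar>) / 2"
proof -
  let ?s = "\<lambda>\<omega>. if greedy_choice \<omega> j then 1 else - 1 :: real"
  define f where "f \<omega> = (\<Sum>l<m. gain j l \<omega>)" for \<omega>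
  have "f \<omega> + f (mirror j \<omega>) = \<bar>advantage \<omega> j\<bar>" for \<omega>
  proof -
    have "gain j l \<omega> + gain j l (mirror j \<omega>) = ?s \<omega> * swing j l \<omega>" if "l < m" for l
      using deriv_mirror[OF _ that] by (auto simp: gain_def swing_def greedy_choice_mirror)
    then have "f \<omega> + f (mirror j \<omega>) = ?s \<omega> * advantage \<omega> j"
      by (simp add: f_def advantage_def sum_distrib_left flip: sum.distrib)
    then show ?thesis by (auto simp: greedy_choice_def)
  qed
  then have "(\<Sum>\<omega>\<in>coin_space n. \<bar>advantage \<omega> j\<bar>) = (\<Sum>\<omega>\<in>coin_space n. f \<omega> + f (mirror j \<omega>))"
    by simp
  also have "\<dots> = 2 * (\<Sum>\<omega>\<in>coin_space n. f \<omega>)"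
    using sum_involution[of "coin_space n" "mirror j" f] j
    by (simp add: sum.distrib mirror_coin_space mirror_mirror)
  finally show ?thesis by (simp add: f_def)
qed

text \<open>A constraint is active at no more than one variable, so the cases partition the coin
  space.\<close>

lemma sum_split_active:
  fixes f :: "coins \<Rightarrow> real"
  assumes l: "l < m"
  shows "(\<Sum>\<omega>\<in>coin_space n. f \<omega>) = (\<Sum>\<omega> | \<omega> \<in> coin_space n \<and> (\<forall>j. \<not> active \<omega> l j). f \<omega>) +
    (\<Sum>j<n. \<Sum>\<omega> | \<omega> \<in> coin_space n \<and> active \<omega> l j. f \<omega>)"
proof -
  have uniq: "active \<omega> l i \<Longrightarrow> active \<omega> l j \<longleftrightarrow> j = i" for \<omega> i j by (auto simp: active_def)
  have "f \<omega> = (if \<forall>j. \<not> active \<omega> l j then f \<omega> else 0) + (\<Sum>j<n. if active \<omega> l j then f \<omega> else 0)" for \<omega>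
  proof (cases "\<forall>j. \<not> active \<omega> l j")
    case False
    then obtain i where i: "active \<omega> l i" by blast
    then have "i < n" using active_mem sc_less[OF l] by blast
    then show ?thesis using i by (auto simp: uniq)
  qed simp
  then have "(\<Sum>\<omega>\<in>coin_space n. f \<omega>) =
     (\<Sum>\<omega>\<in>coin_space n. if \<forall>j. \<not> active \<omega> l j then f \<omega> else 0) +
     (\<Sum>\<omega>\<in>coin_space n. \<Sum>j<n. if active \<omega> l j then f \<omega> else 0)"
    by (metis (mono_tags, lifting) sum.cong sum.distrib)
  also have "(\<Sum>\<omega>\<in>coin_space n. \<Sum>j<n. if active \<omega> l j then f \<omega> else 0) =
     (\<Sum>j<n. \<Sum>\<omega>\<in>coin_space n. if active \<omega> l j then f \<omega> else 0)"
    by (rule sum.swap)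
  finally show ?thesis by (simp add: sum.inter_filter)
qed

text \<open>If \<open>l\<close> is active at \<open>j\<close>, its other variables have their main
  coins as values, so its value is the average over both settings of \<open>j\<close> plus half the
  gain. Otherwise \<open>sum_inactive\<close> applies.\<close>

lemma sum_constr_val_greedy_choice:
  assumes l: "l < m"
  shows "(\<Sum>\<omega>\<in>coin_space n. constr_val (I ! l) (greedy_choice \<omega>)) =
    real (card (coin_space n)) * constr_mean (I ! l) + (\<Sum>j<n. \<Sum>\<omega>\<in>coin_space n. gain j l \<omega>) / 2"
proof -
  let ?C = "I ! l" and ?N = "\<lambda>j. {\<omega> \<in> coin_space n. active \<omega> l j}"
  have act: "(\<Sum>\<omega>\<in>?N j. constr_val ?C (greedy_choice \<omega>)) =
      real (card (?N j)) * constr_mean ?C + (\<Sum>\<omega>\<in>coin_space n. gain j l \<omega>) / 2" for j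
  proof (cases "j \<in> sc l")
    case True
    have "constr_val ?C (greedy_choice \<omega>) =
      (constr_val ?C ((main \<omega>)(j := True)) + constr_val ?C ((main \<omega>)(j := False))) / 2 + gain j l \<omega> / 2"
      if "\<omega> \<in> ?N j" for \<omega>
    proof -
      have a: "active \<omega> l j" using that by simp
      have "constr_val ?C (greedy_choice \<omega>) = constr_val ?C ((main \<omega>)(j := greedy_choice \<omega> j))"
        using activeD[OF a] by (intro constr_val_cong) (auto simp: greedy_choice_not_greedy)
      then show ?thesis using a by (cases "greedy_choice \<omega> j") (simp_all add: gain_def discrete_deriv_def field_simps)
    qed
    then have "(\<Sum>\<omega>\<in>?N j. constr_val ?C (greedy_choice \<omega>)) =
      real (card (?N j)) * constr_mean ?C + (\<Sum>\<omega>\<in>?N j. gain j l \<omega> / 2)"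
      using sum_active[OF l True] by (simp add: sum.distrib)
    moreover have "(\<Sum>\<omega>\<in>?N j. gain j l \<omega>) = (\<Sum>\<omega>\<in>coin_space n. gain j l \<omega>)"
      by (rule sum.mono_neutral_left) (auto simp: gain_def)
    ultimately show ?thesis by (simp flip: sum_divide_distrib)
  next
    case False
    then have "\<not> active \<omega> l j" for \<omega> using active_mem by blast
    then show ?thesis by (simp add: gain_def)
  qed
  have card: "real (card (coin_space n)) =
      real (card {\<omega> \<in> coin_space n. \<forall>j. \<not> active \<omega> l j}) + (\<Sum>j<n. real (card (?N j)))"
    using sum_split_active[OF l, of "\<lambda>_. 1"] by simp
  show ?thesis
    unfolding sum_split_active[OF l, of "\<lambda>\<omega>. constr_val ?C (greedy_choice \<omega>)"] act sum_inactive[OF l] card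
    by (simp add: sum.distrib algebra_simps flip: sum_distrib_left sum_divide_distrib)
qed

definition trial_val :: "coins \<Rightarrow> real" where
  "trial_val \<omega> = (\<Sum>l<m. constr_val (I ! l) (greedy_choice \<omega>)) / m"

lemma trial_val_le_1: "trial_val \<omega> \<le> 1"
proof -
  have "(\<Sum>l<m. constr_val (I ! l) (greedy_choice \<omega>)) \<le> (\<Sum>l<m. 1)"
    by (rule sum_mono) (rule constr_val_bounds)
  then show ?thesis using nonempty by (simp add: trial_val_def divide_le_eq_1)
qed

text \<open>The constant is 24 = 6 * 2 * 2: the 6 is that of the moment bound, one 2 comes from
  \<open>sum_gain\<close>, and the other from the half of the gain that enters the value.\<close>

lemma sum_trial_val_ge:
  assumes k: "\<And>C. C \<in> set I \<Longrightarrow> arity C \<le> k"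
  shows "(\<Sum>\<omega>\<in>coin_space n. trial_val \<omega>) \<ge>
    real (card (coin_space n)) * (random_val n I + 1 / (24 * 8 ^ k * sqrt (real D)))"
proof -
  let ?c = "real (card (coin_space n))"
  have "?c * m / 8 ^ k = (\<Sum>l<m. ?c / 8 ^ k)" by simp
  also have "\<dots> \<le> (\<Sum>l<m. \<Sum>j\<in>sc l. \<Sum>\<omega>\<in>coin_space n. (swing j l \<omega>)\<^sup>2)"
  proof (rule sum_mono)
    fix l assume "l \<in> {..<m}"
    then have l: "l < m" by simp
    obtain j where j: "j \<in> sc l" "?c / 8 ^ arity (I ! l) \<le> (\<Sum>\<omega>\<in>coin_space n. (swing j l \<omega>)\<^sup>2)"
      using sum_swing_sq_ge[OF l] by blast
    have "?c / 8 ^ k \<le> ?c / 8 ^ arity (I ! l)"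
      using k l by (intro divide_left_mono power_increasing) auto
    also note j(2)
    also have "(\<Sum>\<omega>\<in>coin_space n. (swing j l \<omega>)\<^sup>2) \<le> (\<Sum>j\<in>sc l. \<Sum>\<omega>\<in>coin_space n. (swing j l \<omega>)\<^sup>2)"
      using j(1) by (intro member_le_sum sum_nonneg) auto
    finally show "?c / 8 ^ k \<le> (\<Sum>j\<in>sc l. \<Sum>\<omega>\<in>coin_space n. (swing j l \<omega>)\<^sup>2)" .
  qed
  also have "\<dots> = (\<Sum>l<m. \<Sum>j | j \<in> {..<n} \<and> j \<in> sc l. \<Sum>\<omega>\<in>coin_space n. (swing j l \<omega>)\<^sup>2)"
    using sc_less by (intro sum.cong) auto
  \<comment> \<open>Incidences of variables and scopes are now grouped by variable, since
    anticoncentration is applied at each variable separately.\<close>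
  also have "\<dots> = (\<Sum>j<n. \<Sum>l | l \<in> {..<m} \<and> j \<in> sc l. \<Sum>\<omega>\<in>coin_space n. (swing j l \<omega>)\<^sup>2)"
    by (rule sum.swap_restrict) auto
  finally have 1: "?c * m / 8 ^ k / (6 * sqrt D) \<le>
     (\<Sum>j<n. (\<Sum>l | l < m \<and> j \<in> sc l. \<Sum>\<omega>\<in>coin_space n. (swing j l \<omega>)\<^sup>2) / (6 * sqrt D))"
    unfolding sum_divide_distrib[symmetric] by (intro divide_right_mono) simp_all
  also have "\<dots> \<le> (\<Sum>j<n. \<Sum>\<omega>\<in>coin_space n. \<bar>advantage \<omega> j\<bar>)"
    using sum_abs_advantage_ge by (intro sum_mono) simp
  also have "\<dots> = (\<Sum>j<n. 2 * (\<Sum>\<omega>\<in>coin_space n. \<Sum>l<m. gain j l \<omega>))"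
    using sum_gain by (intro sum.cong) (auto simp: mult_ac)
  also have "\<dots> = 2 * (\<Sum>j<n. \<Sum>\<omega>\<in>coin_space n. \<Sum>l<m. gain j l \<omega>)"
    by (simp add: sum_distrib_left)
  also have "(\<Sum>j<n. \<Sum>\<omega>\<in>coin_space n. \<Sum>l<m. gain j l \<omega>) = (\<Sum>j<n. \<Sum>l<m. \<Sum>\<omega>\<in>coin_space n. gain j l \<omega>)"
    by (intro sum.cong refl) (rule sum.swap)
  also have "\<dots> = (\<Sum>l<m. \<Sum>j<n. \<Sum>\<omega>\<in>coin_space n. gain j l \<omega>)"
    by (rule sum.swap)
  finally have gain: "?c * m / 8 ^ k / (6 * sqrt D) \<le> 2 * (\<Sum>l<m. \<Sum>j<n. \<Sum>\<omega>\<in>coin_space n. gain j l \<omega>)" .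
  have m0: "real m > 0" using nonempty by simp
  have "(\<Sum>\<omega>\<in>coin_space n. trial_val \<omega>) =
      (\<Sum>l<m. \<Sum>\<omega>\<in>coin_space n. constr_val (I ! l) (greedy_choice \<omega>)) / m"
    unfolding trial_val_def sum_divide_distrib[symmetric] by (subst sum.swap) simp
  also have "(\<Sum>l<m. \<Sum>\<omega>\<in>coin_space n. constr_val (I ! l) (greedy_choice \<omega>)) =
     ?c * (\<Sum>l<m. constr_mean (I ! l)) + (\<Sum>l<m. \<Sum>j<n. \<Sum>\<omega>\<in>coin_space n. gain j l \<omega>) / 2"
    by (simp add: sum_constr_val_greedy_choice sum.distrib sum_distrib_left sum_divide_distrib)
  finally have tv: "(\<Sum>\<omega>\<in>coin_space n. trial_val \<omega>) = (?c * (\<Sum>l<m. constr_mean (I ! l)) +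
    (\<Sum>l<m. \<Sum>j<n. \<Sum>\<omega>\<in>coin_space n. gain j l \<omega>) / 2) / m" .
  have "?c * (\<Sum>l<m. constr_mean (I ! l)) + ?c * m / 8 ^ k / (6 * sqrt D) / 4 \<le>
    ?c * (\<Sum>l<m. constr_mean (I ! l)) + (\<Sum>l<m. \<Sum>j<n. \<Sum>\<omega>\<in>coin_space n. gain j l \<omega>) / 2"
  proof (rule add_left_mono)
    have "u / 4 \<le> G / 2" if "u \<le> 2 * G" for u G :: real using that by simp
    from this[OF gain] show "?c * m / 8 ^ k / (6 * sqrt D) / 4 \<le>
      (\<Sum>l<m. \<Sum>j<n. \<Sum>\<omega>\<in>coin_space n. gain j l \<omega>) / 2" .
  qed
  then have "(\<Sum>\<omega>\<in>coin_space n. trial_val \<omega>) \<ge>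
      (?c * (\<Sum>l<m. constr_mean (I ! l)) + ?c * m / 8 ^ k / (6 * sqrt D) / 4) / m"
    unfolding tv using m0 by (intro divide_right_mono) simp_all
  also have "(?c * (\<Sum>l<m. constr_mean (I ! l)) + ?c * m / 8 ^ k / (6 * sqrt D) / 4) / m =
     ?c * (random_val n I + 1 / (24 * 8 ^ k * sqrt D))"
    using m0 D_pos by (simp add: random_val_eq_mean[OF inst] field_simps)
  finally show ?thesis .
qed

text \<open>Markov's inequality for a value that is at most 1 and has mean at least \<mu> + 2
  \<delta>; halving the expected excess turns 24 into 48.\<close>

lemma good_coins:
  assumes k: "\<And>C. C \<in> set I \<Longrightarrow> arity C \<le> k"
  defines "\<delta> \<equiv> 1 / (48 * 8 ^ k * sqrt (real D))"
  shows "real (card {\<omega> \<in> coin_space n. trial_val \<omega> \<ge> random_val n I + \<delta>}) \<ge> \<delta> * card (coin_space n)"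
proof -
  let ?c = "real (card (coin_space n))"
  let ?G = "{\<omega> \<in> coin_space n. trial_val \<omega> \<ge> random_val n I + \<delta>}"
  have d0: "\<delta> \<ge> 0" by (simp add: \<delta>_def)
  have "?c * (random_val n I + 2 * \<delta>) \<le> (\<Sum>\<omega>\<in>coin_space n. trial_val \<omega>)"
    using sum_trial_val_ge[OF k] by (simp add: \<delta>_def mult_ac)
  \<comment> \<open>Good coins are worth at most 1, and the others at most \<mu> + \<delta>.\<close>
  also have "\<dots> \<le> (\<Sum>\<omega>\<in>coin_space n. of_bool (trial_val \<omega> \<ge> random_val n I + \<delta>) + (random_val n I + \<delta>))"
    using trial_val_le_1 random_val_nonneg[of n I] d0
    by (intro sum_mono) (auto simp: of_bool_def add_increasing2)
  also have "\<dots> = real (card ?G) + ?c * (random_val n I + \<delta>)"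
    by (simp add: sum.distrib Int_def)
  finally show ?thesis by (simp add: algebra_simps)
qed

end

section \<open>Timed semantics of programs\<close>

lemma run_SKIP [simp]: "run t SKIP s = return_pmf (SKIP, s)"
  by (induction t) (auto simp: bind_return_pmf)

lemma run_add: "run (t1 + t2) c s = run t1 c s \<bind> (\<lambda>(c', s'). run t2 c' s')"
  by (induction t1 arbitrary: c s)
    (auto simp: bind_return_pmf bind_assoc_pmf split_beta intro!: bind_pmf_cong)

section \<open>Running time and output distribution of sequences and loops\<close>

text \<open>One equation states both that every path of coin flips has halted after \<open>t\<close>
  steps and how the final memory is distributed. As \<open>SKIP\<close> idles, \<open>t\<close> is
  an upper bound on the time.\<close>

definition result :: "com \<Rightarrow> mem \<Rightarrow> nat \<Rightarrow> mem pmf \<Rightarrow> bool" where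
  "result c s t M \<longleftrightarrow> run t c s = map_pmf (Pair SKIP) M"

lemma result_weaken: "result c s t M \<Longrightarrow> t \<le> t' \<Longrightarrow> result c s t' M"
  using run_add[of t "t' - t" c s] by (simp add: result_def map_pmf_def bind_assoc_pmf bind_return_pmf)


text \<open>\<open>c1\<close> may halt at different times on different paths, so the induction
  follows its time bound step by step. One extra step removes the finished \<open>SKIP\<close>, and
  \<open>t2\<close> has to serve all memories that \<open>c1\<close> can produce.\<close>

lemma result_Seq:
  assumes "result c1 s t1 M1" "\<And>s'. s' \<in> set_pmf M1 \<Longrightarrow> result c2 s' t2 (M2 s')"
  shows "result (Seq c1 c2) s (t1 + t2 + 1) (M1 \<bind> M2)"
  using assms
proof (induction t1 arbitrary: c1 s M1)
  case 0
  then have eq: "map_pmf (Pair SKIP) M1 = return_pmf (c1, s)" by (simp add: result_def)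
  then have "set_pmf (map_pmf (Pair SKIP) M1) = {(c1, s)}" by simp
  then have "c1 = SKIP" using set_pmf_not_empty[of M1] by auto
  then have "map_pmf (Pair SKIP) M1 = map_pmf (Pair SKIP) (return_pmf s)" using eq by simp
  then have M1: "M1 = return_pmf s" by (rule pmf.inj_map_strong[rotated]) auto
  with 0 \<open>c1 = SKIP\<close> show ?case by (simp add: result_def bind_return_pmf)
next
  case (Suc t)
  show ?case
  proof (cases "c1 = SKIP")
    case True
    then have "map_pmf (Pair SKIP) M1 = map_pmf (Pair SKIP) (return_pmf s)"
      using Suc.prems by (simp add: result_def bind_return_pmf)
    then have M1: "M1 = return_pmf s" by (rule pmf.inj_map_strong[rotated]) auto
    then have "result c2 s (t2 + Suc t) (M2 s)" using result_weaken Suc.prems(2)[of s] by simp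
    then show ?thesis using True M1 by (simp add: result_def bind_return_pmf add_ac)
  next
    case False
    \<comment> \<open>\<open>N p\<close> is the output distribution of the rest of \<open>c1\<close>
      after its first step to \<open>p\<close>. \<open>M1\<close> is the mixture of these, because
      \<open>map_pmf (Pair SKIP)\<close> is injective.\<close>
    define N where "N p = map_pmf snd (run t (fst p) (snd p))" for p
    have N: "result c' s' t (N (c', s'))" if "(c', s') \<in> set_pmf (step c1 s)" for c' s'
    proof -
      have "fst ` set_pmf (run t c' s') \<subseteq> fst ` set_pmf (run (Suc t) c1 s)" using that by force
      also have "\<dots> \<subseteq> {SKIP}" using Suc.prems(1) by (auto simp: result_def)
      finally have "map_pmf (\<lambda>p. (SKIP, snd p)) (run t c' s') = map_pmf id (run t c' s')"
        by (intro map_pmf_cong) (auto simp: prod_eq_iff)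
      then show ?thesis
        by (simp add: N_def result_def pmf.map_comp comp_def)
    qed
    have "map_pmf (Pair SKIP) M1 = step c1 s \<bind> (\<lambda>p. map_pmf (Pair SKIP) (N p))"
      using Suc.prems(1) N by (simp add: result_def split_beta cong: bind_pmf_cong_simp)
    also have "\<dots> = map_pmf (Pair SKIP) (step c1 s \<bind> N)" by (simp add: map_bind_pmf)
    finally have M1: "M1 = step c1 s \<bind> N" by (rule pmf.inj_map_strong[rotated]) auto
    have "result (Seq c' c2) s' (t + t2 + 1) (N (c', s') \<bind> M2)"
      if "(c', s') \<in> set_pmf (step c1 s)" for c' s'
      using that by (intro Suc.IH N) (use Suc.prems(2) M1 in auto)
    then have "run (t + t2 + 1) (Seq (fst p) c2) (snd p) = map_pmf (Pair SKIP) (N p \<bind> M2)"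
      if "p \<in> set_pmf (step c1 s)" for p
      using that by (cases p) (auto simp: result_def)
    then have "step c1 s \<bind> (\<lambda>p. run (t + t2 + 1) (Seq (fst p) c2) (snd p)) =
      step c1 s \<bind> (\<lambda>p. map_pmf (Pair SKIP) (N p \<bind> M2))"
      by (intro bind_pmf_cong) auto
    then show ?thesis using False M1
      by (simp add: result_def bind_map_pmf split_beta bind_assoc_pmf map_bind_pmf)
  qed
qed

lemma result_step:
  assumes "step c s = return_pmf (c', s')" "result c' s' t M"
  shows "result c s (Suc t) M"
  using assms by (simp add: result_def bind_return_pmf)

lemma result_Cond: "result (if bval b s then c1 else c2) s t M \<Longrightarrow> result (Cond b c1 c2) s (Suc t) M"
  by (rule result_step) auto

lemma result_While: "result (Cond b (Seq c (While b c)) SKIP) s t M \<Longrightarrow> result (While b c) s (Suc t) M"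
  by (rule result_step) auto

lemma result_SKIP: "result SKIP s t (return_pmf s)"
  by (simp add: result_def)

lemma result_Store: "result (Store v e1 e2) s 1 (return_pmf (write_cell v (aval e1 s) (aval e2 s) s))"
  by (simp add: result_def bind_return_pmf)

lemma result_Flip:
  "result (Flip v e) s 1 (map_pmf (\<lambda>b. write_cell v (aval e s) (of_bool b) s) (bernoulli_pmf (1 / 2)))"
  by (simp add: result_def bind_map_pmf bind_return_pmf map_pmf_def bind_assoc_pmf)

text \<open>Frame conditions are read off the program text: an array that no instruction has as its
  target keeps its contents.\<close>

primrec arrays_written :: "com \<Rightarrow> string set" where
  "arrays_written SKIP = {}"
| "arrays_written (Store v e1 e2) = {v}"
| "arrays_written (Flip v e) = {v}"
| "arrays_written (Seq c1 c2) = arrays_written c1 \<union> arrays_written c2"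
| "arrays_written (Cond b c1 c2) = arrays_written c1 \<union> arrays_written c2"
| "arrays_written (While b c) = arrays_written c"

lemma step_frame:
  "(c', s') \<in> set_pmf (step c s) \<Longrightarrow>
    arrays_written c' \<subseteq> arrays_written c \<and> (\<forall>v. v \<notin> arrays_written c \<longrightarrow> s' v = s v)"
  by (induction c arbitrary: c' s') (fastforce simp: write_cell_def split: if_splits)+

lemma run_frame:
  "(c', s') \<in> set_pmf (run t c s) \<Longrightarrow> v \<notin> arrays_written c \<Longrightarrow> s' v = s v"
proof (induction t arbitrary: c s)
  case (Suc t)
  then obtain c1 s1 where 1: "(c1, s1) \<in> set_pmf (step c s)" "(c', s') \<in> set_pmf (run t c1 s1)" by auto
  then show ?case using step_frame[OF 1(1)] Suc.IH[OF 1(2)] Suc.prems(2) by auto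
qed auto

lemma result_frame:
  assumes "result c s t M" "s' \<in> set_pmf M" "v \<notin> arrays_written c"
  shows "s' v = s v"
  by (rule run_frame[where c' = SKIP and t = t and c = c]) (use assms in \<open>auto simp: result_def\<close>)

section \<open>Deterministic programs and counting loops\<close>

definition exec :: "com \<Rightarrow> mem \<Rightarrow> nat \<Rightarrow> mem \<Rightarrow> bool" where
  "exec c s t s' \<longleftrightarrow> result c s t (return_pmf s')"

lemma exec_weaken: "exec c s t s' \<Longrightarrow> t \<le> t' \<Longrightarrow> exec c s t' s'"
  unfolding exec_def by (rule result_weaken)

lemma exec_Seq: "exec c1 s t1 s' \<Longrightarrow> exec c2 s' t2 s'' \<Longrightarrow> exec (Seq c1 c2) s (t1 + t2 + 1) s''"
  unfolding exec_def using result_Seq[of c1 s t1 "return_pmf s'" c2 t2 "\<lambda>_. return_pmf s''"]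
  by (simp add: bind_return_pmf)

lemma exec_frame: "exec c s t s' \<Longrightarrow> v \<notin> arrays_written c \<Longrightarrow> s' v = s v"
  unfolding exec_def by (rule result_frame) auto

lemma exec_Cond: "exec (if bval b s then c1 else c2) s t s' \<Longrightarrow> exec (Cond b c1 c2) s (Suc t) s'"
  unfolding exec_def by (rule result_Cond)

text \<open>Programs without loops and coin flips, whose effect and time bound the simplifier can
  compute. To avoid a maximum, a conditional is charged for both branches.\<close>

primrec straight :: "com \<Rightarrow> bool" where
  "straight SKIP = True"
| "straight (Store v e1 e2) = True"
| "straight (Flip v e) = False"
| "straight (Seq c1 c2) = (straight c1 \<and> straight c2)"
| "straight (Cond b c1 c2) = (straight c1 \<and> straight c2)"
| "straight (While b c) = False"

primrec straight_time :: "com \<Rightarrow> nat" where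
  "straight_time SKIP = 0"
| "straight_time (Store v e1 e2) = 1"
| "straight_time (Flip v e) = 1"
| "straight_time (Seq c1 c2) = straight_time c1 + straight_time c2 + 1"
| "straight_time (Cond b c1 c2) = Suc (straight_time c1 + straight_time c2)"
| "straight_time (While b c) = 0"

primrec straight_sem :: "com \<Rightarrow> mem \<Rightarrow> mem" where
  "straight_sem SKIP s = s"
| "straight_sem (Store v e1 e2) s = write_cell v (aval e1 s) (aval e2 s) s"
| "straight_sem (Flip v e) s = s"
| "straight_sem (Seq c1 c2) s = straight_sem c2 (straight_sem c1 s)"
| "straight_sem (Cond b c1 c2) s = (if bval b s then straight_sem c1 s else straight_sem c2 s)"
| "straight_sem (While b c) s = s"

lemma exec_straight: "straight c \<Longrightarrow> exec c s (straight_time c) (straight_sem c s)"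
proof (induction c arbitrary: s)
  case (Seq c1 c2)
  then show ?case using exec_Seq by (simp del: add_Suc_right) blast
next
  case (Cond b c1 c2)
  then have "exec (if bval b s then c1 else c2) s (straight_time c1 + straight_time c2) (straight_sem (Cond b c1 c2) s)"
    using exec_weaken[OF _ le_add1] exec_weaken[OF _ le_add2] by (cases "bval b s") simp_all
  then show ?case using exec_Cond by simp
qed (auto simp: exec_def result_SKIP result_Store[unfolded One_nat_def])

definition for_loop :: "string \<Rightarrow> nat \<Rightarrow> aexp \<Rightarrow> com \<Rightarrow> com" where
  "for_loop v a e c = Seq (Store v (Num a) (Num 0))
     (While (Less (Cell v (Num a)) e) (Seq c (Store v (Num a) (Plus (Cell v (Num a)) (Num 1)))))"

lemma arrays_written_for_loop [simp]: "arrays_written (for_loop v a e c) = insert v (arrays_written c)"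
  by (auto simp: for_loop_def)

text \<open>A round adds five steps to its body: unfolding, test, increment, and the removal of two
  finished parts. The 4 pays for setting the counter, one removal, and the last unfolding with its
  failing test.\<close>

definition loop_time :: "nat \<Rightarrow> nat \<Rightarrow> nat" where
  "loop_time N t = N * (t + 5) + 4"


text \<open>The frame condition is handed to the premises, so \<open>J\<close> only has to describe
  what the body writes. As \<open>e\<close> is evaluated anew before each round, its value must be
  shown to stay \<open>N\<close>.\<close>

lemma exec_for_loop:
  assumes J0: "J 0 (write_cell v a 0 s)"
    and bound: "\<And>i s'. i \<le> N \<Longrightarrow> J i s' \<Longrightarrow> s' v a = i \<Longrightarrow> (\<And>x. x \<noteq> v \<Longrightarrow> x \<notin> arrays_written c \<Longrightarrow> s' x = s x) \<Longrightarrow> aval e s' = N"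
    and body: "\<And>i s'. i < N \<Longrightarrow> J i s' \<Longrightarrow> s' v a = i \<Longrightarrow> (\<And>x. x \<noteq> v \<Longrightarrow> x \<notin> arrays_written c \<Longrightarrow> s' x = s x) \<Longrightarrow>
      \<exists>s''. exec c s' t s'' \<and> s'' v a = i \<and> J (Suc i) (write_cell v a (Suc i) s'')"
  shows "\<exists>s'. exec (for_loop v a e c) s (loop_time N t) s' \<and> J N s' \<and> s' v a = N \<and>
    (\<forall>x. x \<noteq> v \<longrightarrow> x \<notin> arrays_written c \<longrightarrow> s' x = s x)"
proof -
  let ?b = "Less (Cell v (Num a)) e" and ?c = "Seq c (Store v (Num a) (Plus (Cell v (Num a)) (Num 1)))"
  have loop: "\<exists>s''. exec (While ?b ?c) s' ((N - i) * (t + 5) + 2) s'' \<and> J N s'' \<and> s'' v a = N \<and>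
      (\<forall>x. x \<noteq> v \<longrightarrow> x \<notin> arrays_written c \<longrightarrow> s'' x = s x)"
    if "i \<le> N" "J i s'" "s' v a = i" "\<And>x. x \<noteq> v \<Longrightarrow> x \<notin> arrays_written c \<Longrightarrow> s' x = s x" for i s'
    using that
  proof (induction "N - i" arbitrary: i s')
    case 0
    then have "i = N" by simp
    then have "\<not> bval ?b s'" using 0 bound[of N s'] by simp
    then have "exec (While ?b ?c) s' 2 s'"
      unfolding exec_def numeral_2_eq_2 by (intro result_While result_Cond) (simp add: result_SKIP)
    then show ?case using 0 \<open>i = N\<close> by (intro exI[of _ s']) (simp add: numeral_2_eq_2)
  next
    case (Suc k)
    then have i: "i < N" by simp
    then have b: "bval ?b s'" using Suc bound[of i s'] by simp
    obtain s2 where s2: "exec c s' t s2" "s2 v a = i" "J (Suc i) (write_cell v a (Suc i) s2)"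
      using body[OF i Suc.prems(2,3,4)] by blast
    let ?s3 = "write_cell v a (Suc i) s2"
    have e: "exec (Store v (Num a) (Plus (Cell v (Num a)) (Num 1))) s2 1 ?s3"
      using exec_straight[of "Store v (Num a) (Plus (Cell v (Num a)) (Num 1))" s2] s2(2) by simp
    have fr: "?s3 x = s x" if "x \<noteq> v" "x \<notin> arrays_written c" for x
      using exec_frame[OF s2(1) that(2)] Suc.prems(4) that by (simp add: write_cell_def)
    obtain s4 where s4: "exec (While ?b ?c) ?s3 ((N - Suc i) * (t + 5) + 2) s4" "J N s4" "s4 v a = N"
      "\<forall>x. x \<noteq> v \<longrightarrow> x \<notin> arrays_written c \<longrightarrow> s4 x = s x"
    proof -
      have "k = N - Suc i" "Suc i \<le> N" "?s3 v a = Suc i" using Suc.hyps(2) i by (auto simp: write_cell_def)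
      from Suc.hyps(1)[OF this(1,2) s2(3) this(3) fr] that show ?thesis by blast
    qed
    have "exec (Seq ?c (While ?b ?c)) s' (t + 1 + 1 + ((N - Suc i) * (t + 5) + 2) + 1) s4"
      by (rule exec_Seq[OF exec_Seq[OF s2(1) e] s4(1)])
    then have "exec (While ?b ?c) s' (Suc (Suc (t + 1 + 1 + ((N - Suc i) * (t + 5) + 2) + 1))) s4"
      unfolding exec_def using b by (intro result_While result_Cond) simp
    moreover have "N - i = Suc (N - Suc i)" using i by simp
    ultimately have "exec (While ?b ?c) s' ((N - i) * (t + 5) + 2) s4"
      by (elim exec_weaken) simp
    then show ?case using s4 by (intro exI[of _ s4]) simp
  qed
  obtain s' where s': "exec (While ?b ?c) (write_cell v a 0 s) (N * (t + 5) + 2) s'" "J N s'" "s' v a = N"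
    "\<forall>x. x \<noteq> v \<longrightarrow> x \<notin> arrays_written c \<longrightarrow> s' x = s x"
    using loop[of 0 "write_cell v a 0 s"] J0 by (auto simp: write_cell_def)
  have "exec (Store v (Num a) (Num 0)) s 1 (write_cell v a 0 s)"
    using exec_straight[of "Store v (Num a) (Num 0)" s] by simp
  from exec_Seq[OF this s'(1)] have "exec (for_loop v a e c) s (loop_time N t) s'"
    unfolding for_loop_def loop_time_def by (elim exec_weaken) simp
  then show ?thesis using s' by blast
qed

section \<open>The program\<close>

abbreviation then_do :: "com \<Rightarrow> com \<Rightarrow> com" (infixr ";;" 60) where "c1 ;; c2 \<equiv> Seq c1 c2"
abbreviation reg :: "string \<Rightarrow> aexp" where "reg v \<equiv> Cell v (Num 0)"
abbreviation assign :: "string \<Rightarrow> aexp \<Rightarrow> com" where "assign v e \<equiv> Store v (Num 0) e"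
abbreviation increase :: "string \<Rightarrow> aexp \<Rightarrow> com" where "increase v e \<equiv> assign v (Plus (reg v) e)"

text \<open>Array \<open>y\<close> holds the current assignment, \<open>x\<close> the shadow assignment and \<open>g\<close> the greedy marks, all
  with values \<open>0\<close> and \<open>1\<close>.  As \<open>w\<close> holds \<open>0, 2 ^ j\<close> at position \<open>j\<close> of a scope, \<open>w[y[v]]\<close> is
  \<open>y[v] * 2 ^ j\<close>; similarly, \<open>m[g[v]]\<close> is \<open>g[v] * v\<close>.  So \<open>a\<close>, \<open>b\<close>, \<open>q\<close> accumulate the table
  indices of \<open>y\<close>, \<open>x\<close>, \<open>g\<close>, and \<open>h\<close> and \<open>u\<close> the number and the sum of the greedy variables.\<close>

definition position_step :: com where
  "position_step =
     assign ''v'' (Cell ''input'' (Plus (Plus (reg ''p'') (Num 1)) (reg ''j''))) ;;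
     Store ''m'' (Num 1) (reg ''v'') ;;
     increase ''a'' (Cell ''w'' (Cell ''y'' (reg ''v''))) ;;
     increase ''b'' (Cell ''w'' (Cell ''x'' (reg ''v''))) ;;
     increase ''q'' (Cell ''w'' (Cell ''g'' (reg ''v''))) ;;
     increase ''h'' (Cell ''g'' (reg ''v'')) ;;
     increase ''u'' (Cell ''m'' (Cell ''g'' (reg ''v''))) ;;
     Store ''w'' (Num 1) (Plus (Cell ''w'' (Num 1)) (Cell ''w'' (Num 1)))"

definition scan_init :: com where
  "scan_init = assign ''r'' (Cell ''input'' (reg ''p'')) ;;
     assign ''a'' (Num 0) ;; assign ''b'' (Num 0) ;; assign ''q'' (Num 0) ;;
     assign ''h'' (Num 0) ;; assign ''u'' (Num 0) ;;
     Store ''w'' (Num 0) (Num 0) ;; Store ''w'' (Num 1) (Num 1) ;; Store ''m'' (Num 0) (Num 0)"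

text \<open>In the first pass of a trial, \<open>y\<close> and \<open>x\<close> are 0 at greedy
  variables. If \<open>u\<close> is the only greedy variable, \<open>q\<close> is the power of 2 of
  its position, so the entries \<open>a\<close> and \<open>a + q\<close> are the values with
  \<open>u\<close> false and true. As cells hold no negative numbers, \<open>W u - W' u\<close> is
  kept as a difference of \<open>up\<close> and \<open>dn\<close>.\<close>

definition account :: com where
  "account = assign ''d'' (Plus (Plus (reg ''p'') (Num 1)) (reg ''r'')) ;;
     increase ''V'' (Cell ''input'' (Plus (reg ''d'') (reg ''a''))) ;;
     Cond (And (Less (Num 0) (reg ''h'')) (Less (reg ''h'') (Num 2)))
       (Store ''up'' (reg ''u'') (Plus (Cell ''up'' (reg ''u''))
          (Plus (Cell ''input'' (Plus (Plus (reg ''d'') (reg ''a'')) (reg ''q'')))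
                (Cell ''input'' (Plus (reg ''d'') (reg ''b''))))) ;;
        Store ''dn'' (reg ''u'') (Plus (Cell ''dn'' (reg ''u''))
          (Plus (Cell ''input'' (Plus (reg ''d'') (reg ''a'')))
                (Cell ''input'' (Plus (Plus (reg ''d'') (reg ''b'')) (reg ''q''))))))
       SKIP ;;
     assign ''p'' (Plus (reg ''d'') (Cell ''w'' (Num 1)))"

definition constraint_step :: com where
  "constraint_step = scan_init ;; for_loop ''j'' 0 (reg ''r'') position_step ;; account"

definition pass :: com where
  "pass = assign ''p'' (Num 2) ;; assign ''V'' (Num 0) ;;
     for_loop ''c'' 0 (Cell ''input'' (Num 1)) constraint_step"

lemma position_step_straight: "straight position_step" "straight_time position_step = 15"
  by (simp_all add: position_step_def)

lemma scan_init_straight: "straight scan_init" "straight_time scan_init = 17"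
  by (simp_all add: scan_init_def)

lemma account_straight: "straight account" "straight_time account = 10"
  by (simp_all add: account_def)

definition table_index :: "constr \<Rightarrow> (nat \<Rightarrow> nat) \<Rightarrow> nat" where
  "table_index C f = (\<Sum>j<arity C. f (scope C ! j) * 2 ^ j)"

lemma exec_position_loop:
  assumes inp: "\<And>j. j < arity C \<Longrightarrow> s ''input'' (s ''p'' 0 + 1 + j) = scope C ! j"
    and r: "s ''r'' 0 = arity C"
    and bit: "\<And>v. v \<in> set (scope C) \<Longrightarrow> s ''y'' v \<le> 1 \<and> s ''x'' v \<le> 1 \<and> s ''g'' v \<le> 1"
    and init: "s ''w'' 0 = 0" "s ''w'' 1 = 1" "s ''m'' 0 = 0" "s ''a'' 0 = 0" "s ''b'' 0 = 0"
      "s ''q'' 0 = 0" "s ''h'' 0 = 0" "s ''u'' 0 = 0"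
  shows "\<exists>s'. exec (for_loop ''j'' 0 (reg ''r'') position_step) s (loop_time (arity C) 15) s' \<and>
    s' ''w'' 1 = 2 ^ arity C \<and>
    s' ''a'' 0 = table_index C (s ''y'') \<and> s' ''b'' 0 = table_index C (s ''x'') \<and>
    s' ''q'' 0 = table_index C (s ''g'') \<and>
    s' ''h'' 0 = (\<Sum>j<arity C. s ''g'' (scope C ! j)) \<and>
    s' ''u'' 0 = (\<Sum>j<arity C. s ''g'' (scope C ! j) * scope C ! j) \<and>
    (\<forall>v. v \<notin> set [''j'', ''v'', ''m'', ''a'', ''b'', ''q'', ''h'', ''u'', ''w''] \<longrightarrow> s' v = s v)"
proof -
  define J where "J i s' \<longleftrightarrow> s' ''w'' 0 = 0 \<and> s' ''w'' 1 = 2 ^ i \<and> s' ''m'' 0 = 0 \<and>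
    s' ''a'' 0 = (\<Sum>j<i. s ''y'' (scope C ! j) * 2 ^ j) \<and>
    s' ''b'' 0 = (\<Sum>j<i. s ''x'' (scope C ! j) * 2 ^ j) \<and>
    s' ''q'' 0 = (\<Sum>j<i. s ''g'' (scope C ! j) * 2 ^ j) \<and>
    s' ''h'' 0 = (\<Sum>j<i. s ''g'' (scope C ! j)) \<and>
    s' ''u'' 0 = (\<Sum>j<i. s ''g'' (scope C ! j) * scope C ! j)" for i and s' :: mem
  have "\<exists>s'. exec (for_loop ''j'' 0 (reg ''r'') position_step) s (loop_time (arity C) 15) s' \<and>
    J (arity C) s' \<and> s' ''j'' 0 = arity C \<and>
    (\<forall>v. v \<noteq> ''j'' \<longrightarrow> v \<notin> arrays_written position_step \<longrightarrow> s' v = s v)"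
  proof (rule exec_for_loop)
    show "J 0 (write_cell ''j'' 0 0 s)" using init by (simp add: J_def write_cell_def)
    fix i s'
    assume frame: "\<And>v. v \<noteq> ''j'' \<Longrightarrow> v \<notin> arrays_written position_step \<Longrightarrow> s' v = s v"
    have fr: "s' ''r'' = s ''r''" "s' ''p'' = s ''p''" "s' ''input'' = s ''input''"
      "s' ''y'' = s ''y''" "s' ''x'' = s ''x''" "s' ''g'' = s ''g''"
      by (rule frame; simp add: position_step_def)+
    show "aval (reg ''r'') s' = arity C" using r by (simp add: fr)
    assume i: "i < arity C" and J: "J i s'" and ji: "s' ''j'' 0 = i"
    define s'' where "s'' = straight_sem position_step s'"
    have v: "scope C ! i \<in> set (scope C)" using i by (simp add: arity_def)
    have w: "s' ''w'' k = k * 2 ^ i" if "k \<le> 1" for k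
      using J that by (cases k) (auto simp: J_def)
    have "exec position_step s' 15 s''"
      using exec_straight[of position_step s'] by (simp only: position_step_straight s''_def)
    moreover have "s'' ''j'' 0 = i" using ji by (simp add: s''_def position_step_def write_cell_def)
    moreover have "J (Suc i) (write_cell ''j'' 0 (Suc i) s'')"
    proof -
      \<comment> \<open>The mark selects between \<open>m[0] = 0\<close> and
        \<open>m[1] = v\<close>, hence the two cases; the other lookups are covered by
        \<open>w\<close>.\<close>
      consider "s ''g'' (scope C ! i) = 0" | "s ''g'' (scope C ! i) = 1" using bit[OF v] by linarith
      then show ?thesis
        by cases (use J bit[OF v] inp[OF i] ji in
          \<open>simp_all add: J_def s''_def position_step_def write_cell_def fr w\<close>)
    qed
    ultimately show "\<exists>s''. exec position_step s' 15 s'' \<and> s'' ''j'' 0 = i \<and> J (Suc i) (write_cell ''j'' 0 (Suc i) s'')"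
      by blast
  qed
  then show ?thesis by (auto simp: J_def table_index_def position_step_def)
qed

lemma exec_constraint_step:
  assumes inp: "s ''input'' (s ''p'' 0) = arity C"
      "\<And>j. j < arity C \<Longrightarrow> s ''input'' (s ''p'' 0 + 1 + j) = scope C ! j"
    and bit: "\<And>v. v \<in> set (scope C) \<Longrightarrow> s ''y'' v \<le> 1 \<and> s ''x'' v \<le> 1 \<and> s ''g'' v \<le> 1"
  defines "d \<equiv> s ''p'' 0 + 1 + arity C"
  defines "hit \<equiv> \<lambda>k. (\<Sum>j<arity C. s ''g'' (scope C ! j)) = 1 \<and> (\<Sum>j<arity C. s ''g'' (scope C ! j) * scope C ! j) = k"
  defines "a \<equiv> table_index C (s ''y'')" and "b \<equiv> table_index C (s ''x'')" and "q \<equiv> table_index C (s ''g'')"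
  shows "\<exists>s'. exec constraint_step s (loop_time (arity C) 15 + 40) s' \<and>
    s' ''p'' 0 = d + 2 ^ arity C \<and>
    s' ''V'' 0 = s ''V'' 0 + s ''input'' (d + a) \<and>
    (\<forall>k. s' ''up'' k = s ''up'' k + (if hit k then s ''input'' (d + a + q) + s ''input'' (d + b) else 0)) \<and>
    (\<forall>k. s' ''dn'' k = s ''dn'' k + (if hit k then s ''input'' (d + a) + s ''input'' (d + b + q) else 0))"
proof -
  define s1 where "s1 = straight_sem scan_init s"
  have e1: "exec scan_init s 17 s1"
    using exec_straight[of scan_init s] by (simp only: scan_init_straight s1_def)
  have s1: "s1 ''r'' 0 = arity C" "s1 ''w'' 0 = 0" "s1 ''w'' 1 = 1" "s1 ''m'' 0 = 0" "s1 ''a'' 0 = 0"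
    "s1 ''b'' 0 = 0" "s1 ''q'' 0 = 0" "s1 ''h'' 0 = 0" "s1 ''u'' 0 = 0"
    using inp(1) by (simp_all add: s1_def scan_init_def write_cell_def)
  have f1: "s1 v = s v" if "v \<in> set [''y'', ''x'', ''g'', ''input'', ''p'', ''V'', ''up'', ''dn'']" for v
    using that by (intro exec_frame[OF e1]) (auto simp: scan_init_def)
  then have f1': "s1 ''y'' = s ''y''" "s1 ''x'' = s ''x''" "s1 ''g'' = s ''g''"
    "s1 ''input'' = s ''input''" "s1 ''p'' = s ''p''" by simp_all
  obtain s2 where e2: "exec (for_loop ''j'' 0 (reg ''r'') position_step) s1 (loop_time (arity C) 15) s2"
    and s2: "s2 ''w'' 1 = 2 ^ arity C" "s2 ''a'' 0 = a" "s2 ''b'' 0 = b" "s2 ''q'' 0 = q"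
      "s2 ''h'' 0 = (\<Sum>j<arity C. s ''g'' (scope C ! j))"
      "s2 ''u'' 0 = (\<Sum>j<arity C. s ''g'' (scope C ! j) * scope C ! j)"
      "\<And>v. v \<notin> set [''j'', ''v'', ''m'', ''a'', ''b'', ''q'', ''h'', ''u'', ''w''] \<Longrightarrow> s2 v = s1 v"
    using exec_position_loop[of C s1] s1 inp(2) bit unfolding a_def b_def q_def f1' by blast
  have f2: "s2 ''r'' 0 = arity C" "s2 ''p'' = s ''p''" "s2 ''input'' = s ''input''" "s2 ''V'' = s ''V''"
    "s2 ''up'' = s ''up''" "s2 ''dn'' = s ''dn''"
    using s1(1) f1 by (simp_all add: s2(7))
  define s3 where "s3 = straight_sem account s2"
  have e3: "exec account s2 10 s3"
    using exec_straight[of account s2] by (simp only: account_straight s3_def)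
  have "exec constraint_step s (17 + (loop_time (arity C) 15 + 10 + 1) + 1) s3"
    unfolding constraint_step_def by (rule exec_Seq[OF e1 exec_Seq[OF e2 e3]])
  then have "exec constraint_step s (loop_time (arity C) 15 + 40) s3" by (rule exec_weaken) simp
  moreover have "s3 ''p'' 0 = d + 2 ^ arity C" "s3 ''V'' 0 = s ''V'' 0 + s ''input'' (d + a)"
    using s2(1,2) f2 by (simp_all add: s3_def account_def write_cell_def d_def)
  moreover have "s3 ''up'' k = s ''up'' k + (if hit k then s ''input'' (d + a + q) + s ''input'' (d + b) else 0)"
    "s3 ''dn'' k = s ''dn'' k + (if hit k then s ''input'' (d + a) + s ''input'' (d + b + q) else 0)" for k
    using s2(1-4) f2 unfolding hit_def s2(5,6)[symmetric]
    by (auto simp: s3_def account_def write_cell_def d_def)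
  ultimately show ?thesis by blast
qed

section \<open>Layout of the encoded instance\<close>

text \<open>The 2 skips the leading numbers of variables and constraints. At
  \<open>l = length I\<close> the position is the length of the whole input.\<close>

definition constr_pos :: "constr list \<Rightarrow> nat \<Rightarrow> nat" where
  "constr_pos I l = 2 + (\<Sum>i<l. length (encode_constr (I ! i)))"

abbreviation table_pos :: "constr list \<Rightarrow> nat \<Rightarrow> nat" where
  "table_pos I l \<equiv> constr_pos I l + 1 + arity (I ! l)"

lemma length_encode_constr: "length (encode_constr C) = 1 + arity C + 2 ^ arity C"
  by (simp add: encode_constr_def arity_def)

lemma constr_pos_simps [simp]: "constr_pos I 0 = 2"
  "constr_pos I (Suc l) = table_pos I l + 2 ^ arity (I ! l)"
  by (simp_all add: constr_pos_def length_encode_constr)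

lemma nth_concat_offset:
  "l < length xss \<Longrightarrow> j < length (xss ! l) \<Longrightarrow>
    (\<Sum>i<l. length (xss ! i)) + j < length (concat xss) \<and> concat xss ! ((\<Sum>i<l. length (xss ! i)) + j) = xss ! l ! j"
proof (induction xss arbitrary: l)
  case (Cons xs xss)
  then show ?case
    by (cases l) (auto simp: nth_append sum.lessThan_Suc_shift simp del: sum.lessThan_Suc)
qed simp

lemma input_encode_csp:
  defines "inp \<equiv> \<lambda>n I. input_mem (encode_csp n I) ''input''"
  shows "inp n I 0 = n" "inp n I 1 = length I"
    and "l < length I \<Longrightarrow> inp n I (constr_pos I l) = arity (I ! l)"
    and "l < length I \<Longrightarrow> j < arity (I ! l) \<Longrightarrow> inp n I (constr_pos I l + 1 + j) = scope (I ! l) ! j"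
    and "l < length I \<Longrightarrow> t < 2 ^ arity (I ! l) \<Longrightarrow>
      inp n I (table_pos I l + t) = of_bool (predic (I ! l) (index_signs (arity (I ! l)) t))"
proof -
  show "inp n I 0 = n" "inp n I 1 = length I"
    by (simp_all add: inp_def input_mem_def encode_csp_def)
  have nth: "inp n I (constr_pos I l + j) = encode_constr (I ! l) ! j"
    if "l < length I" "j < length (encode_constr (I ! l))" for l j
    using nth_concat_offset[of l "map encode_constr I" j] that
    by (simp add: inp_def input_mem_def encode_csp_def constr_pos_def)
  show "l < length I \<Longrightarrow> inp n I (constr_pos I l) = arity (I ! l)"
    using nth[of l 0] by (simp add: length_encode_constr) (simp add: encode_constr_def)
  show "l < length I \<Longrightarrow> j < arity (I ! l) \<Longrightarrow> inp n I (constr_pos I l + 1 + j) = scope (I ! l) ! j"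
    using nth[of l "1 + j"] by (simp add: length_encode_constr) (simp add: encode_constr_def nth_append arity_def)
  show "l < length I \<Longrightarrow> t < 2 ^ arity (I ! l) \<Longrightarrow>
      inp n I (table_pos I l + t) = of_bool (predic (I ! l) (index_signs (arity (I ! l)) t))"
    using nth[of l "1 + arity (I ! l) + t"]
    by (simp add: length_encode_constr add_ac) (simp add: encode_constr_def nth_append arity_def add_ac)
qed

text \<open>\<open>horner_sum\<close> gives access to the library facts on \<open>bit\<close>, in
  terms of which \<open>index_signs\<close> decodes a table index.\<close>

lemma table_index_eq_horner:
  assumes "\<And>v. v \<in> set (scope C) \<Longrightarrow> f v \<le> 1"
  shows "table_index C f = horner_sum of_bool 2 (map (\<lambda>v. f v = 1) (scope C))"
proof -
  have "f (scope C ! j) = of_bool (f (scope C ! j) = 1)" if "j < arity C" for j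
    using assms[of "scope C ! j"] that nth_mem[of j "scope C"] by (cases "f (scope C ! j)") (auto simp: arity_def)
  then show ?thesis
    unfolding table_index_def horner_sum_eq_sum
    by (intro sum.cong) (auto simp: arity_def)
qed

lemma table_index_less:
  assumes "\<And>v. v \<in> set (scope C) \<Longrightarrow> f v \<le> 1"
  shows "table_index C f < 2 ^ arity C"
proof -
  have "table_index C f = horner_sum of_bool 2 (map (\<lambda>v. f v = 1) (scope C))"
    by (rule table_index_eq_horner) (rule assms)
  moreover have "horner_sum of_bool 2 (map (\<lambda>v. f v = 1) (scope C)) < (2 :: nat) ^ length (scope C)"
    using horner_sum_bound[of "map (\<lambda>v. f v = 1) (scope C)", where 'a = nat] by (simp only: length_map)
  ultimately show ?thesis by (simp only: arity_def)
qed

lemma index_signs_table_index: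
  assumes "\<And>v. v \<in> set (scope C) \<Longrightarrow> f v \<le> 1"
  shows "index_signs (arity C) (table_index C f) = map (\<lambda>v. if f v = 1 then 1 else - 1) (scope C)"
proof -
  have eq: "table_index C f = horner_sum of_bool 2 (map (\<lambda>v. f v = 1) (scope C))"
    by (rule table_index_eq_horner) (rule assms)
  show ?thesis
    unfolding index_signs_def eq by (rule nth_equalityI) (auto simp: arity_def bit_horner_sum_bit_iff)
qed

text \<open>Where \<open>y\<close> is 0 at the marked variables, adding the index of the marks sets
  their bits. So the addresses \<open>a + q\<close> and \<open>b + q\<close> of
  \<open>account\<close> are again indices of assignments.\<close>

lemma table_index_add: "table_index C f + table_index C f' = table_index C (\<lambda>v. f v + f' v)"
  by (simp add: table_index_def sum.distrib algebra_simps)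

section \<open>One pass over all constraints\<close>

definition hits :: "constr \<Rightarrow> (nat \<Rightarrow> nat) \<Rightarrow> nat \<Rightarrow> bool" where
  "hits C g u \<longleftrightarrow> (\<Sum>j<arity C. g (scope C ! j)) = 1 \<and> (\<Sum>j<arity C. g (scope C ! j) * scope C ! j) = u"

definition table_read :: "(nat \<Rightarrow> nat) \<Rightarrow> constr list \<Rightarrow> nat \<Rightarrow> (nat \<Rightarrow> nat) \<Rightarrow> nat" where
  "table_read inp I l f = inp (table_pos I l + table_index (I ! l) f)"

definition pass_time :: "nat \<Rightarrow> nat \<Rightarrow> nat" where
  "pass_time m k = loop_time m (loop_time k 15 + 40) + 4"

lemma arrays_written_pass:
  "arrays_written constraint_step = set [''j'', ''v'', ''m'', ''a'', ''b'', ''q'', ''h'', ''u'', ''w'', ''r'', ''d'', ''V'', ''up'', ''dn'', ''p'']"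
  "arrays_written pass = set [''c'', ''j'', ''v'', ''m'', ''a'', ''b'', ''q'', ''h'', ''u'', ''w'', ''r'', ''d'', ''V'', ''up'', ''dn'', ''p'']"
  unfolding pass_def constraint_step_def position_step_def scan_init_def account_def by auto

lemma loop_time_mono: "N \<le> N' \<Longrightarrow> t \<le> t' \<Longrightarrow> loop_time N t \<le> loop_time N' t'"
  by (simp add: loop_time_def mult_le_mono)

text \<open>The same pass has three purposes: collecting \<open>up\<close> and \<open>dn\<close>,
  evaluating a decided assignment in \<open>V\<close>, and, before all trials, measuring the input
  by the final value of \<open>p\<close>.\<close>

lemma exec_pass:
  assumes inp: "s ''input'' = input_mem (encode_csp n I) ''input''"
    and bit: "\<And>v. v < n \<Longrightarrow> s ''y'' v \<le> 1 \<and> s ''x'' v \<le> 1 \<and> s ''g'' v \<le> 1"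
    and inst: "csp_instance n I" and k: "\<And>C. C \<in> set I \<Longrightarrow> arity C \<le> k"
  defines "T \<equiv> table_read (s ''input'') I"
  shows "\<exists>s'. exec pass s (pass_time (length I) k) s' \<and>
    s' ''p'' 0 = constr_pos I (length I) \<and>
    s' ''V'' 0 = (\<Sum>l<length I. T l (s ''y'')) \<and>
    (\<forall>u. s' ''up'' u = s ''up'' u + (\<Sum>l<length I. if hits (I ! l) (s ''g'') u
       then T l (\<lambda>v. s ''y'' v + s ''g'' v) + T l (s ''x'') else 0)) \<and>
    (\<forall>u. s' ''dn'' u = s ''dn'' u + (\<Sum>l<length I. if hits (I ! l) (s ''g'') u
       then T l (s ''y'') + T l (\<lambda>v. s ''x'' v + s ''g'' v) else 0))"
proof -
  define s0 where "s0 = write_cell ''V'' 0 0 (write_cell ''p'' 0 2 s)"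
  have s0: "s0 ''input'' = s ''input''" "s0 ''y'' = s ''y''" "s0 ''x'' = s ''x''" "s0 ''g'' = s ''g''"
    "s0 ''up'' = s ''up''" "s0 ''dn'' = s ''dn''" "s0 ''p'' 0 = 2" "s0 ''V'' 0 = 0"
    by (simp_all add: s0_def write_cell_def)
  define J where "J i s' \<longleftrightarrow> s' ''p'' 0 = constr_pos I i \<and>
    s' ''V'' 0 = (\<Sum>l<i. T l (s ''y'')) \<and>
    (\<forall>u. s' ''up'' u = s ''up'' u + (\<Sum>l<i. if hits (I ! l) (s ''g'') u
       then T l (\<lambda>v. s ''y'' v + s ''g'' v) + T l (s ''x'') else 0)) \<and>
    (\<forall>u. s' ''dn'' u = s ''dn'' u + (\<Sum>l<i. if hits (I ! l) (s ''g'') u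
       then T l (s ''y'') + T l (\<lambda>v. s ''x'' v + s ''g'' v) else 0))" for i and s' :: mem
  have "\<exists>s'. exec (for_loop ''c'' 0 (Cell ''input'' (Num 1)) constraint_step) s0
      (loop_time (length I) (loop_time k 15 + 40)) s' \<and> J (length I) s' \<and> s' ''c'' 0 = length I \<and>
    (\<forall>v. v \<noteq> ''c'' \<longrightarrow> v \<notin> arrays_written constraint_step \<longrightarrow> s' v = s0 v)"
  proof (rule exec_for_loop)
    show "J 0 (write_cell ''c'' 0 0 s0)" using s0 by (simp add: J_def write_cell_def)
    fix i s'
    assume frame: "\<And>v. v \<noteq> ''c'' \<Longrightarrow> v \<notin> arrays_written constraint_step \<Longrightarrow> s' v = s0 v"
    have fr: "s' ''input'' = s ''input''" "s' ''y'' = s ''y''" "s' ''x'' = s ''x''" "s' ''g'' = s ''g''"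
      unfolding s0(1-4)[symmetric] by (rule frame; simp add: arrays_written_pass)+
    show "aval (Cell ''input'' (Num 1)) s' = length I"
      using input_encode_csp(2)[of n I] by (simp add: fr inp)
    assume i: "i < length I" and J: "J i s'" and ci: "s' ''c'' 0 = i"
    have C: "I ! i \<in> set I" using i by simp
    have "v < n" if "v \<in> set (scope (I ! i))" for v
      using inst C that by (auto simp: csp_instance_def)
    then have bits: "s' ''y'' v \<le> 1 \<and> s' ''x'' v \<le> 1 \<and> s' ''g'' v \<le> 1" if "v \<in> set (scope (I ! i))" for v
      using bit that fr by simp
    have p: "s' ''p'' 0 = constr_pos I i" using J by (simp add: J_def)
    have hit: "((\<Sum>j<arity (I ! i). s' ''g'' (scope (I ! i) ! j)) = 1 \<and>
       (\<Sum>j<arity (I ! i). s' ''g'' (scope (I ! i) ! j) * scope (I ! i) ! j) = u) = hits (I ! i) (s ''g'') u" for u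
      by (simp add: hits_def fr)
    have i1: "s' ''input'' (s' ''p'' 0) = arity (I ! i)"
      using input_encode_csp(3)[OF i] by (simp add: fr p inp)
    have i2: "s' ''input'' (s' ''p'' 0 + 1 + j) = scope (I ! i) ! j" if "j < arity (I ! i)" for j
      using input_encode_csp(4)[OF i that] by (simp add: fr p inp)
    obtain s2 where e: "exec constraint_step s' (loop_time (arity (I ! i)) 15 + 40) s2"
      and s2: "s2 ''p'' 0 = constr_pos I (Suc i)"
        "s2 ''V'' 0 = s' ''V'' 0 + T i (s ''y'')"
        "\<And>u. s2 ''up'' u = s' ''up'' u + (if hits (I ! i) (s ''g'') u
           then T i (\<lambda>v. s ''y'' v + s ''g'' v) + T i (s ''x'') else 0)"
        "\<And>u. s2 ''dn'' u = s' ''dn'' u + (if hits (I ! i) (s ''g'') u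
           then T i (s ''y'') + T i (\<lambda>v. s ''x'' v + s ''g'' v) else 0)"
      using exec_constraint_step[OF i1 i2 bits]
      unfolding hit unfolding T_def table_read_def table_index_add[symmetric] fr p by (auto simp: add_ac)
    have e': "exec constraint_step s' (loop_time k 15 + 40) s2"
      by (rule exec_weaken[OF e]) (use k[OF C] in \<open>simp add: loop_time_mono\<close>)
    have "s2 ''c'' 0 = i" using exec_frame[OF e, of "''c''"] ci by (simp add: arrays_written_pass)
    moreover have "J (Suc i) (write_cell ''c'' 0 (Suc i) s2)"
      using J s2 by (simp add: J_def write_cell_def)
    ultimately show "\<exists>s''. exec constraint_step s' (loop_time k 15 + 40) s'' \<and> s'' ''c'' 0 = i \<and>
        J (Suc i) (write_cell ''c'' 0 (Suc i) s'')" using e' by blast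
  qed
  then obtain s' where e: "exec (for_loop ''c'' 0 (Cell ''input'' (Num 1)) constraint_step) s0
      (loop_time (length I) (loop_time k 15 + 40)) s'" and J: "J (length I) s'" by blast
  have "exec (assign ''p'' (Num 2)) s 1 (write_cell ''p'' 0 2 s)"
    using exec_straight[of "assign ''p'' (Num 2)" s] by simp
  moreover have "exec (assign ''V'' (Num 0)) (write_cell ''p'' 0 2 s) 1 s0"
    using exec_straight[of "assign ''V'' (Num 0)" "write_cell ''p'' 0 2 s"] by (simp add: s0_def)
  ultimately have "exec pass s (1 + (1 + loop_time (length I) (loop_time k 15 + 40) + 1) + 1) s'"
    unfolding pass_def using e exec_Seq by blast
  then have "exec pass s (pass_time (length I) k) s'" by (rule exec_weaken) (simp add: pass_time_def)
  with J show ?thesis unfolding J_def by blast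
qed

section \<open>Loops over the variables\<close>

text \<open>Subtraction is truncated, so \<open>z - g\<close> is the main coin at a fixed variable
  and 0 at a greedy one.\<close>

definition trial_init :: com where
  "trial_init = for_loop ''i'' 0 (Cell ''input'' (Num 0))
     (Store ''y'' (reg ''i'') (Minus (Cell ''z'' (reg ''i'')) (Cell ''g'' (reg ''i''))) ;;
      Store ''x'' (reg ''i'') (Minus (Cell ''s'' (reg ''i'')) (Cell ''g'' (reg ''i''))) ;;
      Store ''up'' (reg ''i'') (Num 0) ;;
      Store ''dn'' (reg ''i'') (Num 0))"

lemma exec_trial_init:
  shows "\<exists>s'. exec trial_init s (loop_time (s ''input'' 0) 7) s' \<and>
    (\<forall>v<s ''input'' 0. s' ''y'' v = s ''z'' v - s ''g'' v \<and> s' ''x'' v = s ''s'' v - s ''g'' v \<and>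
       s' ''up'' v = 0 \<and> s' ''dn'' v = 0) \<and>
    (\<forall>a. a \<notin> set [''i'', ''y'', ''x'', ''up'', ''dn''] \<longrightarrow> s' a = s a)"
proof -
  let ?c = "Store ''y'' (reg ''i'') (Minus (Cell ''z'' (reg ''i'')) (Cell ''g'' (reg ''i''))) ;;
      Store ''x'' (reg ''i'') (Minus (Cell ''s'' (reg ''i'')) (Cell ''g'' (reg ''i''))) ;;
      Store ''up'' (reg ''i'') (Num 0) ;;
      Store ''dn'' (reg ''i'') (Num 0)"
  define J where "J i s' \<longleftrightarrow> (\<forall>v<i. s' ''y'' v = s ''z'' v - s ''g'' v \<and> s' ''x'' v = s ''s'' v - s ''g'' v \<and>
       s' ''up'' v = 0 \<and> s' ''dn'' v = 0)" for i and s' :: mem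
  have "\<exists>s'. exec (for_loop ''i'' 0 (Cell ''input'' (Num 0)) ?c) s (loop_time (s ''input'' 0) 7) s' \<and>
    J (s ''input'' 0) s' \<and> s' ''i'' 0 = s ''input'' 0 \<and>
    (\<forall>v. v \<noteq> ''i'' \<longrightarrow> v \<notin> arrays_written ?c \<longrightarrow> s' v = s v)"
  proof (rule exec_for_loop)
    show "J 0 (write_cell ''i'' 0 0 s)" by (simp add: J_def)
    fix i s' assume frame: "\<And>v. v \<noteq> ''i'' \<Longrightarrow> v \<notin> arrays_written ?c \<Longrightarrow> s' v = s v"
    have fr: "s' ''input'' = s ''input''" "s' ''z'' = s ''z''" "s' ''g'' = s ''g''" "s' ''s'' = s ''s''"
      by (rule frame; simp)+
    show "aval (Cell ''input'' (Num 0)) s' = s ''input'' 0" by (simp add: fr)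
    assume J: "J i s'" and i: "s' ''i'' 0 = i"
    have "straight ?c" "straight_time ?c = 7" by simp_all
    then have "exec ?c s' 7 (straight_sem ?c s')" using exec_straight[of ?c s'] by (simp only:)
    moreover have "straight_sem ?c s' ''i'' 0 = i" using i by (simp add: write_cell_def)
    moreover have "J (Suc i) (write_cell ''i'' 0 (Suc i) (straight_sem ?c s'))"
      using J i by (auto simp: J_def write_cell_def fr less_Suc_eq)
    ultimately show "\<exists>s''. exec ?c s' 7 s'' \<and> s'' ''i'' 0 = i \<and> J (Suc i) (write_cell ''i'' 0 (Suc i) s'')"
      by blast
  qed
  then show ?thesis by (auto simp: J_def trial_init_def)
qed

text \<open>At a fixed variable \<open>up\<close> and \<open>dn\<close> agree, so the last branch
  copies its main coin just as it does for ties, without a test of the mark.\<close>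

definition decide :: com where
  "decide = for_loop ''i'' 0 (Cell ''input'' (Num 0))
     (Cond (Less (Cell ''dn'' (reg ''i'')) (Cell ''up'' (reg ''i''))) (Store ''y'' (reg ''i'') (Num 1))
       (Cond (Less (Cell ''up'' (reg ''i'')) (Cell ''dn'' (reg ''i''))) (Store ''y'' (reg ''i'') (Num 0))
         (Store ''y'' (reg ''i'') (Cell ''z'' (reg ''i'')))))"

lemma exec_decide:
  shows "\<exists>s'. exec decide s (loop_time (s ''input'' 0) 5) s' \<and>
    (\<forall>v<s ''input'' 0. s' ''y'' v = (if s ''dn'' v < s ''up'' v then 1 else if s ''up'' v < s ''dn'' v then 0 else s ''z'' v)) \<and>
    (\<forall>a. a \<notin> set [''i'', ''y''] \<longrightarrow> s' a = s a)"
proof -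
  let ?c = "Cond (Less (Cell ''dn'' (reg ''i'')) (Cell ''up'' (reg ''i''))) (Store ''y'' (reg ''i'') (Num 1))
       (Cond (Less (Cell ''up'' (reg ''i'')) (Cell ''dn'' (reg ''i''))) (Store ''y'' (reg ''i'') (Num 0))
         (Store ''y'' (reg ''i'') (Cell ''z'' (reg ''i''))))"
  define J where "J i s' \<longleftrightarrow> (\<forall>v<i. s' ''y'' v =
    (if s ''dn'' v < s ''up'' v then 1 else if s ''up'' v < s ''dn'' v then 0 else s ''z'' v))" for i and s' :: mem
  have "\<exists>s'. exec (for_loop ''i'' 0 (Cell ''input'' (Num 0)) ?c) s (loop_time (s ''input'' 0) 5) s' \<and>
    J (s ''input'' 0) s' \<and> s' ''i'' 0 = s ''input'' 0 \<and>
    (\<forall>v. v \<noteq> ''i'' \<longrightarrow> v \<notin> arrays_written ?c \<longrightarrow> s' v = s v)"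
  proof (rule exec_for_loop)
    show "J 0 (write_cell ''i'' 0 0 s)" by (simp add: J_def)
    fix i s' assume frame: "\<And>v. v \<noteq> ''i'' \<Longrightarrow> v \<notin> arrays_written ?c \<Longrightarrow> s' v = s v"
    have fr: "s' ''input'' = s ''input''" "s' ''z'' = s ''z''" "s' ''up'' = s ''up''" "s' ''dn'' = s ''dn''"
      by (rule frame; simp)+
    show "aval (Cell ''input'' (Num 0)) s' = s ''input'' 0" by (simp add: fr)
    assume J: "J i s'" and i: "s' ''i'' 0 = i"
    have "straight ?c" "straight_time ?c = 5" by simp_all
    then have "exec ?c s' 5 (straight_sem ?c s')" using exec_straight[of ?c s'] by (simp only:)
    moreover have "straight_sem ?c s' ''i'' 0 = i" using i by (simp add: write_cell_def)
    moreover have "J (Suc i) (write_cell ''i'' 0 (Suc i) (straight_sem ?c s'))"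
      using J i by (auto simp: J_def write_cell_def fr less_Suc_eq)
    ultimately show "\<exists>s''. exec ?c s' 5 s'' \<and> s'' ''i'' 0 = i \<and> J (Suc i) (write_cell ''i'' 0 (Suc i) s'')"
      by blast
  qed
  then show ?thesis by (auto simp: J_def decide_def)
qed

definition save :: com where
  "save = for_loop ''i'' 0 (Cell ''input'' (Num 0)) (Store ''output'' (reg ''i'') (Cell ''y'' (reg ''i'')))"

lemma exec_save:
  shows "\<exists>s'. exec save s (loop_time (s ''input'' 0) 1) s' \<and>
    (\<forall>v<s ''input'' 0. s' ''output'' v = s ''y'' v) \<and> (\<forall>a. a \<notin> set [''i'', ''output''] \<longrightarrow> s' a = s a)"
proof -
  let ?c = "Store ''output'' (reg ''i'') (Cell ''y'' (reg ''i''))"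
  define J where "J i s' \<longleftrightarrow> (\<forall>v<i. s' ''output'' v = s ''y'' v)" for i and s' :: mem
  have "\<exists>s'. exec (for_loop ''i'' 0 (Cell ''input'' (Num 0)) ?c) s (loop_time (s ''input'' 0) 1) s' \<and>
    J (s ''input'' 0) s' \<and> s' ''i'' 0 = s ''input'' 0 \<and>
    (\<forall>v. v \<noteq> ''i'' \<longrightarrow> v \<notin> arrays_written ?c \<longrightarrow> s' v = s v)"
  proof (rule exec_for_loop)
    show "J 0 (write_cell ''i'' 0 0 s)" by (simp add: J_def)
    fix i s' assume frame: "\<And>v. v \<noteq> ''i'' \<Longrightarrow> v \<notin> arrays_written ?c \<Longrightarrow> s' v = s v"
    have fr: "s' ''input'' = s ''input''" "s' ''y'' = s ''y''"
      by (rule frame; simp)+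
    show "aval (Cell ''input'' (Num 0)) s' = s ''input'' 0" by (simp add: fr)
    assume J: "J i s'" and i: "s' ''i'' 0 = i"
    have "straight ?c" "straight_time ?c = 1" by simp_all
    then have "exec ?c s' 1 (straight_sem ?c s')" using exec_straight[of ?c s'] by (simp only:)
    moreover have "straight_sem ?c s' ''i'' 0 = i" using i by (simp add: write_cell_def)
    moreover have "J (Suc i) (write_cell ''i'' 0 (Suc i) (straight_sem ?c s'))"
      using J i by (auto simp: J_def write_cell_def fr less_Suc_eq)
    ultimately show "\<exists>s''. exec ?c s' 1 s'' \<and> s'' ''i'' 0 = i \<and> J (Suc i) (write_cell ''i'' 0 (Suc i) s'')"
      by blast
  qed
  then show ?thesis by (auto simp: J_def save_def)
qed

section \<open>Coin flips and amplification\<close>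

primrec iterate_pmf :: "nat \<Rightarrow> (mem \<Rightarrow> mem pmf) \<Rightarrow> mem \<Rightarrow> mem pmf" where
  "iterate_pmf 0 B s = return_pmf s"
| "iterate_pmf (Suc k) B s = B s \<bind> iterate_pmf k B"

definition next_counter :: "string \<Rightarrow> nat \<Rightarrow> mem \<Rightarrow> mem" where
  "next_counter v a s = write_cell v a (Suc (s v a)) s"

text \<open>The randomized counterpart of \<open>exec_for_loop\<close>: a kernel \<open>B\<close>
  describes the body, and the invariant is required on its support.\<close>

lemma result_for_loop:
  assumes J0: "J 0 (write_cell v a 0 s)"
    and bound: "\<And>i s'. J i s' \<Longrightarrow> s' v a = i \<and> aval e s' = N"
    and body: "\<And>i s'. i < N \<Longrightarrow> J i s' \<Longrightarrow> result c s' t (B s') \<and>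
      (\<forall>s''\<in>set_pmf (B s'). J (Suc i) (next_counter v a s''))"
  shows "result (for_loop v a e c) s (loop_time N t)
    (iterate_pmf N (\<lambda>s. map_pmf (next_counter v a) (B s)) (write_cell v a 0 s))"
proof -
  let ?b = "Less (Cell v (Num a)) e" and ?inc = "Store v (Num a) (Plus (Cell v (Num a)) (Num 1))"
  let ?B = "\<lambda>s. map_pmf (next_counter v a) (B s)"
  have loop: "result (While ?b (Seq c ?inc)) s' ((N - i) * (t + 5) + 2) (iterate_pmf (N - i) ?B s')"
    if "i \<le> N" "J i s'" for i s'
    using that
  proof (induction "N - i" arbitrary: i s')
    case 0
    then have "i = N" by simp
    then have "\<not> bval ?b s'" using 0 bound[of N s'] by simp
    then have "result (While ?b (Seq c ?inc)) s' 2 (return_pmf s')"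
      unfolding numeral_2_eq_2 by (intro result_While result_Cond) (simp add: result_SKIP)
    then show ?case using \<open>i = N\<close> by (simp add: numeral_2_eq_2)
  next
    case (Suc k)
    then have i: "i < N" by simp
    then have b: "bval ?b s'" using Suc bound[of i s'] by simp
    have body': "result c s' t (B s')" "\<And>s''. s'' \<in> set_pmf (B s') \<Longrightarrow> J (Suc i) (next_counter v a s'')"
      using body[OF i Suc.prems(2)] by auto
    have inc: "result ?inc s'' 1 (return_pmf (next_counter v a s''))" for s''
      using result_Store[of v "Num a" "Plus (Cell v (Num a)) (Num 1)" s''] by (simp add: next_counter_def)
    have 1: "result (Seq c ?inc) s' (t + 1 + 1) (?B s')"
      using result_Seq[OF body'(1), of ?inc 1 "\<lambda>s''. return_pmf (next_counter v a s'')", OF inc]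
      by (simp add: map_pmf_def)
    have k: "k = N - Suc i" "N - i = Suc k" using Suc.hyps(2) by simp_all
    have "result (While ?b (Seq c ?inc)) s2 (k * (t + 5) + 2) (iterate_pmf k ?B s2)"
      if "s2 \<in> set_pmf (?B s')" for s2
      using Suc.hyps(1)[OF k(1), of s2] i body'(2) that k by auto
    then have "result (Seq (Seq c ?inc) (While ?b (Seq c ?inc))) s' (t + 1 + 1 + (k * (t + 5) + 2) + 1)
        (?B s' \<bind> iterate_pmf k ?B)"
      by (rule result_Seq[OF 1])
    then have "result (While ?b (Seq c ?inc)) s' (Suc (Suc (t + 1 + 1 + (k * (t + 5) + 2) + 1)))
        (?B s' \<bind> iterate_pmf k ?B)"
      using b by (intro result_While result_Cond) simp
    then show ?case by (rule result_weaken[THEN back_subst[of "result _ _ _"]]) (simp_all add: k(2))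
  qed
  have "result (Store v (Num a) (Num 0)) s 1 (return_pmf (write_cell v a 0 s))"
    using result_Store[of v "Num a" "Num 0" s] by simp
  moreover have "result (While ?b (Seq c ?inc)) s' (N * (t + 5) + 2) (iterate_pmf N ?B s')"
    if "s' \<in> set_pmf (return_pmf (write_cell v a 0 s))" for s'
    using loop[of 0 s'] J0 that by simp
  ultimately have "result (for_loop v a e c) s (1 + (N * (t + 5) + 2) + 1)
      (return_pmf (write_cell v a 0 s) \<bind> iterate_pmf N ?B)"
    unfolding for_loop_def by (rule result_Seq)
  then show ?thesis unfolding loop_time_def bind_return_pmf by (rule result_weaken) simp
qed

section \<open>Amplification by repetition\<close>

lemma prob_bind_le:
  assumes "\<And>s'. s' \<in> set_pmf M \<Longrightarrow> G s' \<Longrightarrow> measure_pmf.prob (f s') {s. \<not> G s} = 0"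
    and "\<And>s'. s' \<in> set_pmf M \<Longrightarrow> measure_pmf.prob (f s') {s. \<not> G s} \<le> r"
    and "0 \<le> r"
  shows "measure_pmf.prob (M \<bind> f) {s. \<not> G s} \<le> r * measure_pmf.prob M {s. \<not> G s}"
proof -
  have "emeasure (bind_pmf M f) {s. \<not> G s} = (\<integral>\<^sup>+s'. emeasure (f s') {s. \<not> G s} \<partial>M)"
    by (rule emeasure_bind_pmf)
  also have "\<dots> \<le> (\<integral>\<^sup>+s'. ennreal r * indicator {s. \<not> G s} s' \<partial>M)"
  proof (rule nn_integral_mono_AE, rule AE_pmfI)
    fix s' assume s': "s' \<in> set_pmf M"
    show "emeasure (f s') {s. \<not> G s} \<le> ennreal r * indicator {s. \<not> G s} s'"
      using assms(1,2)[OF s'] by (cases "G s'") (auto simp: measure_pmf.emeasure_eq_measure ennreal_leI)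
  qed
  also have "\<dots> = ennreal (r * measure_pmf.prob M {s. \<not> G s})"
    using assms(3) by (simp add: nn_integral_cmult measure_pmf.emeasure_eq_measure ennreal_mult)
  finally have "ennreal (measure_pmf.prob (bind_pmf M f) {s. \<not> G s}) \<le> ennreal (r * measure_pmf.prob M {s. \<not> G s})"
    unfolding measure_pmf.emeasure_eq_measure .
  then show ?thesis using assms(3) by (simp add: ennreal_le_iff)
qed

text \<open>Success is never lost, and a round fails with probability at most \<open>q\<close> from
  every memory satisfying \<open>K\<close>. So the failure bounds multiply whatever the earlier
  rounds have left behind.\<close>

lemma iterate_pmf_amplify:
  assumes K: "\<And>s s'. K s \<Longrightarrow> s' \<in> set_pmf (B s) \<Longrightarrow> K s' \<and> (G s \<longrightarrow> G s')"
    and q: "\<And>s. K s \<Longrightarrow> measure_pmf.prob (B s) {s. \<not> G s} \<le> q" "0 \<le> q"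
    and s: "K s"
  shows "(\<forall>s'\<in>set_pmf (iterate_pmf N B s). K s' \<and> (G s \<longrightarrow> G s')) \<and>
    measure_pmf.prob (iterate_pmf N B s) {s. \<not> G s} \<le> q ^ N"
  using s
proof (induction N arbitrary: s)
  case (Suc N)
  have "measure_pmf.prob (iterate_pmf N B s') {s. \<not> G s} = 0" if "s' \<in> set_pmf (B s)" "G s'" for s'
    using Suc.IH[of s'] K[OF Suc.prems that(1)] that(2) by (auto simp: measure_pmf_zero_iff)
  then have "measure_pmf.prob (B s \<bind> iterate_pmf N B) {s. \<not> G s} \<le>
      q ^ N * measure_pmf.prob (B s) {s. \<not> G s}"
    using Suc.IH K[OF Suc.prems] q by (intro prob_bind_le) auto
  also have "\<dots> \<le> q ^ N * q" using q Suc.prems by (intro mult_left_mono) auto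
  finally show ?case using Suc.IH K[OF Suc.prems] by (force simp: mult_ac)
qed (auto simp: measure_pmf.prob_le_1)

text \<open>The loop counters live in separate cells of one array, so that the nesting depth can be arbitrary.\<close>

primrec nest :: "aexp list \<Rightarrow> com \<Rightarrow> com" where
  "nest [] c = c"
| "nest (e # es) c = for_loop ''lc'' (length es) e (nest es c)"

text \<open>\<open>K\<close> is an invariant and \<open>G\<close> an event that cannot be undone.
  The counters from \<open>d\<close> on belong to enclosing loops, which is why they must be
  preserved.\<close>

definition amplifies :: "(mem \<Rightarrow> bool) \<Rightarrow> (mem \<Rightarrow> bool) \<Rightarrow> com \<Rightarrow> nat \<Rightarrow> nat \<Rightarrow> real \<Rightarrow> bool" where
  "amplifies K G c d t q \<longleftrightarrow> (\<forall>s. K s \<longrightarrow> (\<exists>M. result c s t M \<and>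
     (\<forall>s'\<in>set_pmf M. K s' \<and> (G s \<longrightarrow> G s') \<and> (\<forall>k\<ge>d. s' ''lc'' k = s ''lc'' k)) \<and>
     measure_pmf.prob M {s. \<not> G s} \<le> q))"

lemma amplifies_for_loop:
  assumes c: "amplifies K G c d t q"
    and Kw: "\<And>i s. K (write_cell ''lc'' d i s) = K s" and Gw: "\<And>i s. G (write_cell ''lc'' d i s) = G s"
    and e: "\<And>s. K s \<Longrightarrow> aval e s = N" and q: "0 \<le> q"
  shows "amplifies K G (for_loop ''lc'' d e c) (Suc d) (loop_time N t) (q ^ N)"
  unfolding amplifies_def
proof (intro allI impI)
  fix s assume s: "K s"
  \<comment> \<open>The kernel is assembled by choice from the distributions that
    \<open>amplifies\<close> provides for single memories.\<close>
  define B where "B s = (SOME M. result c s t M \<and>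
     (\<forall>s'\<in>set_pmf M. K s' \<and> (G s \<longrightarrow> G s') \<and> (\<forall>k\<ge>d. s' ''lc'' k = s ''lc'' k)) \<and>
     measure_pmf.prob M {s. \<not> G s} \<le> q)" for s
  have B: "result c s t (B s) \<and>
     (\<forall>s'\<in>set_pmf (B s). K s' \<and> (G s \<longrightarrow> G s') \<and> (\<forall>k\<ge>d. s' ''lc'' k = s ''lc'' k)) \<and>
     measure_pmf.prob (B s) {s. \<not> G s} \<le> q" if "K s" for s
    unfolding B_def by (rule someI_ex) (use c that in \<open>auto simp: amplifies_def\<close>)
  let ?B = "\<lambda>s. map_pmf (next_counter ''lc'' d) (B s)"
  \<comment> \<open>Cell \<open>d\<close> is this loop's own counter; the cells above it keep the
    contents they had in \<open>s\<close>.\<close>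
  define K' where "K' s' \<longleftrightarrow> K s' \<and> (\<forall>k>d. s' ''lc'' k = s ''lc'' k)" for s'
  have K'0: "K' (write_cell ''lc'' d 0 s)" using s Kw by (simp add: K'_def write_cell_def)
  have step: "K' s'' \<and> (G s' \<longrightarrow> G s'')" if "K' s'" "s'' \<in> set_pmf (?B s')" for s' s''
    using B[of s'] that Kw Gw by (auto simp: K'_def next_counter_def write_cell_def)
  have prob: "measure_pmf.prob (?B s') {s. \<not> G s} \<le> q" if "K' s'" for s'
    using B[of s'] that Gw by (simp add: K'_def next_counter_def vimage_def)
  have "result (for_loop ''lc'' d e c) s (loop_time N t) (iterate_pmf N ?B (write_cell ''lc'' d 0 s))"
  proof (rule result_for_loop[where J = "\<lambda>i s'. K' s' \<and> s' ''lc'' d = i"])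
    fix i s' assume J: "K' s' \<and> s' ''lc'' d = i"
    show "s' ''lc'' d = i \<and> aval e s' = N" using J e by (simp add: K'_def)
    have "K' (next_counter ''lc'' d s'')" if "s'' \<in> set_pmf (B s')" for s''
      using step[of s'] J that by auto
    moreover have "next_counter ''lc'' d s'' ''lc'' d = Suc i" if "s'' \<in> set_pmf (B s')" for s''
      using B[of s'] J that by (auto simp: K'_def next_counter_def write_cell_def)
    ultimately show "result c s' t (B s') \<and>
        (\<forall>s''\<in>set_pmf (B s'). K' (next_counter ''lc'' d s'') \<and> next_counter ''lc'' d s'' ''lc'' d = Suc i)"
      using B[of s'] J by (auto simp: K'_def)
  qed (use K'0 in \<open>simp add: write_cell_def\<close>)
  moreover have "(\<forall>s'\<in>set_pmf (iterate_pmf N ?B (write_cell ''lc'' d 0 s)).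
       K' s' \<and> (G (write_cell ''lc'' d 0 s) \<longrightarrow> G s')) \<and>
    measure_pmf.prob (iterate_pmf N ?B (write_cell ''lc'' d 0 s)) {s. \<not> G s} \<le> q ^ N"
    by (rule iterate_pmf_amplify) (use step prob q K'0 in blast)+
  ultimately show "\<exists>M. result (for_loop ''lc'' d e c) s (loop_time N t) M \<and>
     (\<forall>s'\<in>set_pmf M. K s' \<and> (G s \<longrightarrow> G s') \<and> (\<forall>k\<ge>Suc d. s' ''lc'' k = s ''lc'' k)) \<and>
     measure_pmf.prob M {s. \<not> G s} \<le> q ^ N"
    using Gw by (auto simp: K'_def Suc_le_eq)
qed

primrec nest_time :: "nat list \<Rightarrow> nat \<Rightarrow> nat" where
  "nest_time [] t = t"
| "nest_time (N # Ns) t = loop_time N (nest_time Ns t)"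

text \<open>Numbers of rounds of nested loops multiply, and so do the exponents of the failure
  bound. This performs as many trials as a product prescribes without computing that
  product.\<close>

lemma amplifies_nest:
  assumes "amplifies K G c 0 t q"
    and "\<And>d i s. K (write_cell ''lc'' d i s) = K s" "\<And>d i s. G (write_cell ''lc'' d i s) = G s"
    and "\<And>s. K s \<Longrightarrow> list_all2 (\<lambda>e N. aval e s = N) es Ns" and "0 \<le> q" "length es = length Ns"
  shows "amplifies K G (nest es c) (length es) (nest_time Ns t) (q ^ prod_list Ns)"
  using assms(6,4)
proof (induction es Ns rule: list_induct2)
  case (Cons e es N Ns)
  have "amplifies K G (for_loop ''lc'' (length es) e (nest es c)) (Suc (length es))
      (loop_time N (nest_time Ns t)) ((q ^ prod_list Ns) ^ N)"
    by (rule amplifies_for_loop) (use Cons assms in auto)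
  then show ?case by (simp add: power_mult[symmetric] mult.commute)
qed (use assms in simp)

section \<open>Uniform coins from fair flips\<close>

definition coin_pmf :: "(bool \<times> bool \<times> bool) pmf" where
  "coin_pmf = pair_pmf (bernoulli_pmf (1/2)) (pair_pmf (bernoulli_pmf (1/2)) (bernoulli_pmf (1/2)))"

lemma coin_pmf_uniform: "coin_pmf = pmf_of_set UNIV"
proof (rule pmf_eqI)
  fix c :: "bool \<times> bool \<times> bool"
  have "pmf (bernoulli_pmf (1 / 2)) b = 1 / 2" for b by (cases b) simp_all
  then show "pmf coin_pmf c = pmf (pmf_of_set UNIV) c"
    by (cases c) (simp add: coin_pmf_def pmf_pair)
qed

definition coins_pmf :: "nat \<Rightarrow> coins pmf" where
  "coins_pmf n = Pi_pmf {..<n} (False, False, False) (\<lambda>_. coin_pmf)"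

lemma coins_pmf_uniform: "coins_pmf n = pmf_of_set (coin_space n)"
  unfolding coins_pmf_def coin_pmf_uniform coin_space_eq by (rule Pi_pmf_of_set) auto

definition flip_coins :: com where
  "flip_coins = for_loop ''i'' 0 (Cell ''input'' (Num 0))
     (Flip ''g'' (reg ''i'') ;; Flip ''z'' (reg ''i'') ;; Flip ''s'' (reg ''i''))"

text \<open>The memory after rounds \<open>i\<close> to \<open>N - 1\<close> of the coin loop. The
  lower end is a parameter because the induction splits off the first round.\<close>

definition fill_coins :: "nat \<Rightarrow> nat \<Rightarrow> mem \<Rightarrow> coins \<Rightarrow> mem" where
  "fill_coins i N s \<omega> = s(''i'' := (s ''i'')(0 := N),
     ''g'' := (\<lambda>v. if i \<le> v \<and> v < N then of_bool (greedy \<omega> v) else s ''g'' v),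
     ''z'' := (\<lambda>v. if i \<le> v \<and> v < N then of_bool (main \<omega> v) else s ''z'' v),
     ''s'' := (\<lambda>v. if i \<le> v \<and> v < N then of_bool (shadow \<omega> v) else s ''s'' v))"

lemma result_flip_coins:
  assumes N: "N = s ''input'' 0"
  shows "result flip_coins s (loop_time N 5) (map_pmf (fill_coins 0 N s) (coins_pmf N))"
proof -
  let ?c = "Flip ''g'' (reg ''i'') ;; Flip ''z'' (reg ''i'') ;; Flip ''s'' (reg ''i'')"
  define put where "put s c = write_cell ''s'' (s ''i'' 0) (of_bool (snd (snd c)))
    (write_cell ''z'' (s ''i'' 0) (of_bool (fst (snd c)))
      (write_cell ''g'' (s ''i'' 0) (of_bool (fst c)) s))" for s :: mem and c :: "bool \<times> bool \<times> bool"
  have flip: "result (Flip v (reg ''i'')) s 1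
      (bernoulli_pmf (1 / 2) \<bind> (\<lambda>b. return_pmf (write_cell v (s ''i'' 0) (of_bool b) s)))" for v s
    using result_Flip[of v "reg ''i''" s] by (simp add: map_pmf_def)
  have body: "result ?c s 5 (map_pmf (put s) coin_pmf)" for s
  proof -
    let ?f = "\<lambda>v s. bernoulli_pmf (1 / 2) \<bind> (\<lambda>b. return_pmf (write_cell v (s ''i'' 0) (of_bool b) s))"
    have "result ?c s (1 + (1 + 1 + 1) + 1) (?f ''g'' s \<bind> (\<lambda>s. ?f ''z'' s \<bind> ?f ''s''))"
      by (intro result_Seq flip)
    also have "?f ''g'' s \<bind> (\<lambda>s. ?f ''z'' s \<bind> ?f ''s'') = map_pmf (put s) coin_pmf"
      by (simp add: coin_pmf_def pair_pmf_def map_pmf_def bind_assoc_pmf bind_return_pmf put_def write_cell_def)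
    finally show ?thesis by (rule result_weaken) simp
  qed
  have res: "result flip_coins s (loop_time N 5)
      (iterate_pmf N (\<lambda>s. map_pmf (next_counter ''i'' 0) (map_pmf (put s) coin_pmf)) (write_cell ''i'' 0 0 s))"
    unfolding flip_coins_def
  proof (rule result_for_loop[where J = "\<lambda>i s'. s' ''i'' 0 = i \<and> s' ''input'' 0 = N"])
    show "result ?c s' 5 (map_pmf (put s') coin_pmf) \<and>
        (\<forall>s''\<in>set_pmf (map_pmf (put s') coin_pmf). next_counter ''i'' 0 s'' ''i'' 0 = Suc i \<and>
           next_counter ''i'' 0 s'' ''input'' 0 = N)"
      if "s' ''i'' 0 = i \<and> s' ''input'' 0 = N" for i s'
      using body that by (auto simp: next_counter_def put_def write_cell_def)
  qed (use N in \<open>auto simp: write_cell_def\<close>)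
  \<comment> \<open>The coins of the remaining rounds form a product distribution, to which
    \<open>Pi_pmf_insert'\<close> adds those of variable \<open>i\<close>.\<close>
  have iter: "iterate_pmf k (\<lambda>s. map_pmf (next_counter ''i'' 0) (map_pmf (put s) coin_pmf)) s =
      map_pmf (fill_coins i (i + k) s) (Pi_pmf {i..<i + k} (False, False, False) (\<lambda>_. coin_pmf))"
    if "s ''i'' 0 = i" for i k s
    using that
  proof (induction k arbitrary: i s)
    case 0
    have "fill_coins i i s = (\<lambda>_. s)" using 0 by (auto simp: fill_coins_def fun_eq_iff)
    then show ?case by simp
  next
    case (Suc k)
    let ?P = "\<lambda>A. Pi_pmf A (False, False, False) (\<lambda>_. coin_pmf)"
    have set: "{i..<i + Suc k} = insert i {Suc i..<Suc i + k}" by auto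
    have fill: "fill_coins (Suc i) (Suc i + k) (next_counter ''i'' 0 (put s c)) \<omega> =
        fill_coins i (i + Suc k) s (fun_upd \<omega> i c)" for c \<omega>
      using Suc.prems by (auto simp: fill_coins_def next_counter_def put_def write_cell_def fun_eq_iff)
    have "iterate_pmf k (\<lambda>s. map_pmf (next_counter ''i'' 0) (map_pmf (put s) coin_pmf)) (next_counter ''i'' 0 (put s c)) =
        map_pmf (\<lambda>\<omega>. fill_coins i (i + Suc k) s (fun_upd \<omega> i c)) (?P {Suc i..<Suc i + k})" for c
    proof -
      have "next_counter ''i'' 0 (put s c) ''i'' 0 = Suc i"
        using Suc.prems by (simp add: next_counter_def put_def write_cell_def)
      note Suc.IH[of "next_counter ''i'' 0 (put s c)" "Suc i", OF this]
      also have "fill_coins (Suc i) (Suc i + k) (next_counter ''i'' 0 (put s c)) =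
          (\<lambda>\<omega>. fill_coins i (i + Suc k) s (fun_upd \<omega> i c))"
        by (rule ext) (rule fill)
      finally show ?thesis .
    qed
    then show ?case
      unfolding set by (subst Pi_pmf_insert')
        (simp_all add: map_pmf_def bind_assoc_pmf bind_return_pmf)
  qed
  have "fill_coins 0 N (write_cell ''i'' 0 0 s) = fill_coins 0 N s"
    by (auto simp: fill_coins_def write_cell_def fun_eq_iff)
  then show ?thesis
    using res iter[of "write_cell ''i'' 0 0 s" 0 N]
    by (simp add: write_cell_def coins_pmf_def atLeast0LessThan)
qed

section \<open>Correctness and running time\<close>

lemma table_read_eq_constr_val:
  assumes "csp_instance n I" "l < length I" "\<And>v. v \<in> set (scope (I ! l)) \<Longrightarrow> f v = of_bool (b v)"
  shows "real (table_read (input_mem (encode_csp n I) ''input'') I l f) = constr_val (I ! l) b"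
proof -
  have f: "f v \<le> 1" if "v \<in> set (scope (I ! l))" for v using assms(3)[OF that] by simp
  have "map (\<lambda>v. if f v = 1 then 1 else - 1) (scope (I ! l)) = map (\<lambda>v. if b v then 1 else - 1 :: int) (scope (I ! l))"
    using assms(3) by (intro map_cong) auto
  moreover have "table_index (I ! l) f < 2 ^ arity (I ! l)" by (rule table_index_less) (rule f)
  note input_encode_csp(5)[OF assms(2) this, of n]
  moreover have "index_signs (arity (I ! l)) (table_index (I ! l) f) = map (\<lambda>v. if f v = 1 then 1 else - 1) (scope (I ! l))"
    by (rule index_signs_table_index) (rule f)
  ultimately show ?thesis
    by (simp only: table_read_def constr_val_def of_nat_of_bool)
qed

lemma csp_val_output:
  assumes "csp_instance n I" "\<And>v. v < n \<Longrightarrow> s ''output'' v = of_bool (b v)"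
  shows "csp_val I (output_assignment n s) = (\<Sum>l<length I. constr_val (I ! l) b) / real (length I)"
  unfolding csp_val_eq_sum
proof (intro arg_cong2[where f = "(/)"] sum.cong refl)
  fix l assume "l \<in> {..<length I}"
  then have "v < n" if "v \<in> set (scope (I ! l))" for v
    using assms(1) that nth_mem[of l I] by (auto simp: csp_instance_def)
  then have "map (output_assignment n s) (scope (I ! l)) = map (\<lambda>v. if b v then 1 else - 1) (scope (I ! l))"
    using assms(2) by (intro map_cong) (auto simp: output_assignment_def)
  then show "of_bool (satisfies (output_assignment n s) (I ! l)) = constr_val (I ! l) b"
    by (simp only: satisfies_def constr_val_def)
qed

text \<open>If exactly one variable of the scope is marked, the sum of the marked variables is that
  variable; so two counters identify it.\<close>

lemma (in tf_csp) hits_iff_active: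
  assumes l: "l < m" and g: "\<And>v. v \<in> sc l \<Longrightarrow> g v = of_bool (greedy \<omega> v)"
  shows "hits (I ! l) g u \<longleftrightarrow> active \<omega> l u"
proof -
  let ?S = "{v \<in> sc l. greedy \<omega> v}"
  have sum: "(\<Sum>j<arity (I ! l). f (scope (I ! l) ! j)) = (\<Sum>v\<in>sc l. f v)" for f :: "nat \<Rightarrow> nat"
    using sum.reindex_bij_betw[OF bij_betw_nth[OF distinct_scope[OF l] refl refl], of f]
    by (simp add: arity_def)
  have "hits (I ! l) g u \<longleftrightarrow> (\<Sum>v\<in>sc l. g v) = 1 \<and> (\<Sum>v\<in>sc l. g v * v) = u"
    using sum[of g] sum[of "\<lambda>v. g v * v"] by (simp add: hits_def)
  also have "(\<Sum>v\<in>sc l. g v) = card ?S"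
    using g by (simp add: Int_def)
  also have "(\<Sum>v\<in>sc l. g v * v) = (\<Sum>v\<in>?S. v)"
  proof -
    have "(\<Sum>v\<in>sc l. g v * v) = (\<Sum>v\<in>sc l. if greedy \<omega> v then v else 0)"
      by (rule sum.cong) (simp_all add: g)
    then show ?thesis by (simp add: sum.inter_filter)
  qed
  also have "card ?S = 1 \<and> (\<Sum>v\<in>?S. v) = u \<longleftrightarrow> active \<omega> l u"
  proof
    assume "card ?S = 1 \<and> (\<Sum>v\<in>?S. v) = u"
    then obtain w where "?S = {w}" and sum: "(\<Sum>v\<in>?S. v) = u" by (metis card_1_singletonE)
    then show "active \<omega> l u" using sum unfolding active_def \<open>?S = {w}\<close> by simp
  next
    assume "active \<omega> l u"
    then have "?S = {u}" by (simp only: active_def)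
    then show "card ?S = 1 \<and> (\<Sum>v\<in>?S. v) = u" by simp
  qed
  finally show ?thesis .
qed

section \<open>Correctness of one trial\<close>

definition trial_rest :: com where
  "trial_rest = trial_init ;; pass ;; decide ;; pass ;;
     Cond (Less (reg ''best'') (reg ''V'')) (assign ''best'' (reg ''V'') ;; save) SKIP"

definition trial :: com where
  "trial = flip_coins ;; trial_rest"

definition rest_time :: "nat \<Rightarrow> nat \<Rightarrow> nat \<Rightarrow> nat" where
  "rest_time n m k = 2 * pass_time m k + 3 * loop_time n 7 + 20"

context tf_csp
begin

text \<open>For \<open>best\<close> an inequality is kept: initially \<open>best\<close> is 0,
  whereas the output cells already describe the assignment with all values -1.\<close>

definition valid_mem :: "mem \<Rightarrow> bool" where
  "valid_mem s \<longleftrightarrow> s ''input'' = input_mem (encode_csp n I) ''input'' \<and>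
     s ''L'' 0 = constr_pos I m \<and> real (s ''best'' 0) \<le> m * csp_val I (output_assignment n s)"

text \<open>Once the coins are in memory, the trial is deterministic and can be followed for each
  coin pattern separately.\<close>

lemma exec_trial_rest:
  assumes s: "valid_mem s" and k: "\<And>C. C \<in> set I \<Longrightarrow> arity C \<le> k"
  shows "\<exists>s'. exec trial_rest (fill_coins 0 n s \<omega>) (rest_time n m k) s' \<and> valid_mem s' \<and>
    s' ''lc'' = s ''lc'' \<and> s ''best'' 0 \<le> s' ''best'' 0 \<and> m * trial_val \<omega> \<le> real (s' ''best'' 0)"
proof -
  let ?inp = "input_mem (encode_csp n I) ''input''"
  define s1 where "s1 = fill_coins 0 n s \<omega>"
  have inp: "s ''input'' = ?inp" using s by (simp add: valid_mem_def)
  have s1: "s1 ''input'' = ?inp" "s1 ''L'' = s ''L''" "s1 ''lc'' = s ''lc''" "s1 ''best'' = s ''best''"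
    "s1 ''output'' = s ''output''"
    "\<And>v. v < n \<Longrightarrow> s1 ''g'' v = of_bool (greedy \<omega> v)"
    "\<And>v. v < n \<Longrightarrow> s1 ''z'' v = of_bool (main \<omega> v)"
    "\<And>v. v < n \<Longrightarrow> s1 ''s'' v = of_bool (shadow \<omega> v)"
    using inp by (simp_all add: s1_def fill_coins_def)
  have n: "?inp 0 = n" by (rule input_encode_csp)
  obtain s2 where e2: "exec trial_init s1 (loop_time n 7) s2"
    and s2: "\<And>v. v < n \<Longrightarrow> s2 ''y'' v = s1 ''z'' v - s1 ''g'' v \<and> s2 ''x'' v = s1 ''s'' v - s1 ''g'' v \<and>
       s2 ''up'' v = 0 \<and> s2 ''dn'' v = 0"
    and f2: "\<And>a. a \<notin> set [''i'', ''y'', ''x'', ''up'', ''dn''] \<Longrightarrow> s2 a = s1 a"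
    using exec_trial_init[of s1] unfolding s1(1) n by blast
  have f2': "s2 ''input'' = ?inp" "s2 ''L'' = s ''L''" "s2 ''lc'' = s ''lc''" "s2 ''best'' = s ''best''"
    "s2 ''output'' = s ''output''" "s2 ''g'' = s1 ''g''" "s2 ''z'' = s1 ''z''"
    using f2 s1 by simp_all
  have b2: "s2 ''y'' v = of_bool (main \<omega> v \<and> \<not> greedy \<omega> v)" "s2 ''x'' v = of_bool (shadow \<omega> v \<and> \<not> greedy \<omega> v)"
    "s2 ''g'' v = of_bool (greedy \<omega> v)" if "v < n" for v
    using s2[OF that] s1(6-8)[OF that] f2' by auto
  define T where "T = table_read ?inp I"
  obtain s3 where e3: "exec pass s2 (pass_time m k) s3"
    and s3: "\<And>u. s3 ''up'' u = s2 ''up'' u + (\<Sum>l<m. if hits (I ! l) (s2 ''g'') u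
       then T l (\<lambda>v. s2 ''y'' v + s2 ''g'' v) + T l (s2 ''x'') else 0)"
      "\<And>u. s3 ''dn'' u = s2 ''dn'' u + (\<Sum>l<m. if hits (I ! l) (s2 ''g'') u
       then T l (s2 ''y'') + T l (\<lambda>v. s2 ''x'' v + s2 ''g'' v) else 0)"
  proof -
    have "s2 ''y'' v \<le> 1 \<and> s2 ''x'' v \<le> 1 \<and> s2 ''g'' v \<le> 1" if "v < n" for v using b2[OF that] by simp
    from exec_pass[OF f2'(1) this inst k] that show ?thesis unfolding f2'(1) T_def by blast
  qed
  have f3: "s3 a = s2 a" if "a \<in> set [''input'', ''L'', ''lc'', ''best'', ''output'', ''g'', ''z'', ''x'']" for a
    using that by (intro exec_frame[OF e3]) (auto simp: arrays_written_pass)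
  have adv: "real (s3 ''up'' u) - real (s3 ''dn'' u) = advantage \<omega> u" if u: "u < n" for u
  proof -
    have up: "(if hits (I ! l) (s2 ''g'') u then T l (\<lambda>v. s2 ''y'' v + s2 ''g'' v) + T l (s2 ''x'') else 0) -
       real (if hits (I ! l) (s2 ''g'') u then T l (s2 ''y'') + T l (\<lambda>v. s2 ''x'' v + s2 ''g'' v) else 0) =
       swing u l \<omega>" if l: "l < m" for l
    proof -
      note lt = sc_less[OF l]
      have h: "hits (I ! l) (s2 ''g'') u = active \<omega> l u" using b2(3)[OF lt] by (rule hits_iff_active[OF l])
      note cv = table_read_eq_constr_val[OF inst l]
      show ?thesis
      proof (cases "active \<omega> l u")
        case True
        note a = activeD[OF True]
        \<comment> \<open>On a scope active at \<open>u\<close>, \<open>y\<close> is the main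
          assignment with \<open>u\<close> false, and adding \<open>g\<close> makes \<open>u\<close>
          true; likewise for \<open>x\<close> and the shadow.\<close>
        have "real (T l (\<lambda>v. s2 ''y'' v + s2 ''g'' v)) = constr_val (I ! l) ((main \<omega>)(u := True))"
          "real (T l (s2 ''y'')) = constr_val (I ! l) ((main \<omega>)(u := False))"
          "real (T l (\<lambda>v. s2 ''x'' v + s2 ''g'' v)) = constr_val (I ! l) ((shadow \<omega>)(u := True))"
          "real (T l (s2 ''x'')) = constr_val (I ! l) ((shadow \<omega>)(u := False))"
          unfolding T_def using a by (intro cv; simp add: b2[OF lt])+
        then show ?thesis using True by (simp add: h swing_def discrete_deriv_def)
      qed (simp add: h swing_def)
    qed
    show ?thesis
      unfolding s3 advantage_def using s2[OF u] up by (simp flip: sum_subtractf)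
  qed
  obtain s4 where e4: "exec decide s3 (loop_time n 5) s4"
    and s4: "\<And>v. v < n \<Longrightarrow> s4 ''y'' v = (if s3 ''dn'' v < s3 ''up'' v then 1
       else if s3 ''up'' v < s3 ''dn'' v then 0 else s3 ''z'' v)"
    and f4: "\<And>a. a \<notin> set [''i'', ''y''] \<Longrightarrow> s4 a = s3 a"
    using exec_decide[of s3] f3[of "''input''"] unfolding f2'(1) n by (auto simp: f2' n)
  have f4': "s4 ''input'' = ?inp" "s4 ''L'' = s ''L''" "s4 ''lc'' = s ''lc''" "s4 ''best'' = s ''best''"
    "s4 ''output'' = s ''output''" "s4 ''g'' = s2 ''g''" "s4 ''x'' = s2 ''x''"
    using f4 f3 f2' by simp_all
  have y4: "s4 ''y'' v = of_bool (greedy_choice \<omega> v)" if v: "v < n" for v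
    using adv[OF v] s1(7)[OF v] f3[of "''z''"] f2'(7) unfolding s4[OF v] greedy_choice_def by auto
  obtain s5 where e5: "exec pass s4 (pass_time m k) s5" and V5: "s5 ''V'' 0 = (\<Sum>l<m. T l (s4 ''y''))"
  proof -
    have "s4 ''y'' v \<le> 1 \<and> s4 ''x'' v \<le> 1 \<and> s4 ''g'' v \<le> 1" if "v < n" for v
      using b2[OF that] y4[OF that] by (simp add: f4')
    from exec_pass[OF f4'(1) this inst k] that show ?thesis unfolding f4'(1) T_def by blast
  qed
  have f5: "s5 a = s4 a" if "a \<in> set [''input'', ''L'', ''lc'', ''best'', ''output'', ''y'']" for a
    using that by (intro exec_frame[OF e5]) (auto simp: arrays_written_pass)
  have V: "real (s5 ''V'' 0) = (\<Sum>l<m. constr_val (I ! l) (greedy_choice \<omega>))"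
    unfolding V5 T_def of_nat_sum
    by (intro sum.cong refl table_read_eq_constr_val[OF inst]) (use y4 sc_less in auto)
  have m0: "real m > 0" using nonempty by simp
  let ?c = "Cond (Less (reg ''best'') (reg ''V'')) (assign ''best'' (reg ''V'') ;; save) SKIP"
  have "\<exists>s6. exec ?c s5 (loop_time n 1 + 3) s6 \<and> s6 ''input'' = ?inp \<and> s6 ''L'' = s ''L'' \<and> s6 ''lc'' = s ''lc'' \<and>
    s ''best'' 0 \<le> s6 ''best'' 0 \<and> s5 ''V'' 0 \<le> s6 ''best'' 0 \<and>
    real (s6 ''best'' 0) \<le> m * csp_val I (output_assignment n s6)"
  proof (cases "s5 ''best'' 0 < s5 ''V'' 0")
    case True
    define s5' where "s5' = write_cell ''best'' 0 (s5 ''V'' 0) s5"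
    have s5': "s5' ''input'' = ?inp" "s5' ''L'' = s ''L''" "s5' ''lc'' = s ''lc''" "s5' ''y'' = s4 ''y''"
      "s5' ''best'' 0 = s5 ''V'' 0"
      using f5 f4' by (simp_all add: s5'_def write_cell_def)
    have e: "exec (assign ''best'' (reg ''V'')) s5 1 s5'"
      using exec_straight[of "assign ''best'' (reg ''V'')" s5] by (simp add: s5'_def)
    obtain s6 where e6: "exec save s5' (loop_time n 1) s6" and s6: "\<And>v. v < n \<Longrightarrow> s6 ''output'' v = s5' ''y'' v"
      and f6: "\<And>a. a \<notin> set [''i'', ''output''] \<Longrightarrow> s6 a = s5' a"
      using exec_save[of s5'] unfolding s5'(1) n by blast
    have "exec ?c s5 (Suc (1 + loop_time n 1 + 1)) s6"
      using exec_Seq[OF e e6] True by (intro exec_Cond) simp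
    then have "exec ?c s5 (loop_time n 1 + 3) s6" by (rule exec_weaken) simp
    moreover have "s6 ''input'' = ?inp" "s6 ''L'' = s ''L''" "s6 ''lc'' = s ''lc''" "s6 ''best'' 0 = s5 ''V'' 0"
      using f6 s5' by simp_all
    moreover have "csp_val I (output_assignment n s6) = real (s5 ''V'' 0) / m"
      unfolding V by (rule csp_val_output[OF inst]) (use s6 s5'(4) y4 in simp)
    moreover have "s ''best'' 0 \<le> s5 ''V'' 0" using True f5 f4' by simp
    ultimately show ?thesis using m0 by (intro exI[of _ s6]) simp
  next
    case False
    have "exec SKIP s5 0 s5" by (simp add: exec_def result_SKIP)
    then have "exec ?c s5 (Suc 0) s5" using False by (intro exec_Cond) simp
    then have "exec ?c s5 (loop_time n 1 + 3) s5" by (rule exec_weaken) simp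
    moreover have "output_assignment n s5 = output_assignment n s"
      using f5 f4' by (simp add: output_assignment_def)
    ultimately show ?thesis using False f5 f4' s by (intro exI[of _ s5]) (simp add: valid_mem_def)
  qed
  then obtain s6 where e6: "exec ?c s5 (loop_time n 1 + 3) s6" and s6: "s6 ''input'' = ?inp" "s6 ''L'' = s ''L''"
    "s6 ''lc'' = s ''lc''" "s ''best'' 0 \<le> s6 ''best'' 0" "s5 ''V'' 0 \<le> s6 ''best'' 0"
    "real (s6 ''best'' 0) \<le> m * csp_val I (output_assignment n s6)" by blast
  have "exec trial_rest s1 (loop_time n 7 + (pass_time m k + (loop_time n 5 +
      (pass_time m k + (loop_time n 1 + 3) + 1) + 1) + 1) + 1) s6"
    unfolding trial_rest_def by (rule exec_Seq[OF e2 exec_Seq[OF e3 exec_Seq[OF e4 exec_Seq[OF e5 e6]]]])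
  moreover have "loop_time n 5 \<le> loop_time n 7" "loop_time n 1 \<le> loop_time n 7" by (simp_all add: loop_time_mono)
  ultimately have "exec trial_rest s1 (rest_time n m k) s6"
    by (elim exec_weaken) (simp add: rest_time_def)
  moreover have "m * trial_val \<omega> = real (s5 ''V'' 0)" using m0 by (simp add: V trial_val_def)
  moreover have "valid_mem s6" using s s6 by (simp add: valid_mem_def)
  ultimately show ?thesis using s6 unfolding s1_def by auto
qed

end

context tf_csp
begin

text \<open>Fresh coins are drawn in every trial, so \<open>good_coins\<close> gives success
  probability at least \<delta> from each valid memory, and \<open>best\<close> never
  decreases.\<close>

lemma amplifies_trial:
  assumes k: "\<And>C. C \<in> set I \<Longrightarrow> arity C \<le> k"
  defines "\<delta> \<equiv> 1 / (48 * 8 ^ k * sqrt (real D))"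
  shows "amplifies valid_mem (\<lambda>s. m * (random_val n I + \<delta>) \<le> real (s ''best'' 0)) trial 0
    (loop_time n 5 + rest_time n m k + 1) (1 - \<delta>)"
  unfolding amplifies_def
proof (intro allI impI)
  fix s assume s: "valid_mem s"
  let ?G = "\<lambda>s :: mem. m * (random_val n I + \<delta>) \<le> real (s ''best'' 0)"
  let ?fill = "fill_coins 0 n s"
  \<comment> \<open>\<open>result_Seq\<close> expects the second stage as a function of the
    intermediate memory, so the final memory is chosen for each such memory. Determinism identifies
    it with the one from \<open>exec_trial_rest\<close>.\<close>
  define F where "F s1 = (SOME s'. exec trial_rest s1 (rest_time n m k) s')" for s1
  have F: "exec trial_rest (?fill \<omega>) (rest_time n m k) (F (?fill \<omega>)) \<and> valid_mem (F (?fill \<omega>)) \<and>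
    F (?fill \<omega>) ''lc'' = s ''lc'' \<and> s ''best'' 0 \<le> F (?fill \<omega>) ''best'' 0 \<and>
    m * trial_val \<omega> \<le> real (F (?fill \<omega>) ''best'' 0)" for \<omega>
  proof -
    obtain s' where s': "exec trial_rest (?fill \<omega>) (rest_time n m k) s'" "valid_mem s'"
      "s' ''lc'' = s ''lc''" "s ''best'' 0 \<le> s' ''best'' 0" "m * trial_val \<omega> \<le> real (s' ''best'' 0)"
      using exec_trial_rest[OF s k] by blast
    moreover have "exec trial_rest (?fill \<omega>) (rest_time n m k) (F (?fill \<omega>))"
      unfolding F_def by (rule someI[of "exec trial_rest (?fill \<omega>) (rest_time n m k)", OF s'(1)])
    then have "F (?fill \<omega>) = s'" using s'(1) by (simp add: exec_def result_def)
    ultimately show ?thesis by simp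
  qed
  have n: "n = s ''input'' 0" using s input_encode_csp(1)[of n I] by (simp add: valid_mem_def)
  define M where "M = map_pmf (\<lambda>\<omega>. F (?fill \<omega>)) (coins_pmf n)"
  have "result trial s (loop_time n 5 + rest_time n m k + 1) (map_pmf ?fill (coins_pmf n) \<bind> (\<lambda>s1. return_pmf (F s1)))"
    unfolding trial_def
    by (rule result_Seq[OF result_flip_coins[of n s, OF n]]) (use F in \<open>auto simp: exec_def\<close>)
  then have "result trial s (loop_time n 5 + rest_time n m k + 1) M"
    by (simp add: M_def map_pmf_def bind_assoc_pmf bind_return_pmf)
  moreover have "valid_mem s' \<and> (?G s \<longrightarrow> ?G s') \<and> (\<forall>k\<ge>0. s' ''lc'' k = s ''lc'' k)" if "s' \<in> set_pmf M" for s'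
    using that F by (auto simp: M_def intro: order_trans)
  moreover have "measure_pmf.prob M {s. \<not> ?G s} \<le> 1 - \<delta>"
  proof -
    let ?A = "{\<omega>. trial_val \<omega> \<ge> random_val n I + \<delta>}"
    have "?G (F (?fill \<omega>))" if "\<omega> \<in> ?A" for \<omega>
    proof -
      have "m * (random_val n I + \<delta>) \<le> m * trial_val \<omega>" using that by (intro mult_left_mono) auto
      then show ?thesis using F[of \<omega>] by linarith
    qed
    then have "measure_pmf.prob M {s. \<not> ?G s} \<le> measure_pmf.prob (coins_pmf n) (- ?A)"
      unfolding M_def measure_map_pmf by (intro measure_pmf.finite_measure_mono) auto
    also have "\<dots> = 1 - measure_pmf.prob (coins_pmf n) ?A"
      using measure_pmf.prob_compl[of ?A "coins_pmf n"] by (simp add: Compl_eq_Diff_UNIV)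
    also have "measure_pmf.prob (coins_pmf n) ?A = card (coin_space n \<inter> ?A) / card (coin_space n)"
      unfolding coins_pmf_uniform by (rule measure_pmf_of_set) auto
    also have "coin_space n \<inter> ?A = {\<omega> \<in> coin_space n. trial_val \<omega> \<ge> random_val n I + \<delta>}" by auto
    also have "1 - real (card \<dots>) / card (coin_space n) \<le> 1 - \<delta>"
      using good_coins[OF k] by (simp add: \<delta>_def field_simps card_gt_0_iff)
    finally show ?thesis .
  qed
  ultimately show "\<exists>M. result trial s (loop_time n 5 + rest_time n m k + 1) M \<and>
     (\<forall>s'\<in>set_pmf M. valid_mem s' \<and> (?G s \<longrightarrow> ?G s') \<and> (\<forall>k\<ge>0. s' ''lc'' k = s ''lc'' k)) \<and>
     measure_pmf.prob M {s. \<not> ?G s} \<le> 1 - \<delta>" by blast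
qed

end

section \<open>The complete algorithm\<close>

definition bounds :: "nat \<Rightarrow> aexp list" where
  "bounds a = Num a # Cell ''input'' (Num 0) # replicate 6 (reg ''L'')"

text \<open>The initial pass measures the input: afterwards \<open>p\<close> points just behind the
  last table, and this length becomes \<open>L\<close>.\<close>

definition algorithm :: "nat \<Rightarrow> com" where
  "algorithm a = pass ;; assign ''L'' (reg ''p'') ;; nest (bounds a) trial"

definition algorithm_time :: "nat \<Rightarrow> nat \<Rightarrow> nat \<Rightarrow> nat \<Rightarrow> nat \<Rightarrow> nat" where
  "algorithm_time a n m L k = pass_time m k +
     nest_time (a # n # replicate 6 L) (loop_time n 5 + rest_time n m k + 1) + 3"

context tf_csp
begin

lemma result_algorithm:
  assumes k: "\<And>C. C \<in> set I \<Longrightarrow> arity C \<le> k"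
  defines "\<delta> \<equiv> 1 / (48 * 8 ^ k * sqrt (real D))" and "L \<equiv> constr_pos I m"
  assumes d1: "\<delta> \<le> 1"
  shows "\<exists>M. result (algorithm a) (input_mem (encode_csp n I)) (algorithm_time a n m L k) M \<and>
    measure_pmf.prob M {s. \<not> random_val n I + \<delta> \<le> csp_val I (output_assignment n s)} \<le> (1 - \<delta>) ^ (a * n * L ^ 6)"
proof -
  let ?s = "input_mem (encode_csp n I)"
  let ?G = "\<lambda>s :: mem. m * (random_val n I + \<delta>) \<le> real (s ''best'' 0)"
  have zero: "?s v i = 0" if "v \<noteq> ''input''" for v i using that by (simp add: input_mem_def)
  have "?s ''y'' v \<le> 1 \<and> ?s ''x'' v \<le> 1 \<and> ?s ''g'' v \<le> 1" if "v < n" for v by (simp add: zero)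
  from exec_pass[OF refl this inst k] obtain s1 where e1: "exec pass ?s (pass_time m k) s1"
    and p: "s1 ''p'' 0 = L" unfolding L_def by blast
  have s1: "s1 v = ?s v" if "v \<in> set [''input'', ''best'', ''output'']" for v
    using that by (intro exec_frame[OF e1]) (auto simp: arrays_written_pass)
  define s2 where "s2 = write_cell ''L'' 0 L s1"
  have e2: "exec (assign ''L'' (reg ''p'')) s1 1 s2"
    using exec_straight[of "assign ''L'' (reg ''p'')" s1] by (simp add: s2_def p)
  have csp0: "0 \<le> csp_val I x" for x by (simp add: csp_val_def)
  have s2: "valid_mem s2"
    using s1 csp0 by (simp add: s2_def valid_mem_def write_cell_def L_def zero)
  have amp: "amplifies valid_mem ?G (nest (bounds a) trial) (length (bounds a))
     (nest_time (a # n # replicate 6 L) (loop_time n 5 + rest_time n m k + 1)) ((1 - \<delta>) ^ prod_list (a # n # replicate 6 L))"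
  proof (rule amplifies_nest)
    show "amplifies valid_mem ?G trial 0 (loop_time n 5 + rest_time n m k + 1) (1 - \<delta>)"
      unfolding \<delta>_def by (rule amplifies_trial) (rule k)
    show "valid_mem (write_cell ''lc'' d i s) = valid_mem s" for d i s
      by (simp add: valid_mem_def write_cell_def output_assignment_def)
    show "?G (write_cell ''lc'' d i s) = ?G s" for d i s by (simp add: write_cell_def)
    show "list_all2 (\<lambda>e N. aval e s = N) (bounds a) (a # n # replicate 6 L)" if "valid_mem s" for s
      using that input_encode_csp(1)[of n I]
      by (simp add: bounds_def valid_mem_def L_def list_all2_conv_all_nth nth_Cons split: nat.split)
  qed (use d1 in \<open>simp_all add: bounds_def\<close>)
  then obtain M where M: "result (nest (bounds a) trial) s2
       (nest_time (a # n # replicate 6 L) (loop_time n 5 + rest_time n m k + 1)) M"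
    "\<And>s'. s' \<in> set_pmf M \<Longrightarrow> valid_mem s'"
    "measure_pmf.prob M {s. \<not> ?G s} \<le> (1 - \<delta>) ^ prod_list (a # n # replicate 6 L)"
    using s2 unfolding amplifies_def by blast
  have "result (assign ''L'' (reg ''p'') ;; nest (bounds a) trial) s1
      (1 + nest_time (a # n # replicate 6 L) (loop_time n 5 + rest_time n m k + 1) + 1) (return_pmf s2 \<bind> (\<lambda>_. M))"
    by (rule result_Seq[OF e2[unfolded exec_def]]) (use M in auto)
  then have 2: "result (assign ''L'' (reg ''p'') ;; nest (bounds a) trial) s1
      (1 + nest_time (a # n # replicate 6 L) (loop_time n 5 + rest_time n m k + 1) + 1) M"
    by (simp only: bind_return_pmf)
  have "result (algorithm a) ?s (pass_time m k +
      (1 + nest_time (a # n # replicate 6 L) (loop_time n 5 + rest_time n m k + 1) + 1) + 1) (return_pmf s1 \<bind> (\<lambda>_. M))"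
    unfolding algorithm_def by (rule result_Seq[OF e1[unfolded exec_def]]) (use 2 in auto)
  then have "result (algorithm a) ?s (algorithm_time a n m L k) M"
    unfolding bind_return_pmf by (rule result_weaken) (simp add: algorithm_time_def del: nest_time.simps)
  moreover have "measure_pmf.prob M {s. \<not> random_val n I + \<delta> \<le> csp_val I (output_assignment n s)} \<le>
      measure_pmf.prob M {s. \<not> ?G s}"
  proof (rule measure_pmf.finite_measure_mono_AE)
    \<comment> \<open>In a valid memory \<open>best\<close> is at most \<open>m\<close> times the
      value of the output, so a large \<open>best\<close> certifies the output.\<close>
    have "\<not> ?G s" if "valid_mem s" "\<not> random_val n I + \<delta> \<le> csp_val I (output_assignment n s)" for s
    proof -
      have "m * csp_val I (output_assignment n s) < m * (random_val n I + \<delta>)"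
        using that(2) nonempty by (intro mult_strict_left_mono) auto
      then show ?thesis using that(1) by (simp add: valid_mem_def)
    qed
    then show "AE s in measure_pmf M. s \<in> {s. \<not> random_val n I + \<delta> \<le> csp_val I (output_assignment n s)} \<longrightarrow>
        s \<in> {s. \<not> ?G s}"
      using M(2) by (auto intro!: AE_pmfI)
  qed simp
  moreover have "prod_list (a # n # replicate 6 L) = a * n * L ^ 6" by simp
  ultimately show ?thesis using M(3) by (intro exI[of _ M]) (auto intro: order_trans simp del: prod_list.Cons)
qed

end

section \<open>Polynomial bound on the running time\<close>

text \<open>One more factor \<open>Y\<close> absorbs an addition, so that running times can be
  tracked by exponents of \<open>Y\<close> alone.\<close>

lemma add_le_power:
  assumes "5 \<le> (Y :: nat)" "x \<le> Y ^ b" "y \<le> Y ^ b'" "b < e" "b' < e"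
  shows "x + y \<le> Y ^ e"
proof -
  have "Y ^ b \<le> Y ^ (e - 1)" "Y ^ b' \<le> Y ^ (e - 1)"
    using assms by (intro power_increasing; simp)+
  then have "x + y \<le> 2 * Y ^ (e - 1)" using assms(2,3) by linarith
  also have "\<dots> \<le> Y * Y ^ (e - 1)" using assms(1) by (intro mult_right_mono) auto
  also have "\<dots> = Y ^ e" using assms(4) by (simp add: power_eq_if)
  finally show ?thesis .
qed

lemma loop_time_le_power:
  assumes "5 \<le> (Y :: nat)" "N \<le> Y ^ p" "t \<le> Y ^ b" "1 \<le> b" "p + b + 2 \<le> e"
  shows "loop_time N t \<le> Y ^ e"
proof -
  have "t + 5 \<le> Y ^ (b + 1)"
    by (rule add_le_power[where b = b and b' = 1]) (use assms in simp_all)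
  then have "N * (t + 5) \<le> Y ^ p * Y ^ (b + 1)" using assms by (intro mult_mono) auto
  also have "\<dots> = Y ^ (p + b + 1)" by (simp add: power_add)
  finally show ?thesis
    unfolding loop_time_def
    by (rule add_le_power[where b' = 1, rotated]) (use assms in simp_all)
qed

text \<open>Exponents are added up with base \<open>m + n + 2 ^ k\<close>; absolute constants are
  absorbed by its square or cube. The factor \<open>a\<close> stays separate, as no power of the
  base bounds it.\<close>

lemma algorithm_time_le:
  assumes "1 \<le> m" "2 \<le> k" and L: "L \<le> 2 + m * (1 + k + 2 ^ k)"
  shows "algorithm_time a n m L k \<le> (a + 1) * (m + n + 2 ^ k) ^ 61"
proof -
  define Y where "Y = m + n + 2 ^ k"
  have "(2 :: nat) ^ 2 \<le> 2 ^ k" using assms by (intro power_increasing) auto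
  then have Y: "5 \<le> Y" using assms by (simp add: Y_def)
  have "k < 2 ^ k" by (rule less_exp)
  then have kmn: "k \<le> Y ^ 1" "m \<le> Y ^ 1" "n \<le> Y ^ 1" unfolding Y_def power_one_right by linarith+
  have "(5 :: nat) ^ 2 \<le> Y ^ 2" "(5 :: nat) ^ 3 \<le> Y ^ 3" using Y by (intro power_mono; simp)+
  then have c40: "40 \<le> Y ^ 3" and "25 \<le> Y ^ 2" by simp_all
  then have c: "c \<le> Y ^ 2" if "c \<le> 25" for c using that by linarith
  note plus = add_le_power[OF Y] and loop = loop_time_le_power[OF Y]
  have "loop_time k 15 \<le> Y ^ 5" by (rule loop[OF kmn(1) c]) simp_all
  then have "loop_time k 15 + 40 \<le> Y ^ 6" by (rule plus[OF _ c40]) simp_all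
  then have "loop_time m (loop_time k 15 + 40) \<le> Y ^ 9" by (rule loop[OF kmn(2)]) simp_all
  then have pass: "pass_time m k \<le> Y ^ 10"
    unfolding pass_time_def by (rule plus[OF _ c]) simp_all
  have "loop_time n 7 \<le> Y ^ 5" by (rule loop[OF kmn(3) c]) simp_all
  then have "3 * loop_time n 7 \<le> Y * Y ^ 5" using Y by (intro mult_mono) simp_all
  then have n7: "3 * loop_time n 7 \<le> Y ^ 6" by (simp flip: power_Suc)
  have "pass_time m k + pass_time m k \<le> Y ^ 11" by (rule plus[OF pass pass]) simp_all
  then have "2 * pass_time m k + 3 * loop_time n 7 \<le> Y ^ 12"
    unfolding mult_2 by (rule plus[OF _ n7]) simp_all
  then have rest: "rest_time n m k \<le> Y ^ 13"
    unfolding rest_time_def by (rule plus[OF _ c]) simp_all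
  have "loop_time n 5 \<le> Y ^ 5" by (rule loop[OF kmn(3) c]) simp_all
  then have "loop_time n 5 + rest_time n m k \<le> Y ^ 14" by (rule plus[OF _ rest]) simp_all
  then have t: "loop_time n 5 + rest_time n m k + 1 \<le> Y ^ 15" by (rule plus[OF _ c]) simp_all
  have "k + 2 ^ k \<le> Y ^ 2" by (rule plus[OF kmn(1), of _ 1]) (simp_all add: Y_def)
  then have "k + 2 ^ k + 1 \<le> Y ^ 3" by (rule plus[OF _ c]) simp_all
  then have "m * (k + 2 ^ k + 1) \<le> Y ^ 1 * Y ^ 3" using kmn(2) by (intro mult_mono) auto
  then have "m * (k + 2 ^ k + 1) \<le> Y ^ 4" by (simp flip: power_Suc)
  then have "m * (k + 2 ^ k + 1) + 2 \<le> Y ^ 5" by (rule plus[OF _ c]) simp_all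
  then have L5: "L \<le> Y ^ 5" using L by (simp add: add_ac)
  \<comment> \<open>\<open>L \<le> Y ^ 5\<close> and the overhead 2 of
    \<open>loop_time_le_power\<close> cost 7 per loop. Six loops lead from 15 to 57, the loop over
    the variables to 60, and the final additive constant to 61.\<close>
  have iter: "nest_time (replicate j L) (loop_time n 5 + rest_time n m k + 1) \<le> Y ^ (15 + 7 * j)" for j
  proof (induction j)
    case (Suc j)
    show ?case
      unfolding replicate_Suc nest_time.simps by (rule loop[OF L5 Suc.IH]) simp_all
  qed (use t in simp)
  let ?t = "nest_time (n # replicate 6 L) (loop_time n 5 + rest_time n m k + 1)"
  have "?t \<le> Y ^ 60"
    unfolding nest_time.simps(2)[of n] by (rule loop[OF kmn(3) iter]) simp_all
  then have "?t + 5 \<le> Y ^ 61" by (rule plus[OF _ c]) simp_all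
  then have "a * (?t + 5) \<le> a * Y ^ 61" by (rule mult_left_mono) simp
  moreover have "pass_time m k + 7 \<le> Y ^ 61" by (rule plus[OF pass c]) simp_all
  ultimately have "pass_time m k + (a * (?t + 5) + 4) + 3 \<le> (a + 1) * Y ^ 61" by (simp add: algebra_simps)
  then show ?thesis
    unfolding algorithm_time_def nest_time.simps(2)[of a] loop_time_def[of a] Y_def .
qed

lemma (in tf_csp) constr_pos_bounds:
  assumes k: "\<And>C. C \<in> set I \<Longrightarrow> arity C \<le> k"
  shows "constr_pos I m \<le> 2 + m * (1 + k + 2 ^ k)" "m \<le> constr_pos I m"
    and "C \<in> set I \<Longrightarrow> 2 + (1 + arity C + 2 ^ arity C) \<le> constr_pos I m"
proof -
  have "(\<Sum>l<m. length (encode_constr (I ! l))) \<le> (\<Sum>l<m. 1 + k + 2 ^ k)"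
    using k unfolding length_encode_constr by (intro sum_mono add_mono power_increasing) auto
  then show "constr_pos I m \<le> 2 + m * (1 + k + 2 ^ k)" by (simp add: constr_pos_def)
  have "(\<Sum>l<m. 1) \<le> (\<Sum>l<m. length (encode_constr (I ! l)))"
    unfolding length_encode_constr by (intro sum_mono) simp
  then show "m \<le> constr_pos I m" by (simp add: constr_pos_def)
  show "2 + (1 + arity C + 2 ^ arity C) \<le> constr_pos I m" if C: "C \<in> set I"
  proof -
    obtain l where l: "l < m" "I ! l = C" using C by (auto simp: in_set_conv_nth)
    have "length (encode_constr (I ! l)) \<le> (\<Sum>l<m. length (encode_constr (I ! l)))"
      using l(1) by (intro member_le_sum) auto
    then show ?thesis using l(2) by (simp add: constr_pos_def length_encode_constr)
  qed
qed

section \<open>High probability and the choice of constants\<close>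

text \<open>\<open>N\<close> trials in expectation succeed at least once, so
  \<open>a * n * N\<close> trials all fail with probability at most exp (- a n), and exp n \<ge>
  n.\<close>

lemma failure_le:
  fixes \<delta> :: real
  assumes "\<delta> \<le> 1" "1 \<le> \<delta> * real N" "1 \<le> n"
  shows "(1 - \<delta>) ^ (a * n * N) \<le> 1 / real n ^ a"
proof -
  have "(1 - \<delta>) ^ (a * n * N) \<le> exp (- \<delta>) ^ (a * n * N)"
    using assms(1) exp_ge_add_one_self[of "- \<delta>"] by (intro power_mono) auto
  also have "\<dots> = exp (- (\<delta> * real N * (real a * real n)))"
    by (simp add: exp_of_nat_mult[symmetric] mult_ac)
  also have "\<dots> \<le> exp (- (real a * real n))"
    using mult_right_mono[OF assms(2), of "real a * real n"] by simp
  also have "\<dots> = (1 / exp (real n)) ^ a"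
    by (simp add: exp_of_nat_mult exp_minus power_one_over inverse_eq_divide)
  also have "\<dots> \<le> (1 / real n) ^ a"
  proof (rule power_mono)
    have "real n \<le> exp (real n)" using exp_ge_add_one_self[of "real n"] by linarith
    then show "1 / exp (real n) \<le> 1 / real n" using assms(3) by (intro divide_left_mono) auto
  qed simp
  finally show ?thesis by (simp add: power_one_over)
qed

text \<open>High probability is expressed by an arbitrary exponent \<open>a\<close>, on which the
  program may depend. It is uniform in \<open>k\<close> and \<open>D\<close>, whose place
  \<open>L\<close> takes in the number of trials.\<close>

theorem theorem1p2:
  shows "\<exists>c f :: nat \<Rightarrow> real. f \<in> O(\<lambda>k. real k) \<and> (\<forall>k. c k = exp (- f k)) \<and>
    (\<forall>a :: nat. \<exists>(alg :: com) (A :: nat) (B :: nat).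
      \<forall>(n :: nat) (k :: nat) (D :: nat) (I :: constr list).
        csp_instance n I \<longrightarrow> I \<noteq> [] \<longrightarrow> triangle_free I \<longrightarrow>
        (\<forall>C \<in> set I. 2 \<le> arity C \<and> arity C \<le> k) \<longrightarrow>
        (\<forall>i < n. var_degree I i \<le> D) \<longrightarrow>
        (\<exists>T :: nat.
          real T \<le> real A * (real (length I) + real n + exp (real k)) ^ B \<and>
          halts_within T alg (input_mem (encode_csp n I)) \<and>
          measure_pmf.prob (run T alg (input_mem (encode_csp n I)))
            {(q, s). csp_val I (output_assignment n s) \<ge> random_val n I + c k / sqrt (real D)}
          \<ge> 1 - 1 / real n ^ a))"
proof -
  \<comment> \<open>64 = 8 * 8: one factor \<open>8 ^ k\<close> is the loss of a trial, the other
    exceeds 48 because \<open>k \<ge> 2\<close> whenever a constraint exists.\<close>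
  define f where "f k = real k * ln 64" for k
  define c where "c k = exp (- f k)" for k
  have c: "c k = 1 / 64 ^ k" for k
    by (simp add: c_def f_def exp_minus exp_of_nat_mult inverse_eq_divide)
  have fO: "f \<in> O(\<lambda>k. real k)" unfolding f_def by simp
  have main: "\<exists>T :: nat.
          real T \<le> real (a + 1) * (real (length I) + real n + exp (real k)) ^ 61 \<and>
          halts_within T (algorithm a) (input_mem (encode_csp n I)) \<and>
          measure_pmf.prob (run T (algorithm a) (input_mem (encode_csp n I)))
            {(q, s). csp_val I (output_assignment n s) \<ge> random_val n I + c k / sqrt (real D)}
          \<ge> 1 - 1 / real n ^ a"
    if inst: "csp_instance n I" and ne: "I \<noteq> []" and tf: "triangle_free I"
      and arity: "\<forall>C \<in> set I. 2 \<le> arity C \<and> arity C \<le> k" and deg: "\<forall>i < n. var_degree I i \<le> D"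
    for n k D I a
  proof -
    \<comment> \<open>\<open>L\<close> bounds only what occurs in the input. The largest arity
      \<open>k'\<close> and the degree bound \<open>D'\<close> occur there, and passing to them does
      not weaken the guarantee.\<close>
    define k' where "k' = Max (arity ` set I)"
    define D' where "D' = min D (length I)"
    have "var_degree I i \<le> length I" for i
    proof -
      have "card {l. l < length I \<and> i \<in> set (scope (I ! l))} \<le> card {..<length I}"
        by (rule card_mono) auto
      then show ?thesis by (simp add: var_degree_def)
    qed
    then interpret tf_csp n I D'
      using inst ne tf arity deg by unfold_locales (auto simp: D'_def)
    have k': "arity C \<le> k'" if "C \<in> set I" for C using that by (simp add: k'_def)
    obtain C0 where C0: "C0 \<in> set I" "arity C0 = k'"
      using Max_in[of "arity ` set I"] ne unfolding k'_def by fastforce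
    have kk: "2 \<le> k'" "k' \<le> k" using arity C0 by auto
    define L where "L = constr_pos I m"
    define \<delta> where "\<delta> = 1 / (48 * 8 ^ k' * sqrt (real D'))"
    have D': "1 \<le> D'" "D' \<le> D" "D' \<le> m" using D_pos by (simp_all add: D'_def Suc_le_eq)
    have sq: "1 \<le> sqrt (real D')" "sqrt (real D') \<le> real D'"
      using D' by (simp_all add: real_le_lsqrt power2_eq_square)
    have e8: "(8 :: real) ^ 2 \<le> 8 ^ k'" using kk by (intro power_increasing) auto
    have "1 * 1 * 1 \<le> 48 * 8 ^ k' * sqrt (real D')"
      using sq e8 by (intro mult_mono) auto
    then have "1 \<le> 48 * 8 ^ k' * sqrt (real D')" by simp
    then have d1: "\<delta> \<le> 1" unfolding \<delta>_def by (subst divide_le_eq_1) linarith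
    have "c k / sqrt (real D) \<le> 1 / 64 ^ k' / sqrt (real D')"
    proof (rule frac_le)
      show "c k \<le> 1 / 64 ^ k'" unfolding c using kk by (intro divide_left_mono power_increasing) auto
    qed (use D' in auto)
    also have "\<dots> \<le> \<delta>"
    proof -
      have "48 * 8 ^ k' \<le> (8 :: real) ^ k' * 8 ^ k'" using e8 by (intro mult_right_mono) auto
      also have "\<dots> = 64 ^ k'" by (simp flip: power_mult_distrib)
      finally have "48 * 8 ^ k' * sqrt (real D') \<le> 64 ^ k' * sqrt (real D')"
        by (rule mult_right_mono) simp
      then show ?thesis unfolding \<delta>_def divide_divide_eq_left
        using sq by (intro divide_left_mono) auto
    qed
    finally have thr: "c k / sqrt (real D) \<le> \<delta>" .
    have L: "L \<le> 2 + m * (1 + k' + 2 ^ k')" "m \<le> L" "2 + (1 + k' + 2 ^ k') \<le> L"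
      using constr_pos_bounds[OF k'] C0 by (auto simp: L_def)
    \<comment> \<open>The three factors 48, \<open>8 ^ k'\<close> and \<open>sqrt D'\<close> of
      \<open>1 / \<delta>\<close> are bounded by \<open>L ^ 2\<close>, \<open>L ^ 3\<close> and
      \<open>L\<close>.\<close>
    have "1 \<le> \<delta> * real (L ^ 6)"
    proof -
      have "(2 :: nat) ^ 2 \<le> 2 ^ k'" using kk by (intro power_increasing) auto
      then have L9: "9 \<le> L" "2 ^ k' \<le> L" using L kk by auto
      have "48 \<le> real L ^ 2" using power_mono[of 9 "real L" 2] L9 by simp
      moreover have "8 ^ k' \<le> real L ^ 3"
      proof -
        have "(8 :: real) ^ k' = (2 ^ k') ^ 3"
        proof -
          have "(2 :: real) ^ (k' * 3) = 2 ^ (3 * k')" by (simp only: mult.commute)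
          then show ?thesis unfolding power_mult by simp
        qed
        also have "\<dots> \<le> real L ^ 3" using L9(2) by (intro power_mono) (auto simp flip: of_nat_le_iff)
        finally show ?thesis .
      qed
      moreover have "sqrt (real D') \<le> real L" using sq(2) D' L(2) by linarith
      ultimately have "48 * 8 ^ k' * sqrt (real D') \<le> real L ^ 2 * real L ^ 3 * real L"
        by (intro mult_mono) auto
      also have "\<dots> = real (L ^ 6)" by (simp add: eval_nat_numeral)
      finally show ?thesis using sq by (simp add: \<delta>_def divide_simps)
    qed
    moreover have "1 \<le> n"
    proof -
      have "0 < m" using ne by simp
      moreover have "scope (I ! 0) \<noteq> []" using arity nth_mem[OF \<open>0 < m\<close>] by (force simp: arity_def)
      ultimately have "hd (scope (I ! 0)) < n" using sc_less hd_in_set by blast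
      then show ?thesis by simp
    qed
    ultimately have fail: "(1 - \<delta>) ^ (a * n * L ^ 6) \<le> 1 / real n ^ a" using d1 by (intro failure_le)
    define T where "T = algorithm_time a n m L k'"
    let ?s = "input_mem (encode_csp n I)"
    obtain M where M: "result (algorithm a) ?s T M"
      "measure_pmf.prob M {s. \<not> random_val n I + \<delta> \<le> csp_val I (output_assignment n s)} \<le> (1 - \<delta>) ^ (a * n * L ^ 6)"
      using result_algorithm[OF k', of a] d1 unfolding T_def L_def \<delta>_def by blast
    have run: "run T (algorithm a) ?s = map_pmf (Pair SKIP) M" using M(1) by (simp add: result_def)
    have "1 \<le> m" using ne by (cases I) auto
    then have "T \<le> (a + 1) * (m + n + 2 ^ k') ^ 61"
      unfolding T_def using kk(1) L(1) by (rule algorithm_time_le)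
    then have "real T \<le> real ((a + 1) * (m + n + 2 ^ k') ^ 61)" by (rule of_nat_mono)
    also have "\<dots> = real (a + 1) * (real m + real n + 2 ^ k') ^ 61"
      by (simp only: of_nat_mult of_nat_power of_nat_add of_nat_numeral)
    also have "\<dots> \<le> real (a + 1) * (real m + real n + exp (real k)) ^ 61"
    proof (intro mult_left_mono power_mono add_left_mono)
      have "(2 :: real) ^ k' \<le> 2 ^ k" using kk by (intro power_increasing) auto
      also have "\<dots> \<le> exp 1 ^ k" using exp_ge_add_one_self[of 1] by (intro power_mono) auto
      finally show "2 ^ k' \<le> exp (real k)" by (simp flip: exp_of_nat_mult)
    qed auto
    finally have "real T \<le> real (a + 1) * (real m + real n + exp (real k)) ^ 61" .
    moreover have "halts_within T (algorithm a) ?s" by (auto simp: halts_within_def run)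
    moreover have "1 - 1 / real n ^ a \<le> measure_pmf.prob (run T (algorithm a) ?s)
        {(q, s). csp_val I (output_assignment n s) \<ge> random_val n I + c k / sqrt (real D)}"
    proof -
      let ?A = "{s. random_val n I + \<delta> \<le> csp_val I (output_assignment n s)}"
      have "1 - 1 / real n ^ a \<le> 1 - measure_pmf.prob M (- ?A)"
        using M(2) fail by (simp add: Collect_neg_eq)
      also have "\<dots> = measure_pmf.prob M ?A"
        using measure_pmf.prob_compl[of ?A M] by (simp add: Compl_eq_Diff_UNIV)
      also have "\<dots> \<le> measure_pmf.prob (run T (algorithm a) ?s)
        {(q, s). csp_val I (output_assignment n s) \<ge> random_val n I + c k / sqrt (real D)}"
        unfolding run measure_map_pmf using thr by (intro measure_pmf.finite_measure_mono) auto
      finally show ?thesis .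
    qed
    ultimately show ?thesis by blast
  qed
  show ?thesis
    \<comment> \<open>The remaining witnesses are left open and found from \<open>main\<close>:
      \<open>algorithm a\<close>, \<open>a + 1\<close> and 61.\<close>
    by (intro exI[of _ c] exI[of _ f] conjI allI fO c_def, rule exI, rule exI, rule exI)
       (use main in blast)
qed

end
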